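(* Let $\alpha,\beta,\gamma>-1$, let $\Omega=\{(x_1,x_2): x_1>0,\ x_2>0,\ x_1+x_2<1\}$, let $\rho(x_1,x_2)=x_1^{\alpha}x_2^{\beta}(1-x_1-x_2)^{\gamma}$ on $\Omega$, and let $L$ be the generalised Helmholtz operator $$\begin{aligned}Lu=&-x_1(1-x_1)\partial_{x_1}^2u+2x_1x_2\,\partial_{x_1x_2}^2u-x_2(1-x_2)\partial_{x_2}^2u-\big(\alpha+1-(\alpha+\beta+\gamma+3)x_1\big)\partial_{x_1}u\\&-\big(\beta+1-(\alpha+\beta+\gamma+3)x_2\big)\partial_{x_2}u+(2+x_1^2+x_2^2)u.\end{aligned}$$ Then $L^2(\Omega,\rho)$ has an orthogonal basis formed by eigenfunctions of $L$ (in the weak sense defined in the context; in particular these eigenfunctions are elements of $W(\Omega,\rho,\rho\Phi)$). Moreover, the eigenvalues of $L$ are positive and can be ordered in a sequence tending to $\infty$.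
   Context: Notation: $\mathcal{P}$ is the space of real polynomials in two variables. Let $$\Phi=\begin{pmatrix}x_1(1-x_1)&-x_1x_2\\-x_1x_2&x_2(1-x_2)\end{pmatrix},$$ which is symmetric and positive-definite on $\Omega$. With $\rho$ as in the claim, $Lu=-\frac1\rho\mathrm{div}(\rho\Phi\nabla u)+(2+x_1^2+x_2^2)u$. Spaces. $L^2(\Omega,\rho)$ is the Hilbert space of (classes of) measurable $u:\Omega\to\mathbb{R}$ with $\int_\Omega u^2\rho\,dx_1dx_2<\infty$, with inner product $\langle u,v\rangle=\int_\Omega uv\rho\,dx_1dx_2$. $L^2(\Omega,\rho\Phi)$ is the space of (a.e.-equality classes of) measurable $u:\Omega\to\mathbb{R}^2$ with $\int_\Omega u^t\rho\Phi u\,dx_1dx_2<\infty$. The weak gradient of $u\in L^2(\Omega,\rho)$, when it exists, is a function $h\in L^2(\Omega,\rho\Phi)$, denoted $\nabla u$, such that $\int_\Omega u\,\mathrm{div}(\rho\Phi v)\,dx_1dx_2=-\int_\Omega h^t\rho\Phi v\,dx_1dx_2$ for all $v\in\mathcal{P}\times\mathcal{P}$. $W^{1,2}(\Omega,\rho,\rho\Phi)=\{u\in L^2(\Omega,\rho):\nabla u\in L^2(\Omega,\rho\Phi)\}$, normed by $\|u\|=\left(\int_\Omega u^2\rho\,dx_1dx_2+\int_\Omega(\nabla u)^t\rho\Phi\nabla u\,dx_1dx_2\right)^{1/2}$, and $W(\Omega,\rho,\rho\Phi)$ is the closure of $\mathcal{P}$ in $W^{1,2}(\Omega,\rho,\rho\Phi)$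 for this norm. Eigenfunctions. The problem $Lu=f$ on $\Omega$ is considered with the boundary condition $(\rho\Phi\nabla u)\cdot\overrightarrow{n}=0$ on $\partial\Omega$. For $f\in L^2(\Omega,\rho)$, a weak solution is $u\in W(\Omega,\rho,\rho\Phi)$ such that $$\int_\Omega(\nabla v)^t\rho\Phi\nabla u\,dx_1dx_2+\int_\Omega(2+x_1^2+x_2^2)vu\rho\,dx_1dx_2=\int_\Omega vf\rho\,dx_1dx_2\quad\text{for all }v\in W(\Omega,\rho,\rho\Phi).$$ An eigenfunction of $L$ with eigenvalue $\nu$ is a nonzero $u\in W(\Omega,\rho,\rho\Phi)$ that is a weak solution of this problem with $f=\nu u$. *)

theory Defs
  imports "HOL-Analysis.Analysis"
begin

definition partial :: "2 \<Rightarrow> (real^2 \<Rightarrow> real) \<Rightarrow> real^2 \<Rightarrow> real" where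
  "partial i u x = frechet_derivative u (at x) (axis i 1)"

definition gradient :: "(real^2 \<Rightarrow> real) \<Rightarrow> real^2 \<Rightarrow> real^2" where
  "gradient u x = (\<chi> i. partial i u x)"

definition divg :: "(real^2 \<Rightarrow> real^2) \<Rightarrow> real^2 \<Rightarrow> real" where
  "divg F x = (\<Sum>i\<in>UNIV. partial i (\<lambda>y. F y $ i) x)"

text \<open>Intended for open \<open>\<Omega>\<close>: \<^const>\<open>partial\<close> uses the full derivative at the point.\<close>

definition C2_on :: "(real^2) set \<Rightarrow> (real^2 \<Rightarrow> real) \<Rightarrow> bool" where
  "C2_on \<Omega> u \<longleftrightarrow> u differentiable_on \<Omega> \<and> (\<forall>i. partial i u differentiable_on \<Omega>) \<and>
     (\<forall>i j. continuous_on \<Omega> (partial i (partial j u)))"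

definition has_divergence_form ::
    "(real^2) set \<Rightarrow> (real^2 \<Rightarrow> real) \<Rightarrow> (real^2 \<Rightarrow> real^2^2) \<Rightarrow> (real^2 \<Rightarrow> real) \<Rightarrow>
     ((real^2 \<Rightarrow> real) \<Rightarrow> real^2 \<Rightarrow> real) \<Rightarrow> bool" where
  "has_divergence_form \<Omega> \<rho> \<Phi> q L \<longleftrightarrow>
     (\<forall>u. C2_on \<Omega> u \<longrightarrow> (\<forall>x\<in>\<Omega>.
        L u x = - (1 / \<rho> x) * divg (\<lambda>y. \<rho> y *\<^sub>R (\<Phi> y *v gradient u y)) x + q x * u x))"

text \<open>
  Elements of the spaces are represented by functions on the whole plane of which only the values
  on \<open>\<Omega>\<close> matter; functions are to be identified when they agree almost everywhere on
  \<open>\<Omega>\<close>.  The polynomials in two variables are the functions satisfying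
  \<^const>\<open>real_polynomial_function\<close>.
\<close>

definition L2w :: "(real^2) set \<Rightarrow> (real^2 \<Rightarrow> real) \<Rightarrow> (real^2 \<Rightarrow> real) set" where
  "L2w \<Omega> \<rho> = {u. u \<in> borel_measurable (lebesgue_on \<Omega>) \<and>
                 integrable (lebesgue_on \<Omega>) (\<lambda>x. (u x)\<^sup>2 * \<rho> x)}"

definition L2w_inner ::
    "(real^2) set \<Rightarrow> (real^2 \<Rightarrow> real) \<Rightarrow> (real^2 \<Rightarrow> real) \<Rightarrow> (real^2 \<Rightarrow> real) \<Rightarrow> real" where
  "L2w_inner \<Omega> \<rho> u v = (\<integral>x. u x * v x * \<rho> x \<partial>lebesgue_on \<Omega>)"

definition L2w_vec ::
    "(real^2) set \<Rightarrow> (real^2 \<Rightarrow> real) \<Rightarrow> (real^2 \<Rightarrow> real^2^2) \<Rightarrow> (real^2 \<Rightarrow> real^2) set" where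
  "L2w_vec \<Omega> \<rho> \<Phi> = {h. h \<in> borel_measurable (lebesgue_on \<Omega>) \<and>
                 integrable (lebesgue_on \<Omega>) (\<lambda>x. h x \<bullet> (\<rho> x *\<^sub>R (\<Phi> x *v h x)))}"

definition is_weak_gradient ::
    "(real^2) set \<Rightarrow> (real^2 \<Rightarrow> real) \<Rightarrow> (real^2 \<Rightarrow> real^2^2) \<Rightarrow>
     (real^2 \<Rightarrow> real) \<Rightarrow> (real^2 \<Rightarrow> real^2) \<Rightarrow> bool" where
  "is_weak_gradient \<Omega> \<rho> \<Phi> u h \<longleftrightarrow> h \<in> L2w_vec \<Omega> \<rho> \<Phi> \<and>
     (\<forall>v. (\<forall>i. real_polynomial_function (\<lambda>x. v x $ i)) \<longrightarrow>
        (\<integral>x. u x * divg (\<lambda>y. \<rho> y *\<^sub>R (\<Phi> y *v v y)) x \<partial>lebesgue_on \<Omega>)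
          = - (\<integral>x. h x \<bullet> (\<rho> x *\<^sub>R (\<Phi> x *v v x)) \<partial>lebesgue_on \<Omega>))"

text \<open>A representative of the weak gradient, meaningful only for functions that have one.\<close>

definition weak_gradient ::
    "(real^2) set \<Rightarrow> (real^2 \<Rightarrow> real) \<Rightarrow> (real^2 \<Rightarrow> real^2^2) \<Rightarrow> (real^2 \<Rightarrow> real) \<Rightarrow> real^2 \<Rightarrow> real^2"
  where "weak_gradient \<Omega> \<rho> \<Phi> u = (SOME h. is_weak_gradient \<Omega> \<rho> \<Phi> u h)"

definition W12 ::
    "(real^2) set \<Rightarrow> (real^2 \<Rightarrow> real) \<Rightarrow> (real^2 \<Rightarrow> real^2^2) \<Rightarrow> (real^2 \<Rightarrow> real) set" where
  "W12 \<Omega> \<rho> \<Phi> = {u \<in> L2w \<Omega> \<rho>. \<exists>h. is_weak_gradient \<Omega> \<rho> \<Phi> u h}"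

definition W12_norm ::
    "(real^2) set \<Rightarrow> (real^2 \<Rightarrow> real) \<Rightarrow> (real^2 \<Rightarrow> real^2^2) \<Rightarrow> (real^2 \<Rightarrow> real) \<Rightarrow> real" where
  "W12_norm \<Omega> \<rho> \<Phi> u = sqrt
     ((\<integral>x. (u x)\<^sup>2 * \<rho> x \<partial>lebesgue_on \<Omega>) +
      (\<integral>x. weak_gradient \<Omega> \<rho> \<Phi> u x \<bullet> (\<rho> x *\<^sub>R (\<Phi> x *v weak_gradient \<Omega> \<rho> \<Phi> u x)) \<partial>lebesgue_on \<Omega>))"

definition W_space ::
    "(real^2) set \<Rightarrow> (real^2 \<Rightarrow> real) \<Rightarrow> (real^2 \<Rightarrow> real^2^2) \<Rightarrow> (real^2 \<Rightarrow> real) set" where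
  "W_space \<Omega> \<rho> \<Phi> = {u \<in> W12 \<Omega> \<rho> \<Phi>.
     \<forall>\<epsilon>>0. \<exists>p. real_polynomial_function p \<and> W12_norm \<Omega> \<rho> \<Phi> (\<lambda>x. u x - p x) < \<epsilon>}"

text \<open>
  Weak solutions of \<open>L u = f\<close> with boundary condition \<open>(\<rho> \<Phi> \<nabla>u) \<cdot> n = 0\<close>, where \<open>L\<close> is the operator
  with divergence form \<open>- (1/\<rho>) div (\<rho> \<Phi> \<nabla>u) + q u\<close>; the boundary condition is encoded in the fact
  that the test functions range over the whole of \<^const>\<open>W_space\<close>.  The conjunct
  \<^const>\<open>has_divergence_form\<close> ties the weak problem to \<open>L\<close>; for the operator of interest it is
  established in \<open>helmholtz_divergence_form\<close>.
\<close>

definition weak_solution ::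
    "(real^2) set \<Rightarrow> (real^2 \<Rightarrow> real) \<Rightarrow> (real^2 \<Rightarrow> real^2^2) \<Rightarrow> (real^2 \<Rightarrow> real) \<Rightarrow>
     ((real^2 \<Rightarrow> real) \<Rightarrow> real^2 \<Rightarrow> real) \<Rightarrow> (real^2 \<Rightarrow> real) \<Rightarrow> (real^2 \<Rightarrow> real) \<Rightarrow> bool" where
  "weak_solution \<Omega> \<rho> \<Phi> q L f u \<longleftrightarrow>
     has_divergence_form \<Omega> \<rho> \<Phi> q L \<and> f \<in> L2w \<Omega> \<rho> \<and> u \<in> W_space \<Omega> \<rho> \<Phi> \<and>
     (\<forall>v\<in>W_space \<Omega> \<rho> \<Phi>.
        (\<integral>x. weak_gradient \<Omega> \<rho> \<Phi> v x \<bullet> (\<rho> x *\<^sub>R (\<Phi> x *v weak_gradient \<Omega> \<rho> \<Phi> u x)) \<partial>lebesgue_on \<Omega>)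
        + (\<integral>x. q x * v x * u x * \<rho> x \<partial>lebesgue_on \<Omega>)
        = (\<integral>x. v x * f x * \<rho> x \<partial>lebesgue_on \<Omega>))"

definition eigenfunction ::
    "(real^2) set \<Rightarrow> (real^2 \<Rightarrow> real) \<Rightarrow> (real^2 \<Rightarrow> real^2^2) \<Rightarrow> (real^2 \<Rightarrow> real) \<Rightarrow>
     ((real^2 \<Rightarrow> real) \<Rightarrow> real^2 \<Rightarrow> real) \<Rightarrow> real \<Rightarrow> (real^2 \<Rightarrow> real) \<Rightarrow> bool" where
  "eigenfunction \<Omega> \<rho> \<Phi> q L \<nu> u \<longleftrightarrow>
     \<not> (AE x in lebesgue_on \<Omega>. u x = 0) \<and> weak_solution \<Omega> \<rho> \<Phi> q L (\<lambda>x. \<nu> * u x) u"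

definition eigenvalue ::
    "(real^2) set \<Rightarrow> (real^2 \<Rightarrow> real) \<Rightarrow> (real^2 \<Rightarrow> real^2^2) \<Rightarrow> (real^2 \<Rightarrow> real) \<Rightarrow>
     ((real^2 \<Rightarrow> real) \<Rightarrow> real^2 \<Rightarrow> real) \<Rightarrow> real \<Rightarrow> bool" where
  "eigenvalue \<Omega> \<rho> \<Phi> q L \<nu> \<longleftrightarrow> (\<exists>u. eigenfunction \<Omega> \<rho> \<Phi> q L \<nu> u)"

definition L2w_orthogonal_basis ::
    "(real^2) set \<Rightarrow> (real^2 \<Rightarrow> real) \<Rightarrow> (nat \<Rightarrow> real^2 \<Rightarrow> real) \<Rightarrow> bool" where
  "L2w_orthogonal_basis \<Omega> \<rho> e \<longleftrightarrow>
     (\<forall>n. e n \<in> L2w \<Omega> \<rho> \<and> \<not> (AE x in lebesgue_on \<Omega>. e n x = 0)) \<and>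
     (\<forall>m n. m \<noteq> n \<longrightarrow> L2w_inner \<Omega> \<rho> (e m) (e n) = 0) \<and>
     (\<forall>u\<in>L2w \<Omega> \<rho>. \<forall>\<epsilon>>0. \<exists>N c.
        (let r = (\<lambda>x. u x - (\<Sum>n<N. c n * e n x)) in sqrt (L2w_inner \<Omega> \<rho> r r) < \<epsilon>))"

definition std_triangle :: "(real^2) set" where
  "std_triangle = {x. x$1 > 0 \<and> x$2 > 0 \<and> x$1 + x$2 < 1}"

definition weight :: "real \<Rightarrow> real \<Rightarrow> real \<Rightarrow> real^2 \<Rightarrow> real" where
  "weight \<alpha> \<beta> \<gamma> x = x$1 powr \<alpha> * x$2 powr \<beta> * (1 - x$1 - x$2) powr \<gamma>"

definition coeff_mat :: "real^2 \<Rightarrow> real^2^2" where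
  "coeff_mat x = vector [vector [x$1 * (1 - x$1), - x$1 * x$2],
                         vector [- x$1 * x$2, x$2 * (1 - x$2)]]"

definition potential :: "real^2 \<Rightarrow> real" where
  "potential x = 2 + (x$1)\<^sup>2 + (x$2)\<^sup>2"

definition helmholtz ::
    "real \<Rightarrow> real \<Rightarrow> real \<Rightarrow> (real^2 \<Rightarrow> real) \<Rightarrow> real^2 \<Rightarrow> real" where
  "helmholtz \<alpha> \<beta> \<gamma> u x =
     - x$1 * (1 - x$1) * partial 1 (partial 1 u) x
     + 2 * x$1 * x$2 * partial 1 (partial 2 u) x
     - x$2 * (1 - x$2) * partial 2 (partial 2 u) x
     - (\<alpha> + 1 - (\<alpha> + \<beta> + \<gamma> + 3) * x$1) * partial 1 u x
     - (\<beta> + 1 - (\<alpha> + \<beta> + \<gamma> + 3) * x$2) * partial 2 u x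
     + (2 + (x$1)\<^sup>2 + (x$2)\<^sup>2) * u x"

lemma open_triangle: "open std_triangle"
proof -
  have "open ({x::real^2. 0 < x$1} \<inter> ({x. 0 < x$2} \<inter> {x. x$1 + x$2 < 1}))"
    by (intro open_Int open_Collect_less continuous_intros)
  moreover have "std_triangle = {x. 0 < x$1} \<inter> ({x. 0 < x$2} \<inter> {x. x$1 + x$2 < 1})"
    by (auto simp: std_triangle_def)
  ultimately show ?thesis by (rule ssubst[rotated])
qed

lemma partial_eqI: "(u has_derivative u') (at x) \<Longrightarrow> partial i u x = u' (axis i 1)"
  unfolding partial_def using frechet_derivative_at by metis

lemma partial_line:
  assumes "u differentiable (at (a + t *\<^sub>R axis i 1))"
  shows "((\<lambda>s. u (a + s *\<^sub>R axis i 1)) has_real_derivative partial i u (a + t *\<^sub>R axis i 1)) (at t)"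
proof -
  let ?p = "a + t *\<^sub>R axis i 1"
  let ?D = "frechet_derivative u (at ?p)"
  have D: "(u has_derivative ?D) (at ?p)"
    using assms frechet_derivative_works by blast
  have "((\<lambda>s. a + s *\<^sub>R axis i (1::real)) has_derivative (\<lambda>s. s *\<^sub>R axis i 1)) (at t)"
    by (auto intro!: derivative_eq_intros)
  from has_derivative_compose[OF this D]
  have "((\<lambda>s. u (a + s *\<^sub>R axis i 1)) has_derivative (\<lambda>s. ?D (s *\<^sub>R axis i 1))) (at t)" .
  moreover have "?D (s *\<^sub>R axis i 1) = partial i u ?p * s" for s
    using linear_cmul[OF has_derivative_linear[OF D]] by (simp add: partial_def)
  ultimately show ?thesis
    by (simp add: has_field_derivative_def)
qed

lemma second_difference:
  assumes u: "C2_on (ball x r) u" and h: "0 < h" "2 * h < r"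
  shows "\<exists>p. dist x p \<le> 2 * h \<and>
    u (x + h *\<^sub>R axis i 1 + h *\<^sub>R axis j 1) - u (x + h *\<^sub>R axis i 1)
      - u (x + h *\<^sub>R axis j 1) + u x = h\<^sup>2 * partial j (partial i u) p"
proof -
  let ?e = "axis i (1::real) :: real^2" and ?f = "axis j (1::real) :: real^2"
  have near: "dist x (x + s *\<^sub>R ?e + t *\<^sub>R ?f) \<le> 2 * h" if "0 \<le> s" "s \<le> h" "0 \<le> t" "t \<le> h" for s t
  proof -
    have "dist x (x + s *\<^sub>R ?e + t *\<^sub>R ?f) = norm (s *\<^sub>R ?e + t *\<^sub>R ?f)"
      by (metis add.assoc add_diff_cancel_left' dist_commute dist_norm)
    also have "\<dots> \<le> norm (s *\<^sub>R ?e) + norm (t *\<^sub>R ?f)"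
      by (rule norm_triangle_ineq)
    also have "\<dots> \<le> 2 * h" using that by simp
    finally show ?thesis .
  qed
  have diff: "u differentiable (at y)" "partial i u differentiable (at y)" if "y \<in> ball x r" for y
    using u that open_ball by (auto simp: C2_on_def differentiable_on_eq_differentiable_at)
  define g where "g s = u (x + s *\<^sub>R ?e + h *\<^sub>R ?f) - u (x + s *\<^sub>R ?e)" for s
  define g' where "g' s = partial i u (x + s *\<^sub>R ?e + h *\<^sub>R ?f) - partial i u (x + s *\<^sub>R ?e)" for s
  have in1: "x + s *\<^sub>R ?e + t *\<^sub>R ?f \<in> ball x r" if "0 \<le> s" "s \<le> h" "0 \<le> t" "t \<le> h" for s t
    using near[OF that] h by simp
  have g: "(g has_real_derivative g' s) (at s)" if "0 \<le> s" "s \<le> h" for s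
  proof -
    have swap: "x + s *\<^sub>R ?e + h *\<^sub>R ?f = (x + h *\<^sub>R ?f) + s *\<^sub>R ?e" for s
      by simp
    have "u differentiable (at ((x + h *\<^sub>R ?f) + s *\<^sub>R ?e))" "u differentiable (at (x + s *\<^sub>R ?e))"
      using diff(1)[OF in1[of s h]] diff(1)[OF in1[of s 0]] that h by (simp_all add: swap)
    from DERIV_diff[OF this[THEN partial_line]] show ?thesis
      unfolding g_def g'_def swap .
  qed
  obtain s where s: "0 < s" "s < h" and gs: "g h - g 0 = (h - 0) * g' s"
    using MVT2[of 0 h g g'] g h by auto
  have "((\<lambda>t. partial i u (x + s *\<^sub>R ?e + t *\<^sub>R ?f)) has_real_derivative
         partial j (partial i u) (x + s *\<^sub>R ?e + t *\<^sub>R ?f)) (at t)" if "0 \<le> t" "t \<le> h" for t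
    by (rule partial_line, rule diff(2), rule in1) (use s that in auto)
  then obtain t where t: "0 < t" "t < h"
      and "partial i u (x + s *\<^sub>R ?e + h *\<^sub>R ?f) - partial i u (x + s *\<^sub>R ?e + 0 *\<^sub>R ?f)
           = (h - 0) * partial j (partial i u) (x + s *\<^sub>R ?e + t *\<^sub>R ?f)"
    using MVT2[of 0 h "\<lambda>t. partial i u (x + s *\<^sub>R ?e + t *\<^sub>R ?f)"
        "\<lambda>t. partial j (partial i u) (x + s *\<^sub>R ?e + t *\<^sub>R ?f)"] h by blast
  with gs have "g h - g 0 = h\<^sup>2 * partial j (partial i u) (x + s *\<^sub>R ?e + t *\<^sub>R ?f)"
    by (simp add: g'_def power2_eq_square)
  moreover have "dist x (x + s *\<^sub>R ?e + t *\<^sub>R ?f) \<le> 2 * h"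
    using near[of s t] s t by simp
  ultimately show ?thesis
    by (intro exI[of _ "x + s *\<^sub>R ?e + t *\<^sub>R ?f"]) (simp add: g_def algebra_simps)
qed

lemma partial_commute:
  assumes "C2_on \<Omega> u" "open \<Omega>" "x \<in> \<Omega>"
  shows "partial i (partial j u) x = partial j (partial i u) x"
proof -
  let ?a = "partial i (partial j u)" and ?b = "partial j (partial i u)"
  obtain r where r: "r > 0" "ball x r \<subseteq> \<Omega>"
    using assms by (meson open_contains_ball)
  have C2: "C2_on (ball x r) u"
    using assms(1) r unfolding C2_on_def
    by (meson continuous_on_subset differentiable_on_subset)
  define h where "h n = r / 4 * inverse (real (Suc n))" for n
  have h: "0 < h n" "2 * h n < r" for n
  proof -
    have "inverse (real (Suc n)) \<le> 1" "0 < inverse (real (Suc n))"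
      by (auto simp: inverse_le_1_iff)
    then have "h n \<le> r / 4 * 1" "0 < h n"
      unfolding h_def using r by (intro mult_left_mono mult_pos_pos; simp)+
    then show "0 < h n" "2 * h n < r" using r by auto
  qed
  have h0: "(\<lambda>n. 2 * h n) \<longlonglongrightarrow> 0"
    unfolding h_def using tendsto_mult_right_zero[OF LIMSEQ_inverse_real_of_nat, of "r / 2"]
    by simp
  have "\<exists>p. dist x p \<le> 2 * h n \<and> (\<exists>q. dist x q \<le> 2 * h n \<and> ?a p = ?b q)" for n
  proof -
    obtain p where p: "dist x p \<le> 2 * h n"
      and "u (x + h n *\<^sub>R axis j 1 + h n *\<^sub>R axis i 1) - u (x + h n *\<^sub>R axis j 1)
        - u (x + h n *\<^sub>R axis i 1) + u x = (h n)\<^sup>2 * ?a p"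
      using second_difference[OF C2 h, of n j i] by blast
    moreover obtain q where q: "dist x q \<le> 2 * h n"
      and "u (x + h n *\<^sub>R axis i 1 + h n *\<^sub>R axis j 1) - u (x + h n *\<^sub>R axis i 1)
        - u (x + h n *\<^sub>R axis j 1) + u x = (h n)\<^sup>2 * ?b q"
      using second_difference[OF C2 h, of n i j] by blast
    ultimately have "(h n)\<^sup>2 * ?a p = (h n)\<^sup>2 * ?b q"
      by (simp add: algebra_simps)
    then have "?a p = ?b q" using h[of n] by simp
    with p q show ?thesis by blast
  qed
  then obtain p q where p: "\<And>n. dist x (p n) \<le> 2 * h n" and q: "\<And>n. dist x (q n) \<le> 2 * h n"
    and eq: "\<And>n. ?a (p n) = ?b (q n)" by metis
  have lim: "z \<longlonglongrightarrow> x" if "\<And>n. dist x (z n) \<le> 2 * h n" for z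
    by (rule metric_tendsto_imp_tendsto[OF h0]) (use that h in \<open>auto simp: dist_commute less_imp_le\<close>)
  have "isCont ?a x" "isCont ?b x"
    using assms by (auto simp: C2_on_def continuous_on_eq_continuous_at)
  then have "(\<lambda>n. ?a (p n)) \<longlonglongrightarrow> ?a x" "(\<lambda>n. ?b (q n)) \<longlonglongrightarrow> ?b x"
    using lim[of p] lim[of q] p q by (auto intro: isCont_tendsto_compose)
  then show ?thesis
    using eq LIMSEQ_unique by auto
qed

lemma weight_has_derivative:
  assumes "x \<in> std_triangle"
  shows "(weight \<alpha> \<beta> \<gamma> has_derivative (\<lambda>h. weight \<alpha> \<beta> \<gamma> x *
    (\<alpha> * h$1 / x$1 + \<beta> * h$2 / x$2 - \<gamma> * (h$1 + h$2) / (1 - x$1 - x$2)))) (at x)"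
proof -
  have pos: "x$1 > 0" "x$2 > 0" "1 - x$1 - x$2 > 0"
    using assms by (auto simp: std_triangle_def)
  have pw: "((\<lambda>y. f y powr a) has_derivative (\<lambda>h. f x powr a * (a * f' h / f x))) (at x)"
    if "(f has_derivative f') (at x)" "f x > 0" for f :: "real^2 \<Rightarrow> real" and f' a
  proof -
    have "((\<lambda>z. z powr a) has_derivative (*) (a * f x powr (a - 1))) (at (f x))"
      using has_real_derivative_powr[OF that(2)] by (simp add: has_field_derivative_def)
    from has_derivative_compose[OF that(1) this] show ?thesis
      by (rule has_derivative_eq_rhs) (use that in \<open>auto simp: powr_diff field_simps\<close>)
  qed
  have c: "((\<lambda>y::real^2. y$i) has_derivative (\<lambda>h. h$i)) (at x)" for i
    by (rule bounded_linear.has_derivative[OF bounded_linear_vec_nth]) (rule has_derivative_ident)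
  have c3: "((\<lambda>y::real^2. 1 - y$1 - y$2) has_derivative (\<lambda>h. 0 - h$1 - h$2)) (at x)"
    by (intro has_derivative_diff has_derivative_const c)
  note m = has_derivative_mult[OF has_derivative_mult[OF pw[OF c pos(1)] pw[OF c pos(2)]] pw[OF c3 pos(3)],
      of \<alpha> \<beta> \<gamma>]
  show ?thesis
    unfolding weight_def[abs_def]
    by (rule has_derivative_eq_rhs[OF m]) (simp add: fun_eq_iff algebra_simps add_divide_distrib diff_divide_distrib)
qed

lemma partial_flux:
  assumes "x \<in> std_triangle"
    and "(a has_derivative a') (at x)" "(b has_derivative b') (at x)"
    and "p differentiable (at x)" "r differentiable (at x)"
  shows "partial i (\<lambda>y. weight \<alpha> \<beta> \<gamma> y * (a y * p y + b y * r y)) x = weight \<alpha> \<beta> \<gamma> x *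
     ((\<alpha> * axis i 1 $ 1 / x$1 + \<beta> * axis i 1 $ 2 / x$2
        - \<gamma> * (axis i 1 $ 1 + axis i 1 $ 2) / (1 - x$1 - x$2)) * (a x * p x + b x * r x)
      + a' (axis i 1) * p x + a x * partial i p x + b' (axis i 1) * r x + b x * partial i r x)"
proof -
  note p = assms(4)[unfolded frechet_derivative_works] and r = assms(5)[unfolded frechet_derivative_works]
  from partial_eqI[OF has_derivative_mult[OF weight_has_derivative[OF assms(1)]
      has_derivative_add[OF has_derivative_mult[OF assms(2) p] has_derivative_mult[OF assms(3) r]]]]
  show ?thesis
    by (simp add: partial_def[symmetric] algebra_simps)
qed

lemma helmholtz_divergence_form:
  "has_divergence_form std_triangle (weight \<alpha> \<beta> \<gamma>) coeff_mat potential (helmholtz \<alpha> \<beta> \<gamma>)"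
  unfolding has_divergence_form_def
proof (intro allI impI ballI)
  fix u :: "real^2 \<Rightarrow> real" and x :: "real^2"
  assume u: "C2_on std_triangle u" and x: "x \<in> std_triangle"
  let ?w = "weight \<alpha> \<beta> \<gamma>"
  define F where "F y = ?w y *\<^sub>R (coeff_mat y *v gradient u y)" for y
  define k where "k = 1 - x$1 - x$2"
  have pos: "x$1 > 0" "x$2 > 0" "k > 0"
    using x by (auto simp: std_triangle_def k_def)
  have w: "?w x > 0"
    using pos by (simp add: weight_def k_def)
  have p: "partial 1 u differentiable (at x)" "partial 2 u differentiable (at x)"
    using u x open_triangle by (auto simp: C2_on_def differentiable_on_eq_differentiable_at)
  have sym: "partial 2 (partial 1 u) x = partial 1 (partial 2 u) x"
    by (rule partial_commute[OF u open_triangle x])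
  have F1: "(\<lambda>y. F y $ 1) = (\<lambda>y. ?w y * ((y$1 * (1 - y$1)) * partial 1 u y + (- y$1 * y$2) * partial 2 u y))"
    and F2: "(\<lambda>y. F y $ 2) = (\<lambda>y. ?w y * ((- y$1 * y$2) * partial 1 u y + (y$2 * (1 - y$2)) * partial 2 u y))"
    by (auto simp: F_def coeff_mat_def gradient_def matrix_vector_mult_def sum_2)
  have c: "((\<lambda>y::real^2. y$i) has_derivative (\<lambda>h. h$i)) (at x)" for i
    by (rule bounded_linear.has_derivative[OF bounded_linear_vec_nth]) (rule has_derivative_ident)
  have d: "((\<lambda>y::real^2. y$i * (1 - y$i)) has_derivative (\<lambda>h. (1 - 2 * x$i) * h$i)) (at x)" for i
    by (rule has_derivative_eq_rhs[OF has_derivative_mult[OF c has_derivative_diff[OF has_derivative_const c]]])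
       (auto simp: algebra_simps)
  have o: "((\<lambda>y::real^2. - y$1 * y$2) has_derivative (\<lambda>h. - x$1 * h$2 - h$1 * x$2)) (at x)"
    by (rule has_derivative_eq_rhs[OF has_derivative_mult[OF has_derivative_minus[OF c] c]])
       (auto simp: algebra_simps)
  have D1: "partial 1 (\<lambda>y. F y $ 1) x = ?w x * ((\<alpha> / x$1 - \<gamma> / k) *
      (x$1 * (1 - x$1) * partial 1 u x - x$1 * x$2 * partial 2 u x) + (1 - 2 * x$1) * partial 1 u x
      + x$1 * (1 - x$1) * partial 1 (partial 1 u) x - x$2 * partial 2 u x
      - x$1 * x$2 * partial 1 (partial 2 u) x)"
    unfolding F1 partial_flux[OF x d o p] by (simp add: axis_def k_def)
  have D2: "partial 2 (\<lambda>y. F y $ 2) x = ?w x * ((\<beta> / x$2 - \<gamma> / k) *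
      (x$2 * (1 - x$2) * partial 2 u x - x$1 * x$2 * partial 1 u x) + (1 - 2 * x$2) * partial 2 u x
      + x$2 * (1 - x$2) * partial 2 (partial 2 u) x - x$1 * partial 1 u x
      - x$1 * x$2 * partial 1 (partial 2 u) x)"
    unfolding F2 partial_flux[OF x o d p] by (simp add: axis_def k_def sym algebra_simps)
  have "- (1 / ?w x) * divg F x =
      - (((\<alpha> / x$1 - \<gamma> / k) * (x$1 * (1 - x$1) * partial 1 u x - x$1 * x$2 * partial 2 u x)
          + (1 - 2 * x$1) * partial 1 u x
          + x$1 * (1 - x$1) * partial 1 (partial 1 u) x - x$2 * partial 2 u x
          - x$1 * x$2 * partial 1 (partial 2 u) x)
        + ((\<beta> / x$2 - \<gamma> / k) * (x$2 * (1 - x$2) * partial 2 u x - x$1 * x$2 * partial 1 u x)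
          + (1 - 2 * x$2) * partial 2 u x
          + x$2 * (1 - x$2) * partial 2 (partial 2 u) x - x$1 * partial 1 u x
          - x$1 * x$2 * partial 1 (partial 2 u) x))"
    using w unfolding divg_def sum_2 D1 D2 by (simp add: distrib_left[symmetric])
  moreover have "(\<alpha> / x$1 - \<gamma> / k) * (x$1 * (1 - x$1) * p1 - x$1 * x$2 * p2)
      + (\<beta> / x$2 - \<gamma> / k) * (x$2 * (1 - x$2) * p2 - x$1 * x$2 * p1)
    = (\<alpha> * (1 - x$1) - \<beta> * x$1 - \<gamma> * x$1) * p1 + (\<beta> * (1 - x$2) - \<alpha> * x$2 - \<gamma> * x$2) * p2" for p1 p2
  proof -
    have g: "(x$1 * (1 - x$1) * p1 - x$1 * x$2 * p2) + (x$2 * (1 - x$2) * p2 - x$1 * x$2 * p1)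
      = k * (x$1 * p1 + x$2 * p2)" by (simp add: k_def algebra_simps)
    have "(\<alpha> / x$1 - \<gamma> / k) * (x$1 * (1 - x$1) * p1 - x$1 * x$2 * p2)
      + (\<beta> / x$2 - \<gamma> / k) * (x$2 * (1 - x$2) * p2 - x$1 * x$2 * p1)
      = \<alpha> / x$1 * (x$1 * ((1 - x$1) * p1 - x$2 * p2)) + \<beta> / x$2 * (x$2 * ((1 - x$2) * p2 - x$1 * p1))
        - \<gamma> / k * ((x$1 * (1 - x$1) * p1 - x$1 * x$2 * p2) + (x$2 * (1 - x$2) * p2 - x$1 * x$2 * p1))"
      by (simp add: ring_distribs mult_ac)
    also have "\<dots> = \<alpha> * ((1 - x$1) * p1 - x$2 * p2) + \<beta> * ((1 - x$2) * p2 - x$1 * p1)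
        - \<gamma> * (x$1 * p1 + x$2 * p2)"
      unfolding g using pos by simp
    finally show ?thesis by (simp add: algebra_simps)
  qed
  note this[of "partial 1 u x" "partial 2 u x"]
  ultimately show "helmholtz \<alpha> \<beta> \<gamma> u x
    = - (1 / ?w x) * divg (\<lambda>y. ?w y *\<^sub>R (coeff_mat y *v gradient u y)) x + potential x * u x"
    unfolding F_def[abs_def, symmetric] helmholtz_def potential_def by (simp add: algebra_simps)
qed

end

theory Submission
  imports Defs "HOL-Library.Function_Algebras"
begin

text \<open>
  Without its potential the operator is \<open>L0 u = - (1/\<rho>) div (\<rho> \<Phi> \<nabla>u)\<close>.  It maps polynomials to
  polynomials without raising the degree, and on a monomial of degree \<open>d\<close> it is multiplication by
  \<open>d (d + \<alpha> + \<beta> + \<gamma> + 2)\<close> up to terms of lower degree (\<open>L0_monom2\<close>).  Integration by parts makes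
  it symmetric in \<open>L\<^sup>2(\<Omega>, \<rho>)\<close>: the boundary terms vanish because \<open>\<rho> \<Phi> \<nabla>u\<close> is a combination of
  fields tangent to the sides of the triangle, a fact that on monomials is the functional equation
  of the Gamma function in the Dirichlet integral, for all exponents above \<open>-1\<close>.  A symmetric
  operator that is triangular in a sequence of vectors is diagonalised by orthonormalising that
  sequence (\<open>triangular_eigenvector\<close>), so there is an orthonormal basis of polynomials \<open>\<phi> k\<close> in
  which the Dirichlet form is diagonal, with eigenvalues \<open>l k\<close> tending to infinity
  (\<open>eigenpolynomials\<close>).

  An integrable function orthogonal to all polynomials vanishes almost everywhere.  Hence weak
  gradients are unique, and \<open>u\<close> has one exactly when \<open>\<Sum>k. l k \<langle>u, \<phi> k\<rangle>\<^sup>2\<close> is finite; the partial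
  sums of its expansion then converge to \<open>u\<close> also in the norm of \<open>W\<^sup>1\<^sup>,\<^sup>2\<close>.  In particular the
  polynomials are dense in that space (\<open>W_space_eq\<close>).

  The potential lies between 2 and 4 and adds a bounded form to the diagonal one.  A bound on the
  energy makes the tails of the expansion uniformly small, so sets of bounded energy are relatively
  compact in \<open>L\<^sup>2(\<Omega>, \<rho>)\<close> (\<open>compact_sublevel\<close>), and eigenvectors are obtained one after the other
  by minimising the energy on the orthogonal complement of the earlier ones (\<open>spectral\<close>).  An
  orthonormal sequence has no convergent subsequence, so the minima \<open>\<nu> n\<close> tend to infinity.  What
  is left of an element of energy \<open>a\<close> after removing \<open>N\<close> eigenvectors has squared norm at most
  \<open>a / \<nu> N\<close>, which shows that the eigenvectors form a basis and that no eigenvalue is missed.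
\<close>

text \<open>With the pointwise linear structure, classes of functions become subspaces to which \<open>span\<close> and
  the abstract results on forms apply.\<close>

instantiation "fun" :: (type, real_vector) real_vector
begin

definition scaleR_fun_def: "scaleR c f = (\<lambda>x. c *\<^sub>R f x)"

instance
  by standard (auto simp: scaleR_fun_def fun_eq_iff algebra_simps)

end

lemma scaleR_fun_apply [simp]: "(c *\<^sub>R f) x = c *\<^sub>R f x"
  by (simp add: scaleR_fun_def)

lemma sum_fun_apply: "(\<Sum>i\<in>I. f i) x = (\<Sum>i\<in>I. f i x)"
  by (induction I rule: infinite_finite_induct) auto

section \<open>Semi-inner products and orthonormal systems\<close>

text \<open>The integrals to which this applies are bilinear only on the subspace where they converge, and
  they vanish on functions that are zero almost everywhere without being zero.  So the form is
  restricted to a subspace and may have null vectors, which \<open>null_orthogonal\<close> lets one ignore.\<close>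

locale semi_inner_on =
  fixes W :: "'a::real_vector set" and B :: "'a \<Rightarrow> 'a \<Rightarrow> real"
  assumes subspace: "subspace W"
    and add_left: "u \<in> W \<Longrightarrow> v \<in> W \<Longrightarrow> w \<in> W \<Longrightarrow> B (u + v) w = B u w + B v w"
    and scale_left: "u \<in> W \<Longrightarrow> w \<in> W \<Longrightarrow> B (c *\<^sub>R u) w = c * B u w"
    and sym: "u \<in> W \<Longrightarrow> v \<in> W \<Longrightarrow> B u v = B v u"
    and nonneg: "u \<in> W \<Longrightarrow> 0 \<le> B u u"
begin

lemma closed [simp, intro]:
  "0 \<in> W" "u \<in> W \<Longrightarrow> v \<in> W \<Longrightarrow> u + v \<in> W" "u \<in> W \<Longrightarrow> v \<in> W \<Longrightarrow> u - v \<in> W"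
  "u \<in> W \<Longrightarrow> c *\<^sub>R u \<in> W" "(\<And>i. i \<in> I \<Longrightarrow> f i \<in> W) \<Longrightarrow> (\<Sum>i\<in>I. f i) \<in> W"
  using subspace by (auto intro: subspace_0 subspace_add subspace_diff subspace_scale subspace_sum)

lemma add_right: "u \<in> W \<Longrightarrow> v \<in> W \<Longrightarrow> w \<in> W \<Longrightarrow> B w (u + v) = B w u + B w v"
  using add_left sym closed(2) by metis

lemma scale_right: "u \<in> W \<Longrightarrow> w \<in> W \<Longrightarrow> B w (c *\<^sub>R u) = c * B w u"
  using scale_left sym closed(4) by metis

lemma diff_left: "u \<in> W \<Longrightarrow> v \<in> W \<Longrightarrow> w \<in> W \<Longrightarrow> B (u - v) w = B u w - B v w"
  using add_left[of "u - v" v w] by auto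

lemma diff_right: "u \<in> W \<Longrightarrow> v \<in> W \<Longrightarrow> w \<in> W \<Longrightarrow> B w (u - v) = B w u - B w v"
  using add_right[of "u - v" v w] by auto

lemma zero_left: "w \<in> W \<Longrightarrow> B 0 w = 0"
  using scale_left[of 0 w 0] by auto

lemma sum_left:
  "w \<in> W \<Longrightarrow> (\<And>i. i \<in> I \<Longrightarrow> f i \<in> W) \<Longrightarrow> B (\<Sum>i\<in>I. f i) w = (\<Sum>i\<in>I. B (f i) w)"
  by (induction I rule: infinite_finite_induct) (auto simp: zero_left add_left)

lemma combination_left:
  "w \<in> W \<Longrightarrow> (\<And>i. i \<in> I \<Longrightarrow> f i \<in> W) \<Longrightarrow> B (\<Sum>i\<in>I. c i *\<^sub>R f i) w = (\<Sum>i\<in>I. c i * B (f i) w)"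
  by (subst sum_left) (auto simp: scale_left intro!: sum.cong)

lemma square_add: "u \<in> W \<Longrightarrow> v \<in> W \<Longrightarrow> B (u + v) (u + v) = B u u + 2 * B u v + B v v"
  by (simp add: add_left add_right sym)

lemma square_diff: "u \<in> W \<Longrightarrow> v \<in> W \<Longrightarrow> B (u - v) (u - v) = B u u - 2 * B u v + B v v"
  by (simp add: diff_left diff_right sym)

lemma square_diff_le: "u \<in> W \<Longrightarrow> v \<in> W \<Longrightarrow> B (u - v) (u - v) \<le> 2 * B u u + 2 * B v v"
  using nonneg[of "u + v"] by (simp add: square_add square_diff)

lemma square_scale: "u \<in> W \<Longrightarrow> B (c *\<^sub>R u) (c *\<^sub>R u) = c\<^sup>2 * B u u"
  by (simp add: scale_left scale_right power2_eq_square)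

lemma Cauchy_Schwarz:
  assumes u: "u \<in> W" and v: "v \<in> W"
  shows "(B u v)\<^sup>2 \<le> B u u * B v v"
proof -
  have q: "0 \<le> B u u - 2 * t * B u v + t\<^sup>2 * B v v" for t
    using nonneg[of "u - t *\<^sub>R v"] u v square_diff[of u "t *\<^sub>R v"] square_scale[of v t]
    by (simp add: scale_right mult_ac)
  show ?thesis
  proof (cases "B v v = 0")
    case True
    \<comment> \<open>Now \<open>q\<close> is affine in \<open>t\<close> and stays nonnegative only if its slope is zero.\<close>
    have "B u v = 0"
    proof (rule ccontr)
      assume "B u v \<noteq> 0"
      with q[of "(B u u + 1) / (2 * B u v)"] True show False by simp
    qed
    then show ?thesis using True by simp
  next
    case False
    then have pos: "B v v > 0" using nonneg[OF v] by simp
    have "0 \<le> B u u - (B u v)\<^sup>2 / B v v"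
      using q[of "B u v / B v v"] pos by (simp add: power2_eq_square field_simps)
    then show ?thesis using pos by (simp add: field_simps)
  qed
qed

lemma null_orthogonal:
  assumes "u \<in> W" "v \<in> W" "B u u = 0"
  shows "B u v = 0"
  using Cauchy_Schwarz[OF assms(1,2)] assms(3) by simp

definition tends :: "(nat \<Rightarrow> 'a) \<Rightarrow> 'a \<Rightarrow> bool" where
  "tends u w \<longleftrightarrow> (\<lambda>n. B (u n - w) (u n - w)) \<longlonglongrightarrow> 0"

lemma tends_inner:
  assumes u: "\<And>n. u n \<in> W" and "w \<in> W" "v \<in> W" and t: "tends u w"
  shows "(\<lambda>n. B (u n) v) \<longlonglongrightarrow> B w v"
proof -
  have "(\<lambda>n. (B (u n - w) v)\<^sup>2) \<longlonglongrightarrow> 0"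
  proof (rule tendsto_sandwich[of "\<lambda>_. 0" _ _ "\<lambda>n. B (u n - w) (u n - w) * B v v"])
    show "(\<lambda>n. B (u n - w) (u n - w) * B v v) \<longlonglongrightarrow> 0"
      using tendsto_mult_left_zero[OF t[unfolded tends_def]] .
  qed (use assms Cauchy_Schwarz in auto)
  then have "(\<lambda>n. B (u n - w) v) \<longlonglongrightarrow> 0" by simp
  then show ?thesis
    using assms by (simp add: diff_left LIM_zero_iff)
qed

lemma tends_square:
  assumes u: "\<And>n. u n \<in> W" and w: "w \<in> W" and t: "tends u w"
  shows "(\<lambda>n. B (u n) (u n)) \<longlonglongrightarrow> B w w"
proof -
  have "(\<lambda>n. B (u n - w) (u n - w) + 2 * B (u n) w - B w w) \<longlonglongrightarrow> 0 + 2 * B w w - B w w"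
    using tends_inner[OF u w w t] t unfolding tends_def by (intro tendsto_intros)
  moreover have "B (u n - w) (u n - w) + 2 * B (u n) w - B w w = B (u n) (u n)" for n
    using u w by (simp add: square_diff)
  ultimately show ?thesis by simp
qed

definition orthonormal :: "(nat \<Rightarrow> 'a) \<Rightarrow> nat set \<Rightarrow> bool" where
  "orthonormal e I \<longleftrightarrow> (\<forall>i\<in>I. e i \<in> W) \<and> (\<forall>i\<in>I. \<forall>j\<in>I. B (e i) (e j) = (if i = j then 1 else 0))"

lemma orthonormal_in: "orthonormal e I \<Longrightarrow> i \<in> I \<Longrightarrow> e i \<in> W"
  by (simp add: orthonormal_def)

lemma orthonormal_eq:
  "orthonormal e I \<Longrightarrow> i \<in> I \<Longrightarrow> j \<in> I \<Longrightarrow> B (e i) (e j) = (if i = j then 1 else 0)"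
  by (simp add: orthonormal_def)

lemma orthonormal_subset: "orthonormal e I \<Longrightarrow> J \<subseteq> I \<Longrightarrow> orthonormal e J"
  unfolding orthonormal_def by blast

definition proj :: "(nat \<Rightarrow> 'a) \<Rightarrow> nat \<Rightarrow> 'a \<Rightarrow> 'a" where
  "proj e n u = (\<Sum>i<n. B u (e i) *\<^sub>R e i)"

lemma proj_in: "orthonormal e {..<n} \<Longrightarrow> proj e n u \<in> W"
  unfolding proj_def by (auto simp: orthonormal_in)

lemma residual_orthogonal:
  assumes e: "orthonormal e {..<n}" and u: "u \<in> W" and i: "i < n"
  shows "B (u - proj e n u) (e i) = 0"
proof -
  have "B (proj e n u) (e i) = (\<Sum>j<n. B u (e j) * B (e j) (e i))"
    unfolding proj_def using e i by (intro combination_left) (auto simp: orthonormal_in)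
  also have "\<dots> = (\<Sum>j<n. if j = i then B u (e j) else 0)"
    using e i by (intro sum.cong) (auto simp: orthonormal_eq)
  also have "\<dots> = B u (e i)" using i by simp
  finally show ?thesis
    using e u i by (subst diff_left) (auto simp: orthonormal_in proj_in)
qed

lemma residual_inner:
  assumes e: "orthonormal e {..<n}" and u: "u \<in> W" and v: "v \<in> W"
    and v0: "\<And>i. i < n \<Longrightarrow> B v (e i) = 0"
  shows "B v (u - proj e n u) = B v u"
proof -
  have "B (proj e n u) v = (\<Sum>j<n. B u (e j) * B (e j) v)"
    unfolding proj_def using e v by (intro combination_left) (auto simp: orthonormal_in)
  also have "\<dots> = 0"
    using v0 sym[OF v] e by (intro sum.neutral) (auto simp: orthonormal_in)
  finally have "B (proj e n u) v = 0" .
  then show ?thesis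
    using e u v sym[OF v proj_in[OF e]] by (subst diff_right) (auto simp: proj_in)
qed

text \<open>One computation serves both the Bessel inequality (\<open>A = B\<close>, \<open>l = 1\<close>) and the energy of the
  tail of an expansion in eigenvectors.\<close>

lemma residual_square:
  assumes A: "semi_inner_on V A" and V: "V \<subseteq> W" and e: "orthonormal e {..<n}"
    and eV: "\<And>i. i < n \<Longrightarrow> e i \<in> V" and u: "u \<in> V"
    and eig: "\<And>i v. i < n \<Longrightarrow> v \<in> V \<Longrightarrow> A v (e i) = l i * B v (e i)"
  shows "A (u - proj e n u) (u - proj e n u) = A u u - (\<Sum>i<n. l i * (B u (e i))\<^sup>2)"
proof -
  interpret A: semi_inner_on V A by fact
  let ?p = "proj e n u"
  have p: "?p \<in> V" unfolding proj_def using eV by auto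
  have comb: "A ?p v = (\<Sum>i<n. B u (e i) * A v (e i))" if "v \<in> V" for v
    unfolding proj_def using that eV
    by (subst A.combination_left) (auto intro!: sum.cong simp: A.sym)
  have "A ?p (u - ?p) = 0"
    using e u p V by (subst comb) (auto simp: eig residual_orthogonal subset_iff)
  moreover have "A ?p u = (\<Sum>i<n. l i * (B u (e i))\<^sup>2)"
    using u by (subst comb) (auto simp: eig power2_eq_square intro!: sum.cong)
  ultimately show ?thesis
    using u p by (simp add: A.diff_left A.diff_right A.sym)
qed

lemma Pythagoras:
  assumes "orthonormal e {..<n}" "u \<in> W"
  shows "B (u - proj e n u) (u - proj e n u) = B u u - (\<Sum>i<n. (B u (e i))\<^sup>2)"
  using residual_square[OF semi_inner_on_axioms subset_refl assms(1) _ assms(2), of "\<lambda>_. 1"] assms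
  by (simp add: orthonormal_in)

lemma Bessel:
  assumes "orthonormal e {..<n}" "u \<in> W"
  shows "(\<Sum>i<n. (B u (e i))\<^sup>2) \<le> B u u"
  using Pythagoras[OF assms] nonneg[of "u - proj e n u"] assms proj_in by auto

lemma orthogonal_combination_square:
  assumes I: "finite I" and f: "\<And>i. i \<in> I \<Longrightarrow> f i \<in> W"
    and orth: "\<And>i j. i \<in> I \<Longrightarrow> j \<in> I \<Longrightarrow> B (f i) (f j) = (if i = j then l i else 0)"
  shows "B (\<Sum>i\<in>I. c i *\<^sub>R f i) (\<Sum>i\<in>I. c i *\<^sub>R f i) = (\<Sum>i\<in>I. l i * (c i)\<^sup>2)"
proof -
  let ?s = "\<Sum>i\<in>I. c i *\<^sub>R f i"
  have s: "?s \<in> W" using f by auto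
  have c: "B (f j) ?s = l j * c j" if j: "j \<in> I" for j
  proof -
    have "B ?s (f j) = (\<Sum>i\<in>I. c i * B (f i) (f j))"
      using f j by (intro combination_left) auto
    also have "\<dots> = (\<Sum>i\<in>I. if i = j then l j * c j else 0)"
      using j by (intro sum.cong) (auto simp: orth)
    also have "\<dots> = l j * c j" using I j by simp
    finally show ?thesis using sym[OF s f[OF j]] by simp
  qed
  have "B ?s ?s = (\<Sum>i\<in>I. c i * B (f i) ?s)"
    using f s by (intro combination_left) auto
  then show ?thesis by (simp add: c power2_eq_square mult_ac)
qed

lemma orthogonal_series_Cauchy:
  fixes f :: "nat \<Rightarrow> 'a" and l c :: "nat \<Rightarrow> real"
  assumes f: "\<And>i. f i \<in> W" and orth: "\<And>i j. B (f i) (f j) = (if i = j then l i else 0)"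
    and bounded: "\<And>n. (\<Sum>k<n. l k * (c k)\<^sup>2) \<le> C" and \<epsilon>: "\<epsilon> > 0"
  defines "S \<equiv> \<lambda>n. \<Sum>k<n. c k *\<^sub>R f k"
  shows "\<exists>N. \<forall>i\<ge>N. \<forall>j\<ge>N. B (S i - S j) (S i - S j) \<le> \<epsilon>"
proof -
  let ?c = "\<lambda>k. l k * (c k)\<^sup>2"
  have l: "0 \<le> l k" for k using nonneg[OF f, of k] orth[of k k] by simp
  have S: "S n \<in> W" for n unfolding S_def using f by auto
  have *: "B (S i - S j) (S i - S j) = sum ?c {..<i} - sum ?c {..<j}" if "j \<le> i" for i j
  proof -
    have split: "{..<i} = {..<j} \<union> {j..<i}" using that by auto
    have "S i - S j = (\<Sum>k=j..<i. c k *\<^sub>R f k)"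
      unfolding S_def split by (subst sum.union_disjoint) auto
    then have "B (S i - S j) (S i - S j) = (\<Sum>k=j..<i. ?c k)"
      using orthogonal_combination_square[of "{j..<i}" f l c] f orth by simp
    also have "\<dots> = sum ?c {..<i} - sum ?c {..<j}"
      unfolding split by (subst sum.union_disjoint) auto
    finally show ?thesis .
  qed
  have "B (S i - S j) (S i - S j) = \<bar>sum ?c {..<i} - sum ?c {..<j}\<bar>" for i j
  proof (cases "j \<le> i")
    case True
    then show ?thesis using *[OF True] nonneg[of "S i - S j"] S by simp
  next
    case False
    have "B (S i - S j) (S i - S j) = B (S j - S i) (S j - S i)"
      unfolding square_diff[OF S S] sym[OF S S, of i j] by simp
    then show ?thesis using *[of i j] False nonneg[of "S j - S i"] S by simp
  qed
  moreover have "Cauchy (\<lambda>n. sum ?c {..<n})"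
  proof -
    have "summable ?c" by (rule summableI_nonneg_bounded[OF _ bounded]) (use l in auto)
    then show ?thesis by (simp add: summable_iff_convergent Cauchy_convergent_iff)
  qed
  ultimately show ?thesis using \<epsilon> by (auto simp: Cauchy_def dist_real_def) (meson less_imp_le)
qed

section \<open>Gram--Schmidt and triangular symmetric operators\<close>

text \<open>Independence is asked for modulo null vectors, so that the residuals can be normalised.  Each new
  vector lies in the span of those already treated, which gives the equality of all initial
  spans.\<close>

lemma Gram_Schmidt:
  fixes m :: "nat \<Rightarrow> 'a"
  assumes m: "\<And>n. m n \<in> W"
    and ind: "\<And>n v. v \<in> span (m ` {..<n}) \<Longrightarrow> B (m n - v) (m n - v) \<noteq> 0"
  obtains \<phi> where "orthonormal \<phi> UNIV" "\<And>n. \<phi> n \<in> span (m ` {..n})"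
    "\<And>n. span (\<phi> ` {..<n}) = span (m ` {..<n})"
proof -
  \<comment> \<open>The last conjunct makes each \<open>m n\<close> recoverable from the orthonormal vectors.\<close>
  define P where "P \<phi> n x \<longleftrightarrow> x \<in> span (m ` {..n}) \<and> B x x = 1 \<and> (\<forall>i<n. B x (\<phi> i) = 0)
      \<and> m n \<in> span (insert x (\<phi> ` {..<n}))" for \<phi> n x
  have spW: "span (m ` I) \<subseteq> W" for I
    using m by (intro span_minimal subspace) auto
  have mono: "span (m ` {..i}) \<subseteq> span (m ` {..<n})" if "i < n" for i n
    using that by (intro span_mono image_mono) auto
  have ex: "\<exists>x. P \<phi> n x" if IH: "\<And>i. i < n \<Longrightarrow> P \<phi> i (\<phi> i)" for \<phi> n
  proof -
    have W\<phi>: "\<phi> i \<in> W" if "i < n" for i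
      using IH[OF that] spW unfolding P_def by blast
    have "B (\<phi> i) (\<phi> j) = (if i = j then 1 else 0)" if "i < n" "j < n" for i j
    proof (cases i j rule: linorder_cases)
      case less
      then show ?thesis using IH[OF that(2)] sym[OF W\<phi>[OF that(1)] W\<phi>[OF that(2)]] by (auto simp: P_def)
    qed (use IH[OF that(1)] in \<open>auto simp: P_def\<close>)
    then have on: "orthonormal \<phi> {..<n}" using W\<phi> by (auto simp: orthonormal_def)
    let ?p = "proj \<phi> n (m n)"
    have pm: "?p \<in> span (m ` {..<n})" unfolding proj_def
      using IH mono by (intro span_sum span_scale) (unfold P_def, blast)
    have p\<phi>: "?p \<in> span (\<phi> ` {..<n})" unfolding proj_def
      by (intro span_sum span_scale span_base) auto
    define d where "d = m n - ?p"
    have d: "d \<in> W" unfolding d_def using m pm spW by auto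
    define c where "c = sqrt (B d d)"
    have "B d d > 0" using nonneg[OF d] ind[OF pm] by (simp add: d_def)
    then have c: "c > 0" "c\<^sup>2 = B d d" by (simp_all add: c_def)
    let ?x = "(1/c) *\<^sub>R d"
    have "?p \<in> span (m ` {..n})"
      using pm span_mono[of "m ` {..<n}" "m ` {..n}"] by fastforce
    then have "?x \<in> span (m ` {..n})"
      unfolding d_def by (intro span_scale span_diff) (auto intro: span_base)
    moreover have "B ?x ?x = 1"
      unfolding square_scale[OF d] c(2)[symmetric] using c(1) by (simp add: power_divide)
    moreover have "B ?x (\<phi> i) = 0" if "i < n" for i
      using residual_orthogonal[OF on m that] d W\<phi>[OF that] by (simp add: scale_left d_def)
    moreover have "m n = c *\<^sub>R ?x + ?p"
      using c by (simp add: d_def)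
    moreover have "c *\<^sub>R ?x + ?p \<in> span (insert ?x (\<phi> ` {..<n}))"
    proof (rule span_add)
      show "c *\<^sub>R ?x \<in> span (insert ?x (\<phi> ` {..<n}))" by (intro span_scale span_base insertI1)
      show "?p \<in> span (insert ?x (\<phi> ` {..<n}))" using p\<phi> span_mono[OF subset_insertI] by blast
    qed
    ultimately show ?thesis unfolding P_def by (intro exI[of _ ?x]) metis
  qed
  have "\<exists>\<phi>. \<forall>n. P \<phi> n (\<phi> n)"
  proof (rule dependent_wellorder_choice)
    show "P f n x = P g n x" if "\<And>i. i < n \<Longrightarrow> f i = g i" for f g n x
    proof -
      have "f ` {..<n} = g ` {..<n}" using that by auto
      then show ?thesis using that by (simp add: P_def)
    qed
  qed (rule ex)
  then obtain \<phi> where P: "\<And>n. P \<phi> n (\<phi> n)" by blast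
  have 1: "\<phi> n \<in> span (m ` {..n})" for n using P[of n] by (auto simp: P_def)
  then have W\<phi>: "\<phi> i \<in> W" for i using spW by blast
  have "B (\<phi> i) (\<phi> j) = (if i = j then 1 else 0)" for i j
  proof (cases i j rule: linorder_cases)
    case less
    then show ?thesis using P[of j] sym[OF W\<phi>[of i] W\<phi>[of j]] by (auto simp: P_def)
  qed (use P[of i] in \<open>auto simp: P_def\<close>)
  then have 2: "orthonormal \<phi> UNIV" using W\<phi> by (auto simp: orthonormal_def)
  have 3: "span (\<phi> ` {..<n}) = span (m ` {..<n})" for n
  proof
    show "span (\<phi> ` {..<n}) \<subseteq> span (m ` {..<n})"
      using 1 mono by (intro span_minimal subspace_span) blast
    have "m i \<in> span (\<phi> ` {..<n})" if "i < n" for i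
    proof -
      have "insert (\<phi> i) (\<phi> ` {..<i}) \<subseteq> \<phi> ` {..<n}" using that by auto
      then show ?thesis using P[of i] span_mono unfolding P_def by blast
    qed
    then show "span (m ` {..<n}) \<subseteq> span (\<phi> ` {..<n})"
      by (intro span_minimal subspace_span) auto
  qed
  show thesis using that[OF 2 1 3] .
qed

text \<open>Each space \<open>S n\<close> spanned by the first \<open>n\<close> vectors is invariant under \<open>T\<close>, and on the
  quotient \<open>S (n + 1) / S n\<close> the operator acts as the number \<open>l n\<close>.  Symmetry then forces
  \<open>T (\<phi> n) - l n \<phi> n\<close>, an element of \<open>S n\<close>, to be orthogonal to \<open>S n\<close>.\<close>

lemma triangular_eigenvector:
  assumes on: "orthonormal \<phi> UNIV" and \<phi>: "\<And>n. \<phi> n \<in> span (m ` {..n})"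
    and sp: "\<And>n. span (\<phi> ` {..<n}) = span (m ` {..<n})"
    and m: "\<And>n. m n \<in> W"
    and Tadd: "\<And>u v. u \<in> span (range m) \<Longrightarrow> v \<in> span (range m) \<Longrightarrow> T (u + v) = T u + T v"
    and Tscale: "\<And>c u. u \<in> span (range m) \<Longrightarrow> T (c *\<^sub>R u) = c *\<^sub>R T u"
    and Tsym: "\<And>u v. u \<in> span (range m) \<Longrightarrow> v \<in> span (range m) \<Longrightarrow> B (T u) v = B u (T v)"
    and tri: "\<And>n. T (m n) - l n *\<^sub>R m n \<in> span (m ` {..<n})"
  shows "B (T (\<phi> n) - l n *\<^sub>R \<phi> n) (T (\<phi> n) - l n *\<^sub>R \<phi> n) = 0"
proof -
  let ?S = "\<lambda>n. span (m ` {..<n})"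
  have SR: "?S k \<subseteq> span (range m)" for k by (intro span_mono) auto
  have SW: "?S k \<subseteq> W" for k using m by (intro span_minimal subspace) auto
  have Smono: "?S j \<subseteq> ?S k" if "j \<le> k" for j k using that by (intro span_mono) auto
  have T0: "T 0 = 0" using Tscale[OF span_zero, of 0] by simp
  have "u \<in> ?S k \<and> T u \<in> ?S k" if "u \<in> ?S k" for u k
    using that
  proof (induction rule: span_induct_alt)
    case base
    show ?case by (simp add: T0 span_zero)
  next
    case (step c x y)
    then obtain j where j: "x = m j" "j < k" by auto
    have "T (m j) = (T (m j) - l j *\<^sub>R m j) + l j *\<^sub>R m j" by simp
    also have "\<dots> \<in> ?S k"
      using tri[of j] Smono[of j k] j by (intro span_add span_scale) (auto intro: span_base)
    finally have "T (m j) \<in> ?S k" .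
    moreover have "T (c *\<^sub>R x + y) = c *\<^sub>R T (m j) + T y"
      using step(2) SR j by (subst Tadd) (auto simp: Tscale span_base span_scale)
    ultimately show ?case
      using step j by (auto intro!: span_add span_scale intro: span_base)
  qed
  then have inv: "T u \<in> ?S k" if "u \<in> ?S k" for u k using that by blast
  have "\<phi> n \<in> span (insert (m n) (m ` {..<n}))"
    using \<phi>[of n] by (simp add: lessThan_Suc_atMost[symmetric] lessThan_Suc)
  then obtain a where a: "\<phi> n - a *\<^sub>R m n \<in> ?S n" by (auto simp: span_breakdown_eq)
  define s where "s = \<phi> n - a *\<^sub>R m n"
  have s: "s \<in> ?S n" using a by (simp add: s_def)
  let ?d = "T (\<phi> n) - l n *\<^sub>R \<phi> n"
  have \<phi>n: "\<phi> n = a *\<^sub>R m n + s" by (simp add: s_def)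
  have "T (\<phi> n) = a *\<^sub>R T (m n) + T s"
    using s SR unfolding \<phi>n by (subst Tadd) (auto simp: Tscale span_base span_scale)
  then have "?d = a *\<^sub>R (T (m n) - l n *\<^sub>R m n) + (T s - l n *\<^sub>R s)"
    by (simp add: \<phi>n algebra_simps)
  also have "\<dots> \<in> ?S n"
    by (intro span_add span_scale span_diff tri inv s)
  finally have d: "?d \<in> ?S n" .
  have \<phi>R: "\<phi> n \<in> span (range m)" using \<phi>[of n] span_mono[of "m ` {..n}" "range m"] by auto
  have \<phi>W: "\<phi> n \<in> W" using on by (simp add: orthonormal_in)
  have orth: "B (\<phi> n) v = 0" if "v \<in> ?S n" for v
  proof -
    have v: "v \<in> span (\<phi> ` {..<n})" using that sp by simp
    have "subspace {v \<in> W. B (\<phi> n) v = 0}"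
      using \<phi>W by (auto simp: subspace_def add_right scale_right sym[of _ 0] zero_left)
    moreover have "\<phi> ` {..<n} \<subseteq> {v \<in> W. B (\<phi> n) v = 0}"
      using on by (auto simp: orthonormal_def)
    ultimately show ?thesis using v span_minimal by blast
  qed
  have TW: "T (\<phi> n) \<in> W"
  proof -
    have "?d + l n *\<^sub>R \<phi> n \<in> W" using d SW \<phi>W by blast
    then show ?thesis by simp
  qed
  have dW: "?d \<in> W" using d SW by blast
  have "B ?d ?d = B (T (\<phi> n)) ?d - l n * B (\<phi> n) ?d"
    using TW \<phi>W dW by (subst diff_left) (auto simp: scale_left)
  also have "B (T (\<phi> n)) ?d = B (\<phi> n) (T ?d)"
    using d SR \<phi>R by (intro Tsym) auto
  finally show ?thesis using orth[OF d] orth[OF inv[OF d]] by simp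
qed

end

section \<open>The spectral theorem for a form with compact sublevel sets\<close>

text \<open>Sublevel sets of \<open>A\<close> are compact for the norm of \<open>B\<close>, and \<open>A\<close> is lower semicontinuous along
  the convergent subsequence.  An infinite orthonormal sequence keeps the list of eigenvectors from
  ending.\<close>

locale compact_form = semi_inner_on W B + A: semi_inner_on W A
  for W :: "'a::real_vector set" and B A +
  assumes compact: "(\<And>n. u n \<in> W) \<Longrightarrow> (\<And>n. B (u n) (u n) \<le> C) \<Longrightarrow> (\<And>n. A (u n) (u n) \<le> C) \<Longrightarrow>
      \<exists>r w. strict_mono r \<and> w \<in> W \<and> tends (\<lambda>n. u (r n)) w
        \<and> (\<forall>a. (\<lambda>n. A (u n) (u n)) \<longlonglongrightarrow> a \<longrightarrow> A w w \<le> a)"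
    and infinite_dimensional: "\<exists>\<phi>. orthonormal \<phi> UNIV"
begin

text \<open>If all vectors orthogonal to \<open>n\<close> orthonormal vectors were null, each of \<open>n + 1\<close> further
  orthonormal vectors would be recovered with full norm from its \<open>n\<close> coefficients.  Summing the
  squared coefficients in the other order bounds \<open>n + 1\<close> by \<open>n\<close>.\<close>

lemma exists_normalised_orthogonal:
  assumes e: "orthonormal e {..<n}"
  shows "\<exists>v\<in>W. B v v = 1 \<and> (\<forall>i<n. B v (e i) = 0)"
proof (rule ccontr)
  assume none: "\<not> ?thesis"
  obtain \<phi> where \<phi>: "orthonormal \<phi> UNIV" using infinite_dimensional by blast
  have Bes: "(\<Sum>i<n. (B (\<phi> k) (e i))\<^sup>2) \<ge> 1" for k
  proof -
    let ?v = "\<phi> k - proj e n (\<phi> k)"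
    have \<phi>k: "\<phi> k \<in> W" using \<phi> by (simp add: orthonormal_in)
    have v: "?v \<in> W" using \<phi>k proj_in[OF e] by auto
    have "B ?v ?v = 0"
    proof (rule ccontr)
      assume "B ?v ?v \<noteq> 0"
      then have pos: "B ?v ?v > 0" using nonneg[OF v] by simp
      let ?w = "(1 / sqrt (B ?v ?v)) *\<^sub>R ?v"
      have "?w \<in> W" using v by auto
      moreover have "B ?w ?w = 1" unfolding square_scale[OF v] using pos by (simp add: power_divide)
      moreover have "\<forall>i<n. B ?w (e i) = 0"
        using residual_orthogonal[OF e \<phi>k] e v by (auto simp: scale_left orthonormal_in)
      ultimately show False using none by blast
    qed
    then show ?thesis using Pythagoras[OF e \<phi>k] \<phi> by (simp add: orthonormal_eq)
  qed
  have "real (Suc n) = (\<Sum>k<Suc n. 1)" by simp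
  also have "\<dots> \<le> (\<Sum>k<Suc n. \<Sum>i<n. (B (\<phi> k) (e i))\<^sup>2)" by (intro sum_mono Bes)
  also have "\<dots> = (\<Sum>i<n. \<Sum>k<Suc n. (B (\<phi> k) (e i))\<^sup>2)" by (rule sum.swap)
  also have "\<dots> \<le> (\<Sum>i<n. 1)"
  proof (intro sum_mono)
    fix i assume i: "i \<in> {..<n}"
    have "(\<Sum>k<Suc n. (B (\<phi> k) (e i))\<^sup>2) = (\<Sum>k<Suc n. (B (e i) (\<phi> k))\<^sup>2)"
      using \<phi> e i sym by (intro sum.cong refl) (metis UNIV_I orthonormal_in)
    also have "\<dots> \<le> B (e i) (e i)"
      using e i by (intro Bessel orthonormal_subset[OF \<phi>]) (auto simp: orthonormal_in)
    also have "\<dots> = 1" using e i by (simp add: orthonormal_eq)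
    finally show "(\<Sum>k<Suc n. (B (\<phi> k) (e i))\<^sup>2) \<le> 1" .
  qed
  finally show False by simp
qed

definition minimiser :: "(nat \<Rightarrow> 'a) \<Rightarrow> nat \<Rightarrow> 'a \<Rightarrow> bool" where
  "minimiser e n x \<longleftrightarrow> x \<in> W \<and> B x x = 1 \<and> (\<forall>i<n. B x (e i) = 0) \<and>
     (\<forall>v\<in>W. (\<forall>i<n. B v (e i) = 0) \<longrightarrow> A x x * B v v \<le> A v v)"

text \<open>The direct method: norm and orthogonality pass to the limit of a minimising sequence, and the
  energy does not increase.\<close>

lemma minimiser_exists:
  assumes e: "orthonormal e {..<n}"
  shows "\<exists>x. minimiser e n x"
proof -
  define K where "K = {v \<in> W. B v v = 1 \<and> (\<forall>i<n. B v (e i) = 0)}"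
  define \<mu> where "\<mu> = (INF v\<in>K. A v v)"
  have ne: "K \<noteq> {}" using exists_normalised_orthogonal[OF e] by (auto simp: K_def)
  have bdd: "bdd_below ((\<lambda>v. A v v) ` K)" by (rule bdd_belowI[of _ 0]) (auto simp: K_def A.nonneg)
  have lower: "\<mu> \<le> A v v" if "v \<in> K" for v
    unfolding \<mu>_def using that by (intro cINF_lower bdd)
  have "\<exists>v\<in>K. A v v < \<mu> + 1 / real (Suc j)" for j
    using cInf_lessD[of "(\<lambda>v. A v v) ` K" "\<mu> + 1 / real (Suc j)"] ne by (auto simp: \<mu>_def)
  then obtain u where u: "\<And>j. u j \<in> K" "\<And>j. A (u j) (u j) < \<mu> + 1 / real (Suc j)" by metis
  have uW: "u j \<in> W" "B (u j) (u j) = 1" and u0: "i < n \<Longrightarrow> B (u j) (e i) = 0" for i j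
    using u(1)[of j] by (auto simp: K_def)
  have lim: "(\<lambda>j. A (u j) (u j)) \<longlonglongrightarrow> \<mu>"
  proof (rule tendsto_sandwich[of "\<lambda>_. \<mu>" _ _ "\<lambda>j. \<mu> + 1 / real (Suc j)"])
    show "(\<lambda>j. \<mu> + 1 / real (Suc j)) \<longlonglongrightarrow> \<mu>"
      using tendsto_add[OF tendsto_const[of \<mu>] LIMSEQ_inverse_real_of_nat] by (simp add: inverse_eq_divide)
  qed (use u(1) u(2)[THEN less_imp_le] lower in \<open>auto intro!: always_eventually\<close>)
  have "A (u j) (u j) \<le> max 1 (\<mu> + 1)" for j
  proof -
    have "1 / real (Suc j) \<le> 1" by (simp add: field_simps)
    with u(2)[of j] show ?thesis by linarith
  qed
  then obtain r w where r: "strict_mono r" and w: "w \<in> W" and t: "tends (\<lambda>n. u (r n)) w"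
    and sc: "A w w \<le> \<mu>"
    using compact[of u "max 1 (\<mu> + 1)"] uW lim by auto
  have "(\<lambda>n. 1) \<longlonglongrightarrow> B w w"
    using tends_square[OF _ w t] uW by simp
  then have Bw: "B w w = 1" using LIMSEQ_unique tendsto_const by blast
  have Be: "B w (e i) = 0" if i: "i < n" for i
  proof -
    have "(\<lambda>n. 0) \<longlonglongrightarrow> B w (e i)"
      using tends_inner[OF _ w _ t, of "e i"] uW u0[OF i] e i by (simp add: orthonormal_in)
    then show ?thesis using LIMSEQ_unique tendsto_const by blast
  qed
  have "A w w * B v v \<le> A v v" if v: "v \<in> W" and v0: "\<forall>i<n. B v (e i) = 0" for v
  proof (cases "B v v = 0")
    case True
    then show ?thesis using A.nonneg[OF v] by simp
  next
    case False
    then have pos: "B v v > 0" using nonneg[OF v] by simp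
    let ?x = "(1 / sqrt (B v v)) *\<^sub>R v"
    have "?x \<in> W" "\<forall>i<n. B ?x (e i) = 0"
      using v v0 e by (auto simp: scale_left orthonormal_in)
    moreover have "B ?x ?x = 1"
      unfolding square_scale[OF v] using pos by (simp add: power_divide)
    ultimately have "?x \<in> K" by (simp add: K_def)
    then have "\<mu> \<le> A v v / B v v"
      using lower[of ?x] v pos by (simp add: A.square_scale power_divide)
    then show ?thesis using sc pos by (simp add: field_simps) (meson dual_order.trans mult_right_mono less_imp_le)
  qed
  then show ?thesis using w Bw Be by (auto simp: minimiser_def)
qed

text \<open>At a minimiser the form \<open>A - A x x B\<close>, which is nonnegative on the orthogonal complement of
  the earlier eigenvectors, vanishes, and so it pairs to zero with that complement by the
  Cauchy--Schwarz inequality; on the earlier eigenvectors both forms vanish.\<close>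

lemma minimiser_eigenvector:
  assumes e: "orthonormal e {..<n}" and x: "minimiser e n x"
    and eig: "\<And>i v. i < n \<Longrightarrow> v \<in> W \<Longrightarrow> A (e i) v = l i * B (e i) v" and v: "v \<in> W"
  shows "A x v = A x x * B x v"
proof -
  have xW: "x \<in> W" and x1: "B x x = 1" and x0: "\<And>i. i < n \<Longrightarrow> B x (e i) = 0"
    and min: "\<And>v. v \<in> W \<Longrightarrow> (\<forall>i<n. B v (e i) = 0) \<Longrightarrow> A x x * B v v \<le> A v v"
    using x by (auto simp: minimiser_def)
  have eW: "i < n \<Longrightarrow> e i \<in> W" for i using e by (simp add: orthonormal_in)
  let ?V = "{v \<in> W. \<forall>i<n. B v (e i) = 0}"
  interpret D: semi_inner_on ?V "\<lambda>u v. A u v - A x x * B u v"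
  proof
    show "subspace ?V"
      using eW by (auto simp: subspace_def add_left scale_left zero_left)
    show "A (u + v) w - A x x * B (u + v) w = (A u w - A x x * B u w) + (A v w - A x x * B v w)"
      if "u \<in> ?V" "v \<in> ?V" "w \<in> ?V" for u v w
      using that by (simp add: add_left A.add_left algebra_simps)
    show "A (c *\<^sub>R u) w - A x x * B (c *\<^sub>R u) w = c * (A u w - A x x * B u w)"
      if "u \<in> ?V" "w \<in> ?V" for u w c
      using that by (simp add: scale_left A.scale_left algebra_simps)
    show "A u v - A x x * B u v = A v u - A x x * B v u" if "u \<in> ?V" "v \<in> ?V" for u v
      using that sym[of u v] A.sym[of u v] by simp
  qed (use min in auto)
  let ?p = "proj e n v"
  have p: "?p \<in> W" using proj_in[OF e] .
  have vp: "v - ?p \<in> ?V" using residual_orthogonal[OF e v] v p by auto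
  have "A x (v - ?p) - A x x * B x (v - ?p) = 0"
    by (rule D.null_orthogonal[OF _ vp]) (simp_all add: x0 xW x1)
  moreover have "B x (v - ?p) = B x v"
    using residual_inner[OF e v xW] x0 by simp
  moreover have "A ?p x = 0"
  proof -
    have "A ?p x = (\<Sum>i<n. B v (e i) * A (e i) x)"
      unfolding proj_def using eW xW by (intro A.combination_left) auto
    also have "\<dots> = 0"
      using eig xW x0 eW sym[OF xW] by (intro sum.neutral) auto
    finally show ?thesis .
  qed
  then have "A x (v - ?p) = A x v"
    using A.diff_right[OF v p xW] A.sym[OF p xW] by simp
  ultimately show ?thesis by simp
qed

text \<open>The minimisers are chosen recursively.  The minima grow because the constraint sets shrink; were
  they bounded, a subsequence of the orthonormal minimisers would converge to a vector of norm 1,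
  whereas by Bessel's inequality the inner products of the sequence with any fixed vector tend to
  zero.  The residual of \<open>u\<close> after \<open>N\<close> eigenvectors competes in the \<open>N\<close>-th minimisation and has
  energy at most \<open>A u u\<close>, which bounds its norm.  An eigenvector for a further eigenvalue would be
  orthogonal to all \<open>e n\<close>, contradicting this approximation.\<close>

theorem spectral:
  obtains e \<nu> where "orthonormal e UNIV" "\<And>n v. v \<in> W \<Longrightarrow> A (e n) v = \<nu> n * B (e n) v"
    "\<And>n v. v \<in> W \<Longrightarrow> (\<And>i. i < n \<Longrightarrow> B v (e i) = 0) \<Longrightarrow> \<nu> n * B v v \<le> A v v"
    "incseq \<nu>" "filterlim \<nu> at_top sequentially"
    "\<And>u \<epsilon>. u \<in> W \<Longrightarrow> \<epsilon> > 0 \<Longrightarrow> \<exists>N. B (u - proj e N u) (u - proj e N u) \<le> \<epsilon>"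
    "\<And>u \<mu>. u \<in> W \<Longrightarrow> B u u \<noteq> 0 \<Longrightarrow> (\<And>v. v \<in> W \<Longrightarrow> A v u = \<mu> * B v u) \<Longrightarrow> \<mu> \<in> range \<nu>"
proof -
  have ext: "orthonormal e {..<n}" if M: "\<And>i. i < n \<Longrightarrow> minimiser e i (e i)" for e n
  proof -
    have eW: "e i \<in> W" if "i < n" for i using M[OF that] by (simp add: minimiser_def)
    have "B (e i) (e j) = (if i = j then 1 else 0)" if "i < n" "j < n" for i j
    proof (cases i j rule: linorder_cases)
      case less
      then show ?thesis using M[OF that(2)] sym[OF eW[OF that(1)] eW[OF that(2)]] by (auto simp: minimiser_def)
    qed (use M[OF that(1)] in \<open>auto simp: minimiser_def\<close>)
    then show ?thesis using eW by (auto simp: orthonormal_def)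
  qed
  have "\<exists>e. \<forall>n. minimiser e n (e n)"
  proof (rule dependent_wellorder_choice)
    show "minimiser f n x = minimiser g n x" if "\<And>i. i < n \<Longrightarrow> f i = g i" for f g n x
      using that by (simp add: minimiser_def)
  qed (rule minimiser_exists[OF ext])
  then obtain e where M: "\<And>n. minimiser e n (e n)" by blast
  define \<nu> where "\<nu> n = A (e n) (e n)" for n
  have onn: "orthonormal e {..<n}" for n using ext[of n e] M by blast
  have on: "orthonormal e UNIV"
    unfolding orthonormal_def
  proof (intro conjI ballI)
    fix i j
    show "e i \<in> W" using onn[of "Suc i"] by (simp add: orthonormal_in)
    show "B (e i) (e j) = (if i = j then 1 else 0)"
      using onn[of "Suc (max i j)"] by (rule orthonormal_eq) auto
  qed
  have eW: "e n \<in> W" for n using on by (simp add: orthonormal_in)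
  have eig: "A (e n) v = \<nu> n * B (e n) v" if "v \<in> W" for n v
    using that
  proof (induction n arbitrary: v rule: less_induct)
    case (less n)
    show ?case
      unfolding \<nu>_def using less by (intro minimiser_eigenvector[OF onn M, of n \<nu>]) auto
  qed
  have min: "\<nu> n * B v v \<le> A v v" if "v \<in> W" "\<And>i. i < n \<Longrightarrow> B v (e i) = 0" for n v
    using M[of n] that by (auto simp: minimiser_def \<nu>_def)
  have inc: "incseq \<nu>"
  proof (rule incseq_SucI)
    fix n
    show "\<nu> n \<le> \<nu> (Suc n)"
      using min[of "e (Suc n)" n] on eW by (auto simp: orthonormal_eq \<nu>_def)
  qed
  have top: "filterlim \<nu> at_top sequentially"
  proof (rule ccontr)
    assume "\<not> ?thesis"
    then obtain c where c: "\<not> (\<forall>\<^sub>F n in sequentially. c \<le> \<nu> n)" by (auto simp: filterlim_at_top)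
    have le: "\<nu> n \<le> c" for n
    proof (rule ccontr)
      assume "\<not> \<nu> n \<le> c"
      then have "c \<le> \<nu> k" if "k \<ge> n" for k using incseqD[OF inc that] by simp
      then show False using c by (auto simp: eventually_sequentially)
    qed
    have "B (e n) (e n) \<le> max 1 c" "A (e n) (e n) \<le> max 1 c" for n
      using le[of n] on by (auto simp: \<nu>_def orthonormal_eq)
    then have "\<exists>r w. strict_mono r \<and> w \<in> W \<and> tends (\<lambda>n. e (r n)) w
        \<and> (\<forall>a. (\<lambda>n. A (e n) (e n)) \<longlonglongrightarrow> a \<longrightarrow> A w w \<le> a)"
      by (intro compact eW)
    then obtain r w where r: "strict_mono r" and w: "w \<in> W" and t: "tends (\<lambda>n. e (r n)) w"
      by (elim exE conjE)
    have "(\<lambda>n. B (e (r n)) w) \<longlonglongrightarrow> B w w"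
      using tends_inner[OF _ w w t] eW by simp
    moreover have "(\<lambda>n. B (e (r n)) w) \<longlonglongrightarrow> 0"
    proof -
      have "summable (\<lambda>i. (B w (e i))\<^sup>2)"
        by (rule summableI_nonneg_bounded[where x = "B w w"])
           (use Bessel[OF onn w] in auto)
      then have "(\<lambda>i. (B w (e i))\<^sup>2) \<longlonglongrightarrow> 0" by (rule summable_LIMSEQ_zero)
      then have "(\<lambda>i. B w (e i)) \<longlonglongrightarrow> 0" by simp
      then have "(\<lambda>n. B w (e (r n))) \<longlonglongrightarrow> 0"
        using LIMSEQ_subseq_LIMSEQ[OF _ r] unfolding o_def by blast
      then show ?thesis using sym[OF w eW] by simp
    qed
    ultimately have "B w w = 0" using LIMSEQ_unique by blast
    moreover have "(\<lambda>n. 1) \<longlonglongrightarrow> B w w"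
      using tends_square[OF _ w t] eW on by (simp add: orthonormal_eq)
    then have "B w w = 1" using LIMSEQ_unique tendsto_const by blast
    ultimately show False by simp
  qed
  have approx: "\<exists>N. B (u - proj e N u) (u - proj e N u) \<le> \<epsilon>" if u: "u \<in> W" and \<epsilon>: "\<epsilon> > 0" for u \<epsilon>
  proof -
    obtain N where N: "max 1 (A u u / \<epsilon>) \<le> \<nu> N"
      using top unfolding filterlim_at_top eventually_sequentially by blast
    let ?r = "u - proj e N u"
    have r: "?r \<in> W" using u proj_in[OF onn] by auto
    have "\<nu> N * B ?r ?r \<le> A ?r ?r" by (intro min r residual_orthogonal[OF onn u])
    also have "\<dots> = A u u - (\<Sum>i<N. \<nu> i * (B u (e i))\<^sup>2)"
    proof (rule residual_square[OF A.semi_inner_on_axioms subset_refl onn eW u])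
      show "A v (e i) = \<nu> i * B v (e i)" if "v \<in> W" for i v
        using eig[OF that, of i] A.sym[OF that eW] sym[OF that eW] by simp
    qed
    also have "\<dots> \<le> A u u"
      using A.nonneg[OF eW] by (simp add: sum_nonneg \<nu>_def)
    finally have "B ?r ?r \<le> A u u / \<nu> N" using N by (simp add: field_simps)
    also have "\<dots> \<le> \<epsilon>" using N \<epsilon> by (simp add: field_simps)
    finally show ?thesis by blast
  qed
  have "\<mu> \<in> range \<nu>" if u: "u \<in> W" "B u u \<noteq> 0" and \<mu>: "\<And>v. v \<in> W \<Longrightarrow> A v u = \<mu> * B v u" for u \<mu>
  proof (rule ccontr)
    assume "\<mu> \<notin> range \<nu>"
    then have ne: "\<mu> \<noteq> \<nu> n" for n by blast
    have "B u (e n) = 0" for n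
      using eig[OF u(1), of n] \<mu>[OF eW, of n] ne[of n] sym[OF u(1) eW] by auto
    then have "proj e N u = 0" for N by (simp add: proj_def)
    then have "B u u \<le> \<epsilon>" if "\<epsilon> > 0" for \<epsilon> using approx[OF u(1) that] by simp
    then have "B u u \<le> 0" using field_le_epsilon[of "B u u" 0] by simp
    then show False using u nonneg[OF u(1)] by simp
  qed
  then show thesis using that[OF on eig min inc top approx] by blast
qed

end

section \<open>Compact perturbations of diagonal forms\<close>

text \<open>Tychonoff's theorem for countably many intervals, in the metrisable product topology.\<close>

lemma bounded_sequences_pointwise_subseq:
  fixes c :: "nat \<Rightarrow> nat \<Rightarrow> real"
  assumes "\<And>n k. \<bar>c n k\<bar> \<le> C"
  obtains l r where "strict_mono r" "\<And>k. (\<lambda>n. c (r n) k) \<longlonglongrightarrow> l k"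
proof -
  let ?K = "Pi\<^sub>E UNIV (\<lambda>k::nat. {-C..C})"
  have "compact ?K"
    using compactin_PiE[of "\<lambda>_::nat. euclidean :: real topology" UNIV "\<lambda>_. {-C..C}"]
    by (simp add: euclidean_product_topology)
  moreover have "c n \<in> ?K" for n using assms[of n] by (auto simp: abs_le_iff minus_le_iff)
  ultimately obtain l r where "strict_mono r" and lim: "(c \<circ> r) \<longlonglongrightarrow> l"
    unfolding compact_eq_seq_compact_metric seq_compact_def by metis
  moreover have "(\<lambda>n. c (r n) k) \<longlonglongrightarrow> l k" for k
    using continuous_on_tendsto_compose[OF continuous_on_product_coordinates[of k] lim] by (simp add: o_def)
  ultimately show thesis using that by blast
qed

locale Hilbert_basis = semi_inner_on H B
  for H :: "'a::real_vector set" and B +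
  fixes \<phi> :: "nat \<Rightarrow> 'a"
  assumes \<phi>_orthonormal: "orthonormal \<phi> UNIV"
    and total: "u \<in> H \<Longrightarrow> (\<And>k. B u (\<phi> k) = 0) \<Longrightarrow> B u u = 0"
    and complete: "(\<And>n. s n \<in> H) \<Longrightarrow>
        (\<And>\<epsilon>. \<epsilon> > 0 \<Longrightarrow> \<exists>N. \<forall>i\<ge>N. \<forall>j\<ge>N. B (s i - s j) (s i - s j) \<le> \<epsilon>) \<Longrightarrow> \<exists>w\<in>H. tends s w"
begin

lemma \<phi>_finite: "orthonormal \<phi> {..<K}"
  using orthonormal_subset[OF \<phi>_orthonormal] by simp

lemma \<phi>_H [simp]: "\<phi> k \<in> H"
  using \<phi>_orthonormal by (simp add: orthonormal_in)

text \<open>The partial sums have some limit by completeness; its difference from \<open>u\<close> is orthogonal to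
  every \<open>\<phi> k\<close> and therefore null.\<close>

lemma expansion_tends:
  assumes u: "u \<in> H"
  shows "(\<lambda>K. B (u - proj \<phi> K u) (u - proj \<phi> K u)) \<longlonglongrightarrow> 0"
proof -
  have p: "proj \<phi> K u \<in> H" for K using proj_in[OF \<phi>_finite] .
  have "\<exists>N. \<forall>i\<ge>N. \<forall>j\<ge>N. B (proj \<phi> i u - proj \<phi> j u) (proj \<phi> i u - proj \<phi> j u) \<le> \<epsilon>"
    if "\<epsilon> > 0" for \<epsilon>
    unfolding proj_def
    by (rule orthogonal_series_Cauchy[where l = "\<lambda>_. 1" and C = "B u u"])
       (use \<phi>_orthonormal Bessel[OF \<phi>_finite u] that in \<open>auto simp: orthonormal_eq\<close>)
  from complete[OF p this] obtain w where w: "w \<in> H" and t: "tends (\<lambda>K. proj \<phi> K u) w" by blast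
  have "B (u - w) (\<phi> k) = 0" for k
  proof -
    have "(\<lambda>K. B (proj \<phi> K u) (\<phi> k)) \<longlonglongrightarrow> B w (\<phi> k)"
      by (rule tends_inner[OF p w \<phi>_H t])
    moreover have "\<forall>\<^sub>F K in sequentially. B (proj \<phi> K u) (\<phi> k) = B u (\<phi> k)"
      using eventually_gt_at_top[of k]
    proof eventually_elim
      case (elim K)
      then show ?case using residual_orthogonal[OF \<phi>_finite u elim] u p by (simp add: diff_left)
    qed
    then have "(\<lambda>K. B (proj \<phi> K u) (\<phi> k)) \<longlonglongrightarrow> B u (\<phi> k)" by (rule tendsto_eventually)
    ultimately have "B w (\<phi> k) = B u (\<phi> k)" by (rule LIMSEQ_unique)
    then show ?thesis using u w by (simp add: diff_left)
  qed
  then have 0: "B (u - w) (u - w) = 0" using u w by (intro total) auto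
  have "B (u - proj \<phi> K u) (u - proj \<phi> K u) = B (proj \<phi> K u - w) (proj \<phi> K u - w)" for K
  proof -
    let ?a = "u - w" and ?b = "proj \<phi> K u - w"
    have "B ?a ?b = 0" using u w p by (intro null_orthogonal[OF _ _ 0]) auto
    moreover have "u - proj \<phi> K u = ?a - ?b" by simp
    ultimately show ?thesis using u w p 0 square_diff[of ?a ?b] by simp
  qed
  then show ?thesis using t by (simp add: tends_def)
qed

end

text \<open>Here \<open>A0\<close> is a form with eigenvectors \<open>\<phi>\<close> and \<open>Q\<close> a bounded perturbation.  The assumption
  \<open>finite_energy\<close> says that \<open>W\<close> is the full form domain: it contains every vector whose formal
  energy is finite, and the form has no energy beyond the one seen in the coefficients.\<close>

locale diagonal_form = Hilbert_basis H B \<phi> + A0: semi_inner_on W A0 + Q: semi_inner_on H Q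
  for H W :: "'a::real_vector set" and B A0 Q \<phi> +
  fixes l :: "nat \<Rightarrow> real" and M :: real
  assumes W_subset: "W \<subseteq> H" and \<phi>_in: "\<phi> k \<in> W"
    and eigenvector: "u \<in> W \<Longrightarrow> A0 u (\<phi> k) = l k * B u (\<phi> k)"
    and l_nonneg: "0 \<le> l k" and l_at_top: "filterlim l at_top sequentially"
    and finite_energy: "u \<in> H \<Longrightarrow> (\<And>K. (\<Sum>k<K. l k * (B u (\<phi> k))\<^sup>2) \<le> C) \<Longrightarrow> u \<in> W \<and> A0 u u \<le> C"
    and Q_bounded: "u \<in> H \<Longrightarrow> Q u u \<le> M * B u u"
begin

lemma energy_Bessel:
  assumes "u \<in> W"
  shows "(\<Sum>k<K. l k * (B u (\<phi> k))\<^sup>2) \<le> A0 u u"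
proof -
  have "A0 (u - proj \<phi> K u) (u - proj \<phi> K u) = A0 u u - (\<Sum>k<K. l k * (B u (\<phi> k))\<^sup>2)"
    by (rule residual_square[OF A0.semi_inner_on_axioms W_subset \<phi>_finite \<phi>_in assms]) (rule eigenvector)
  moreover have "u - proj \<phi> K u \<in> W" using assms \<phi>_in by (auto simp: proj_def)
  ultimately show ?thesis using A0.nonneg[of "u - proj \<phi> K u"] by simp
qed

text \<open>The Bessel inequality bounds the sum of \<open>l k (B u (\<phi> k))\<^sup>2\<close> by the energy of \<open>u\<close>; the reverse
  inequality is \<open>finite_energy\<close> applied to \<open>u\<close> itself.\<close>

lemma energy_expansion_tends:
  assumes u: "u \<in> W"
  shows "(\<lambda>K. A0 (u - proj \<phi> K u) (u - proj \<phi> K u)) \<longlonglongrightarrow> 0"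
proof -
  let ?c = "\<lambda>k. l k * (B u (\<phi> k))\<^sup>2"
  have sum: "summable ?c"
    by (rule summableI_nonneg_bounded[where x = "A0 u u"]) (use energy_Bessel[OF u] l_nonneg in auto)
  have "sum ?c {..<K} \<le> suminf ?c" for K
    by (intro sum_le_suminf sum) (use l_nonneg in auto)
  then have "A0 u u \<le> suminf ?c" using finite_energy[of u] W_subset u by blast
  moreover have "suminf ?c \<le> A0 u u" by (rule suminf_le_const[OF sum energy_Bessel[OF u]])
  ultimately have "(\<lambda>K. A0 u u - sum ?c {..<K}) \<longlonglongrightarrow> A0 u u - A0 u u"
    using summable_LIMSEQ[OF sum] by (intro tendsto_diff tendsto_const) simp
  moreover have "A0 (u - proj \<phi> K u) (u - proj \<phi> K u) = A0 u u - sum ?c {..<K}" for K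
    by (rule residual_square[OF A0.semi_inner_on_axioms W_subset \<phi>_finite \<phi>_in u]) (rule eigenvector)
  ultimately show ?thesis by simp
qed

text \<open>Beyond \<open>K\<close>, each unit of squared norm costs at least \<open>L\<close> units of energy.\<close>

lemma tail_bound:
  assumes u: "u \<in> W" and L: "L > 0" "\<And>k. k \<ge> K \<Longrightarrow> L \<le> l k"
  shows "B (u - proj \<phi> K u) (u - proj \<phi> K u) \<le> A0 u u / L"
proof -
  let ?r = "\<lambda>K. B (u - proj \<phi> K u) (u - proj \<phi> K u)" and ?c = "\<lambda>k. (B u (\<phi> k))\<^sup>2"
  have uH: "u \<in> H" using u W_subset by blast
  have "?r K - ?r J \<le> A0 u u / L" if "J \<ge> K" for J
  proof -
    have split: "{..<J} = {..<K} \<union> {K..<J}" using that by auto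
    have "L * (?r K - ?r J) = (\<Sum>k=K..<J. L * ?c k)"
      unfolding Pythagoras[OF \<phi>_finite uH] split
      by (subst sum.union_disjoint) (auto simp: sum_distrib_left)
    also have "\<dots> \<le> (\<Sum>k=K..<J. l k * ?c k)" using L by (intro sum_mono mult_right_mono) auto
    also have "\<dots> \<le> (\<Sum>k<J. l k * ?c k)" using l_nonneg by (intro sum_mono2) auto
    also have "\<dots> \<le> A0 u u" by (rule energy_Bessel[OF u])
    finally show ?thesis using L by (simp add: field_simps)
  qed
  moreover have "(\<lambda>J. ?r K - ?r J) \<longlonglongrightarrow> ?r K - 0"
    by (intro tendsto_diff tendsto_const expansion_tends uH)
  ultimately show ?thesis
    using LIMSEQ_le_const2[of "\<lambda>J. ?r K - ?r J" "?r K"] by auto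
qed

text \<open>All coefficients converge along one subsequence, and by \<open>tail_bound\<close> the remainders are
  uniformly small, so the subsequence is Cauchy.  Any finite part of the energy of the limit is a
  limit of partial energies of the sequence, which gives both membership in \<open>W\<close> and lower
  semicontinuity; the bounded part \<open>Q\<close> is continuous.\<close>

lemma compact_sublevel:
  assumes u: "\<And>n. u n \<in> W" and Bu: "\<And>n. B (u n) (u n) \<le> C"
    and Au: "\<And>n. A0 (u n) (u n) + Q (u n) (u n) \<le> C"
  shows "\<exists>r w. strict_mono r \<and> w \<in> W \<and> tends (\<lambda>n. u (r n)) w
    \<and> (\<forall>a. (\<lambda>n. A0 (u n) (u n) + Q (u n) (u n)) \<longlonglongrightarrow> a \<longrightarrow> A0 w w + Q w w \<le> a)"
proof -
  have uH: "u n \<in> H" for n using u W_subset by blast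
  have C0: "C \<ge> 0" using nonneg[OF uH] Bu order_trans by blast
  define c where "c n k = B (u n) (\<phi> k)" for n k
  have "(c n k)\<^sup>2 \<le> C" for n k
    using Cauchy_Schwarz[OF uH \<phi>_H, of n k] Bu[of n] \<phi>_orthonormal by (simp add: c_def orthonormal_eq)
  then have "\<bar>c n k\<bar> \<le> sqrt C" for n k using real_le_rsqrt[of "\<bar>c n k\<bar>" C] by simp
  then obtain d r where r: "strict_mono r" and d: "\<And>k. (\<lambda>n. c (r n) k) \<longlonglongrightarrow> d k"
    using bounded_sequences_pointwise_subseq by metis
  have A0u: "A0 (u n) (u n) \<le> C" for n using Au[of n] Q.nonneg[OF uH] by (smt (verit))
  have "\<exists>N. \<forall>i\<ge>N. \<forall>j\<ge>N. B (u (r i) - u (r j)) (u (r i) - u (r j)) \<le> \<epsilon>" if \<epsilon>: "\<epsilon> > 0" for \<epsilon>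
  proof -
    \<comment> \<open>Differences have energy at most \<open>4 C\<close>; with this \<open>L\<close> their tails contribute at most \<open>\<epsilon> / 2\<close>.\<close>
    define L where "L = (8 * C + 1) / \<epsilon>"
    have L: "L > 0" using C0 \<epsilon> by (simp add: L_def)
    have L2: "4 * C / L \<le> \<epsilon> / 2" using C0 \<epsilon> by (simp add: L_def field_simps)
    obtain K where K: "\<And>k. k \<ge> K \<Longrightarrow> L \<le> l k"
      using l_at_top by (auto simp: filterlim_at_top eventually_sequentially)
    have "(\<lambda>n. \<Sum>k<K. (c (r n) k - d k)\<^sup>2) \<longlonglongrightarrow> (\<Sum>k<K. (d k - d k)\<^sup>2)"
      by (intro tendsto_intros d)
    then have "\<forall>\<^sub>F n in sequentially. (\<Sum>k<K. (c (r n) k - d k)\<^sup>2) < \<epsilon> / 8"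
      using \<epsilon> by (intro order_tendstoD) auto
    then obtain N where N: "\<And>n. n \<ge> N \<Longrightarrow> (\<Sum>k<K. (c (r n) k - d k)\<^sup>2) < \<epsilon> / 8"
      by (auto simp: eventually_sequentially)
    have "B (u (r i) - u (r j)) (u (r i) - u (r j)) \<le> \<epsilon>" if "i \<ge> N" "j \<ge> N" for i j
    proof -
      let ?v = "u (r i) - u (r j)"
      have v: "?v \<in> W" "?v \<in> H" using u uH by auto
      have "(\<Sum>k<K. (B ?v (\<phi> k))\<^sup>2) = (\<Sum>k<K. (c (r i) k - c (r j) k)\<^sup>2)"
        using uH by (intro sum.cong) (auto simp: c_def diff_left)
      also have "\<dots> \<le> (\<Sum>k<K. 2 * (c (r i) k - d k)\<^sup>2 + 2 * (c (r j) k - d k)\<^sup>2)"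
      proof (intro sum_mono)
        fix k
        have "0 \<le> ((c (r i) k - d k) + (c (r j) k - d k))\<^sup>2" by simp
        then show "(c (r i) k - c (r j) k)\<^sup>2 \<le> 2 * (c (r i) k - d k)\<^sup>2 + 2 * (c (r j) k - d k)\<^sup>2"
          by (simp add: power2_eq_square algebra_simps)
      qed
      also have "\<dots> = 2 * (\<Sum>k<K. (c (r i) k - d k)\<^sup>2) + 2 * (\<Sum>k<K. (c (r j) k - d k)\<^sup>2)"
        by (simp add: sum.distrib sum_distrib_left)
      also have "\<dots> \<le> \<epsilon> / 2" using N[OF that(1)] N[OF that(2)] by linarith
      finally have 1: "(\<Sum>k<K. (B ?v (\<phi> k))\<^sup>2) \<le> \<epsilon> / 2" .
      have "A0 ?v ?v \<le> 4 * C"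
        using A0.square_diff_le[OF u u, of "r i" "r j"] A0u[of "r i"] A0u[of "r j"] by linarith
      then have "A0 ?v ?v / L \<le> 4 * C / L" using L by (simp add: divide_right_mono)
      then have 2: "B (?v - proj \<phi> K ?v) (?v - proj \<phi> K ?v) \<le> \<epsilon> / 2"
        using tail_bound[where K = K, OF v(1) L K] L2 by linarith
      show ?thesis using Pythagoras[OF \<phi>_finite[of K] v(2)] 1 2 by linarith
    qed
    then show ?thesis by blast
  qed
  from complete[OF uH this] obtain w where w: "w \<in> H" and t: "tends (\<lambda>n. u (r n)) w" by blast
  have wd: "B w (\<phi> k) = d k" for k
    using tends_inner[OF uH w \<phi>_H t, of k] d[of k] LIMSEQ_unique by (auto simp: c_def)
  have energy: "(\<lambda>n. \<Sum>k<K. l k * (B (u (r n)) (\<phi> k))\<^sup>2) \<longlonglongrightarrow> (\<Sum>k<K. l k * (B w (\<phi> k))\<^sup>2)" for K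
    unfolding wd using d unfolding c_def by (intro tendsto_intros)
  have "(\<Sum>k<K. l k * (B w (\<phi> k))\<^sup>2) \<le> C" for K
    using LIMSEQ_le_const2[OF energy[of K]] energy_Bessel[OF u] A0u order_trans by blast
  then have wW: "w \<in> W" using finite_energy[OF w] by blast
  have "A0 w w + Q w w \<le> a" if a: "(\<lambda>n. A0 (u n) (u n) + Q (u n) (u n)) \<longlonglongrightarrow> a" for a
  proof -
    have Qt: "Q.tends (\<lambda>n. u (r n)) w"
      unfolding Q.tends_def
    proof (rule tendsto_sandwich[of "\<lambda>_. 0"])
      show "(\<lambda>n. M * B (u (r n) - w) (u (r n) - w)) \<longlonglongrightarrow> 0"
        using tendsto_mult_right_zero[OF t[unfolded tends_def], of M] .
    qed (use uH w Q.nonneg Q_bounded in \<open>auto intro!: always_eventually\<close>)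
    have "(\<lambda>n. A0 (u (r n)) (u (r n)) + Q (u (r n)) (u (r n)) - Q (u (r n)) (u (r n))) \<longlonglongrightarrow> a - Q w w"
      using LIMSEQ_subseq_LIMSEQ[OF a r] Q.tends_square[OF uH w Qt] unfolding o_def
      by (intro tendsto_diff)
    then have A0lim: "(\<lambda>n. A0 (u (r n)) (u (r n))) \<longlonglongrightarrow> a - Q w w" by simp
    have "(\<Sum>k<K. l k * (B w (\<phi> k))\<^sup>2) \<le> a - Q w w" for K
      using LIMSEQ_le[OF energy[of K] A0lim] energy_Bessel[OF u] by blast
    then show ?thesis using finite_energy[OF w] by fastforce
  qed
  then show ?thesis using r wW t by blast
qed

lemma restricted: "semi_inner_on W B"
proof
  have [simp]: "u \<in> H" if "u \<in> W" for u using that W_subset by blast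
  show "B u v = B v u" if "u \<in> W" "v \<in> W" for u v using that by (intro sym) auto
qed (use W_subset[THEN subsetD] A0.subspace in \<open>auto simp: add_left scale_left nonneg\<close>)

sublocale perturbed: compact_form W B "\<lambda>u v. A0 u v + Q u v"
proof -
  interpret R: semi_inner_on W B by (rule restricted)
  have [simp]: "u \<in> H" if "u \<in> W" for u using that W_subset by blast
  show "compact_form W B (\<lambda>u v. A0 u v + Q u v)"
  proof
    show "A0 u w + Q u w = A0 w u + Q w u" if "u \<in> W" "w \<in> W" for u w
      using that A0.sym[of u w] Q.sym[of u w] by simp
    show "\<exists>\<phi>. R.orthonormal \<phi> UNIV"
      using \<phi>_in \<phi>_orthonormal by (intro exI[of _ \<phi>]) (auto simp: R.orthonormal_def orthonormal_def)
    show "\<exists>r w. strict_mono r \<and> w \<in> W \<and> R.tends (\<lambda>n. u (r n)) w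
      \<and> (\<forall>a. (\<lambda>n. A0 (u n) (u n) + Q (u n) (u n)) \<longlonglongrightarrow> a \<longrightarrow> A0 w w + Q w w \<le> a)"
      if "\<And>n. u n \<in> W" "\<And>n. B (u n) (u n) \<le> C" "\<And>n. A0 (u n) (u n) + Q (u n) (u n) \<le> C" for u C
      using compact_sublevel[OF that] by (simp add: R.tends_def tends_def)
  qed (use A0.subspace in \<open>auto simp: A0.add_left Q.add_left A0.scale_left Q.scale_left A0.nonneg Q.nonneg algebra_simps\<close>)
qed

end

section \<open>A weighted Riesz--Fischer theorem\<close>

text \<open>The quadratic forms \<open>N x\<close> need a positive lower bound only at each point, not uniformly.  This
  is what the matrix \<open>\<Phi>\<close> provides, which degenerates at the boundary of the triangle.\<close>

lemma weighted_Riesz_Fischer: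
  fixes f :: "nat \<Rightarrow> 'a \<Rightarrow> 'b::{banach, second_countable_topology}" and N :: "'a \<Rightarrow> 'b \<Rightarrow> real"
  assumes f [measurable]: "\<And>n. f n \<in> borel_measurable M"
    and N_measurable: "\<And>g. g \<in> borel_measurable M \<Longrightarrow> (\<lambda>x. N x (g x)) \<in> borel_measurable M"
    and cont: "\<And>x. x \<in> space M \<Longrightarrow> continuous_on UNIV (N x)"
    and coercive: "\<And>x. x \<in> space M \<Longrightarrow> \<exists>c>0. \<forall>h. c * (norm h)\<^sup>2 \<le> N x h"
    and Cauchy: "\<And>\<epsilon>. \<epsilon> > 0 \<Longrightarrow> \<exists>K. \<forall>i\<ge>K. \<forall>j\<ge>K. (\<integral>\<^sup>+x. ennreal (N x (f i x - f j x)) \<partial>M) \<le> ennreal \<epsilon>"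
  obtains g where "g \<in> borel_measurable M"
    "\<And>\<epsilon>. \<epsilon> > 0 \<Longrightarrow> \<exists>K. \<forall>n\<ge>K. (\<integral>\<^sup>+x. ennreal (N x (f n x - g x)) \<partial>M) \<le> ennreal \<epsilon>"
proof -
  have [measurable]: "(\<lambda>x. N x (f i x - f j x)) \<in> borel_measurable M" for i j
    by (intro N_measurable) measurable
  have "\<exists>K. \<forall>i\<ge>K. \<forall>j\<ge>K. (\<integral>\<^sup>+x. ennreal (N x (f i x - f j x)) \<partial>M) \<le> ennreal ((1/4)^k)" for k :: nat
    by (rule Cauchy) simp
  then obtain K where K: "\<And>k i j. i \<ge> K k \<Longrightarrow> j \<ge> K k \<Longrightarrow>
      (\<integral>\<^sup>+x. ennreal (N x (f i x - f j x)) \<partial>M) \<le> ennreal ((1/4)^k)"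
    by metis
  \<comment> \<open>A nondecreasing choice of indices beyond the thresholds \<open>K k\<close>.\<close>
  define r where "r k = (\<Sum>j\<le>k. K j) + k" for k
  have rK: "r k \<ge> K k" "r (Suc k) \<ge> K k" "r k \<ge> k" for k
  proof -
    have "(\<Sum>j\<in>{k}. K j) \<le> (\<Sum>j\<le>k. K j)" by (intro sum_mono2) auto
    then show "r k \<ge> K k" "r (Suc k) \<ge> K k" "r k \<ge> k" by (auto simp: r_def)
  qed
  define d where "d k x = f (r (Suc k)) x - f (r k) x" for k x
  \<comment> \<open>The integrals of \<open>N x (d k x)\<close> are at most \<open>4\<^sup>-\<^sup>k\<close>, so the sum weighted by \<open>2\<^sup>k\<close> is finite almost
    everywhere, and there the increments decay like \<open>2\<^sup>-\<^sup>k\<^sup>/\<^sup>2\<close>.\<close>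
  define G where "G x = (\<Sum>k. ennreal (2^k * N x (d k x)))" for x
  have [measurable]: "(\<lambda>x. N x (d k x)) \<in> borel_measurable M" for k
    unfolding d_def by measurable
  have "(\<integral>\<^sup>+x. G x \<partial>M) = (\<Sum>k. \<integral>\<^sup>+x. ennreal (2^k * N x (d k x)) \<partial>M)"
    unfolding G_def by (intro nn_integral_suminf) measurable
  also have "\<dots> \<le> (\<Sum>k. ennreal ((1/2)^k))"
  proof (intro suminf_le allI summableI)
    fix k
    have "(\<integral>\<^sup>+x. ennreal (2^k * N x (d k x)) \<partial>M) = ennreal (2^k) * (\<integral>\<^sup>+x. ennreal (N x (d k x)) \<partial>M)"
      by (subst nn_integral_cmult[symmetric]) (auto simp: ennreal_mult')
    also have "\<dots> \<le> ennreal (2^k) * ennreal ((1/4)^k)"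
      unfolding d_def by (intro mult_left_mono K rK) auto
    also have "\<dots> = ennreal ((1/2)^k)"
      by (simp add: ennreal_mult[symmetric] power_mult_distrib[symmetric])
    finally show "(\<integral>\<^sup>+x. ennreal (2^k * N x (d k x)) \<partial>M) \<le> ennreal ((1/2)^k)" .
  qed
  also have "\<dots> = ennreal (\<Sum>k. (1/2)^k)" by (intro suminf_ennreal2) auto
  finally have "(\<integral>\<^sup>+x. G x \<partial>M) \<noteq> \<infinity>" by (auto simp: top_unique)
  moreover have "G \<in> borel_measurable M" unfolding G_def by measurable
  ultimately have AE_fin: "AE x in M. G x \<noteq> \<infinity>" by (intro nn_integral_PInf_AE) auto
  have conv: "convergent (\<lambda>k. f (r k) x)" if x: "x \<in> space M" and fin: "G x \<noteq> \<infinity>" for x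
  proof -
    obtain c where c: "c > 0" "\<And>h. c * (norm h)\<^sup>2 \<le> N x h" using coercive[OF x] by blast
    obtain s where s: "G x = ennreal s" "s \<ge> 0" using fin by (cases "G x") auto
    have le: "norm (d k x) \<le> sqrt (s / c) * (sqrt (1/2))^k" for k
    proof -
      have N0: "0 \<le> N x (d k x)" using c(1) c(2)[of "d k x"] by (smt (verit) mult_nonneg_nonneg zero_le_power2)
      have "ennreal (2^k * N x (d k x)) \<le> G x"
        unfolding G_def using sum_le_suminf[OF summableI, of "{k}" "\<lambda>k. ennreal (2^k * N x (d k x))"] by simp
      then have "2^k * N x (d k x) \<le> s" using s N0 by (simp add: ennreal_le_iff)
      then have "2^k * (c * (norm (d k x))\<^sup>2) \<le> s"
        using c(2)[of "d k x"] by (smt (verit) mult_left_mono zero_le_power)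
      then have "(norm (d k x))\<^sup>2 \<le> s / c * (1/2)^k"
        using c(1) by (simp add: field_simps power_one_over)
      then have "norm (d k x) \<le> sqrt (s / c * (1/2)^k)" by (rule real_le_rsqrt)
      also have "\<dots> = sqrt (s / c) * sqrt (1/2) ^ k" by (simp only: real_sqrt_mult real_sqrt_power)
      finally show ?thesis .
    qed
    have "summable (\<lambda>k. sqrt (s / c) * (sqrt (1/2))^k)"
      by (intro summable_mult summable_geometric) simp
    then have "summable (\<lambda>k. d k x)" by (rule summable_comparison_test'[of _ 0]) (use le in auto)
    then have "convergent (\<lambda>n. f (r 0) x + (\<Sum>k<n. d k x))"
      by (intro convergent_add convergent_const) (simp add: summable_iff_convergent)
    moreover have "f (r 0) x + (\<Sum>k<n. d k x) = f (r n) x" for n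
      unfolding d_def by (subst sum_lessThan_telescope) simp
    ultimately show ?thesis by simp
  qed
  define g where "g x = lim (\<lambda>k. f (r k) x)" for x
  have g: "g \<in> borel_measurable M" unfolding g_def by measurable
  have "\<exists>K. \<forall>n\<ge>K. (\<integral>\<^sup>+x. ennreal (N x (f n x - g x)) \<partial>M) \<le> ennreal \<epsilon>" if \<epsilon>: "\<epsilon> > 0" for \<epsilon>
  proof -
    obtain K where K: "\<And>i j. i \<ge> K \<Longrightarrow> j \<ge> K \<Longrightarrow> (\<integral>\<^sup>+x. ennreal (N x (f i x - f j x)) \<partial>M) \<le> ennreal \<epsilon>"
      using Cauchy[OF \<epsilon>] by blast
    have "(\<integral>\<^sup>+x. ennreal (N x (f n x - g x)) \<partial>M) \<le> ennreal \<epsilon>" if n: "n \<ge> K" for n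
    proof -
      have "(\<integral>\<^sup>+x. ennreal (N x (f n x - g x)) \<partial>M)
          = (\<integral>\<^sup>+x. liminf (\<lambda>k. ennreal (N x (f n x - f (r k) x))) \<partial>M)"
      proof (rule nn_integral_cong_AE, use AE_fin AE_space in eventually_elim)
        fix x assume x: "x \<in> space M" "G x \<noteq> \<infinity>"
        have "(\<lambda>k. f (r k) x) \<longlonglongrightarrow> g x"
          using conv[OF x] by (simp add: g_def convergent_LIMSEQ_iff)
        then have "(\<lambda>k. f n x - f (r k) x) \<longlonglongrightarrow> f n x - g x" by (intro tendsto_intros)
        from continuous_on_tendsto_compose[OF cont[OF x(1)] this]
        have "(\<lambda>k. ennreal (N x (f n x - f (r k) x))) \<longlonglongrightarrow> ennreal (N x (f n x - g x))"
          by (intro tendsto_ennrealI) simp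
        then show "ennreal (N x (f n x - g x)) = liminf (\<lambda>k. ennreal (N x (f n x - f (r k) x)))"
          using lim_imp_Liminf[OF sequentially_bot] by metis
      qed
      also have "\<dots> \<le> liminf (\<lambda>k. \<integral>\<^sup>+x. ennreal (N x (f n x - f (r k) x)) \<partial>M)"
        by (rule nn_integral_liminf) measurable
      also have "\<dots> \<le> ennreal \<epsilon>"
      proof -
        have "\<forall>\<^sub>F k in sequentially. (\<integral>\<^sup>+x. ennreal (N x (f n x - f (r k) x)) \<partial>M) \<le> ennreal \<epsilon>"
          using eventually_ge_at_top[of K] by eventually_elim (use rK n K order_trans in blast)
        then show ?thesis by (intro Liminf_le) auto
      qed
      finally show ?thesis .
    qed
    then show ?thesis by blast
  qed
  with g show thesis using that by blast
qed

section \<open>Integrable functions orthogonal to all polynomials\<close>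

lemma integrable_mult_bounded:
  fixes F g :: "'a \<Rightarrow> real"
  assumes "integrable M F" "g \<in> borel_measurable M" "\<And>x. x \<in> space M \<Longrightarrow> \<bar>g x\<bar> \<le> C"
  shows "integrable M (\<lambda>x. F x * g x)"
proof (rule Bochner_Integration.integrable_bound[where f = "\<lambda>x. C * F x"])
  show "AE x in M. norm (F x * g x) \<le> norm (C * F x)"
  proof (rule AE_I2)
    fix x assume x: "x \<in> space M"
    have "\<bar>F x\<bar> * \<bar>g x\<bar> \<le> \<bar>F x\<bar> * \<bar>C\<bar>" using assms(3)[OF x] by (intro mult_left_mono) auto
    then show "norm (F x * g x) \<le> norm (C * F x)" by (simp add: abs_mult mult.commute)
  qed
qed (use assms in auto)

text \<open>Orthogonality passes from polynomials to continuous functions by the Stone--Weierstrass theorem,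
  to indicators of closed sets by dominated convergence, and to all measurable sets because these
  are countable unions of closed sets up to null sets.  The sets where \<open>F\<close> is positive and where it
  is negative finish the proof.\<close>

lemma AE_zero_if_orthogonal_to_polynomials:
  fixes F :: "'a::euclidean_space \<Rightarrow> real"
  assumes S: "bounded S" "S \<in> sets lebesgue" and F: "integrable (lebesgue_on S) F"
    and orth: "\<And>p. real_polynomial_function p \<Longrightarrow> (\<integral>x. F x * p x \<partial>lebesgue_on S) = 0"
  shows "AE x in lebesgue_on S. F x = 0"
proof -
  let ?M = "lebesgue_on S"
  have [measurable]: "F \<in> borel_measurable ?M" using F by auto
  have borel: "g \<in> borel_measurable ?M" if "g \<in> borel_measurable borel" for g :: "'a \<Rightarrow> real"
    using that by (intro measurable_restrict_space1 measurable_completion) simp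
  obtain R where R: "S \<subseteq> cball 0 R" using bounded_subset_ballD[OF S(1), of 0] ball_subset_cball by blast
  have bdd: "\<exists>C. \<forall>x\<in>S. \<bar>g x\<bar> \<le> C" if "continuous_on UNIV g" for g :: "'a \<Rightarrow> real"
  proof -
    have "bounded (g ` cball 0 R)"
      using that by (intro compact_imp_bounded compact_continuous_image) (auto intro: continuous_on_subset)
    then show ?thesis using R by (fastforce simp: bounded_iff)
  qed
  have int: "integrable ?M (\<lambda>x. F x * g x)" if g: "continuous_on UNIV g" for g
  proof -
    obtain C where "\<forall>x\<in>S. \<bar>g x\<bar> \<le> C" using bdd[OF g] by blast
    then show ?thesis
      using g F by (intro integrable_mult_bounded[of _ _ _ C] borel borel_measurable_continuous_onI) auto
  qed
  have 1: "(\<integral>x. F x * g x \<partial>?M) = 0" if g: "continuous_on UNIV g" for g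
  proof -
    let ?I = "\<integral>x. \<bar>F x\<bar> \<partial>?M"
    have I0: "?I \<ge> 0" by simp
    have le: "\<bar>\<integral>x. F x * g x \<partial>?M\<bar> \<le> e * ?I" if e: "e > 0" for e
    proof -
      obtain p where p: "real_polynomial_function p" "\<And>x. x \<in> cball 0 R \<Longrightarrow> \<bar>g x - p x\<bar> < e"
        using Stone_Weierstrass_real_polynomial_function[of "cball 0 R" g e] e
        by (metis compact_cball continuous_on_subset g subset_UNIV)
      have pc: "continuous_on UNIV p" using p(1) continuous_real_polymonial_function
        by (intro continuous_at_imp_continuous_on) blast
      have "(\<integral>x. F x * g x \<partial>?M) = (\<integral>x. F x * g x - F x * p x \<partial>?M)"
        using orth[OF p(1)] int[OF g] int[OF pc] by simp
      also have "\<bar>\<dots>\<bar> \<le> (\<integral>x. \<bar>F x * g x - F x * p x\<bar> \<partial>?M)"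
        by (rule integral_abs_bound)
      also have "\<dots> \<le> (\<integral>x. e * \<bar>F x\<bar> \<partial>?M)"
      proof (rule integral_mono)
        fix x assume "x \<in> space ?M"
        then have "\<bar>g x - p x\<bar> \<le> e" using p(2)[of x] R by fastforce
        then have "\<bar>F x\<bar> * \<bar>g x - p x\<bar> \<le> \<bar>F x\<bar> * e" by (intro mult_left_mono) auto
        then show "\<bar>F x * g x - F x * p x\<bar> \<le> e * \<bar>F x\<bar>"
          by (simp add: abs_mult[symmetric] right_diff_distrib mult.commute)
      qed (use int[OF g] int[OF pc] F in auto)
      finally show ?thesis by simp
    qed
    have "\<bar>\<integral>x. F x * g x \<partial>?M\<bar> \<le> 0 + e" if e: "e > 0" for e
    proof -
      have "e / (?I + 1) > 0" using e I0 by (intro divide_pos_pos add_nonneg_pos) auto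
      from le[OF this] have "\<bar>\<integral>x. F x * g x \<partial>?M\<bar> \<le> e * (?I / (?I + 1))" by simp
      moreover have "?I / (?I + 1) \<le> 1"
        using I0 by (subst divide_le_eq_1_pos) (auto intro: add_nonneg_pos)
      then have "e * (?I / (?I + 1)) \<le> e * 1" using e by (intro mult_left_mono) auto
      ultimately show ?thesis by simp
    qed
    then show ?thesis using field_le_epsilon[of "\<bar>\<integral>x. F x * g x \<partial>?M\<bar>" 0] by simp
  qed
  have 2: "(\<integral>x. F x * indicator C x \<partial>?M) = 0" if C: "closed C" for C
  proof (cases "C = {}")
    case False
    let ?g = "\<lambda>n x. max 0 (1 - real n * infdist x C)"
    have g: "continuous_on UNIV (?g n)" for n by (intro continuous_intros)
    have "(\<lambda>n. \<integral>x. F x * ?g n x \<partial>?M) \<longlonglongrightarrow> (\<integral>x. F x * indicator C x \<partial>?M)"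
    proof (rule integral_dominated_convergence[where w = "\<lambda>x. \<bar>F x\<bar>"])
      show "AE x in ?M. (\<lambda>n. F x * ?g n x) \<longlonglongrightarrow> F x * indicator C x"
      proof (rule AE_I2)
        fix x
        have "(\<lambda>n. ?g n x) \<longlonglongrightarrow> indicator C x"
        proof (cases "x \<in> C")
          case False
          then have pos: "infdist x C > 0"
            using C \<open>C \<noteq> {}\<close> in_closed_iff_infdist_zero[of C x] infdist_nonneg[of x C] by fastforce
          obtain m where m: "real m * infdist x C > 1"
            using reals_Archimedean3[OF pos] by blast
          have "\<forall>\<^sub>F n in sequentially. ?g n x = 0"
            using eventually_ge_at_top[of m]
          proof eventually_elim
            case (elim n)
            then have "real m * infdist x C \<le> real n * infdist x C" using pos by (intro mult_right_mono) auto
            then show ?case using m by simp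
          qed
          then show ?thesis using False by (simp add: tendsto_eventually)
        qed simp
        then show "(\<lambda>n. F x * ?g n x) \<longlonglongrightarrow> F x * indicator C x" by (intro tendsto_intros)
      qed
      show "AE x in ?M. norm (F x * ?g n x) \<le> \<bar>F x\<bar>" for n
        by (intro AE_I2) (auto simp: abs_mult max_def infdist_nonneg intro!: mult_left_le)
      show "(\<lambda>x. F x * ?g n x) \<in> borel_measurable ?M" for n using int[OF g] by auto
      show "(\<lambda>x. F x * indicator C x) \<in> borel_measurable ?M"
        using C by (intro borel_measurable_times[OF _ borel]) auto
    qed (use F in auto)
    then have "(\<lambda>n. 0) \<longlonglongrightarrow> (\<integral>x. F x * indicator C x \<partial>?M)" unfolding 1[OF g] .
    then show ?thesis using LIMSEQ_unique[OF tendsto_const] by metis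
  qed simp
  have 3: "(\<integral>x. F x * indicator E x \<partial>?M) = 0" if "E \<in> sets lebesgue" for E
  proof -
    obtain C T where C: "fsigma C" and T: "T \<in> null_sets lebesgue" and CT: "C \<union> T = E"
      using lebesgue_set_almost_fsigma[OF \<open>E \<in> sets lebesgue\<close>] by metis
    obtain D :: "nat \<Rightarrow> 'a set" where D: "\<And>n. closed (D n)" "C = \<Union> (range D)"
      using C by (auto simp: fsigma.simps)
    let ?D = "\<lambda>n. \<Union>k\<le>n. D k"
    have cl: "closed (?D n)" for n using D by auto
    have C_meas [measurable]: "C \<in> sets borel" using D by auto
    have "(\<lambda>n. \<integral>x. F x * indicator (?D n) x \<partial>?M) \<longlonglongrightarrow> (\<integral>x. F x * indicator C x \<partial>?M)"
    proof (rule integral_dominated_convergence[where w = "\<lambda>x. \<bar>F x\<bar>"])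
      show "AE x in ?M. (\<lambda>n. F x * indicator (?D n) x) \<longlonglongrightarrow> F x * indicator C x"
      proof (rule AE_I2)
        fix x
        have "(\<lambda>n. indicator (?D n) x :: real) \<longlonglongrightarrow> indicator C x"
        proof (cases "x \<in> C")
          case True
          then obtain m where "x \<in> D m" using D(2) by auto
          then have "\<forall>\<^sub>F n in sequentially. indicator (?D n) x = (1::real)"
            by (intro eventually_sequentiallyI[of m]) (auto simp: indicator_def)
          then show ?thesis using True by (simp add: tendsto_eventually)
        qed (use D in \<open>auto simp: indicator_def\<close>)
        then show "(\<lambda>n. F x * indicator (?D n) x) \<longlonglongrightarrow> F x * indicator C x" by (intro tendsto_intros)
      qed
      show "AE x in ?M. norm (F x * indicator (?D n) x) \<le> \<bar>F x\<bar>" for n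
        by (intro AE_I2) (auto simp: indicator_def)
      show "(\<lambda>x. F x * indicator (?D n) x) \<in> borel_measurable ?M" for n
        using borel_closed[OF cl[of n]] by (intro borel_measurable_times[OF _ borel]) (auto simp del: UN_simps)
      show "(\<lambda>x. F x * indicator C x) \<in> borel_measurable ?M"
        by (intro borel_measurable_times[OF _ borel]) auto
    qed (use F in auto)
    then have "(\<lambda>n. 0) \<longlonglongrightarrow> (\<integral>x. F x * indicator C x \<partial>?M)" unfolding 2[OF cl] .
    then have C0: "(\<integral>x. F x * indicator C x \<partial>?M) = 0" using LIMSEQ_unique[OF tendsto_const] by metis
    have E_meas: "(\<lambda>x. indicator E x :: real) \<in> borel_measurable ?M"
      using that by (intro measurable_restrict_space1) auto
    have "AE x in lebesgue. x \<notin> T" using T by (rule AE_not_in)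
    then have "AE x in ?M. x \<notin> T" using S by (subst AE_restrict_space_iff) auto
    then have "(\<integral>x. F x * indicator E x \<partial>?M) = (\<integral>x. F x * indicator C x \<partial>?M)"
      using E_meas CT by (intro integral_cong_AE borel_measurable_times[OF _ borel] borel_measurable_times[OF _ E_meas])
        (auto simp: indicator_def)
    then show ?thesis using C0 by simp
  qed
  have 4: "AE x in ?M. c * F x \<le> 0" for c :: real
  proof -
    let ?E = "{x \<in> space ?M. c * F x > 0}"
    have "?E \<in> sets ?M" by measurable
    then have E: "?E \<in> sets lebesgue" using S by (simp add: sets_restrict_space_iff)
    have "(\<integral>x. max 0 (c * F x) \<partial>?M) = (\<integral>x. c * (F x * indicator ?E x) \<partial>?M)"
      by (rule Bochner_Integration.integral_cong) (auto simp: indicator_def)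
    also have "\<dots> = 0" using 3[OF E] by simp
    finally have "(\<integral>x. max 0 (c * F x) \<partial>?M) = 0" .
    moreover have "integrable ?M (\<lambda>x. max 0 (c * F x))" using F by (intro integrable_max) auto
    ultimately have "AE x in ?M. max 0 (c * F x) = 0"
      by (subst (asm) integral_nonneg_eq_0_iff_AE) auto
    then show ?thesis by eventually_elim (auto simp: max_def split: if_splits)
  qed
  show ?thesis using 4[of 1] 4[of "-1"] by eventually_elim simp
qed

section \<open>The Dirichlet integral\<close>

lemma borel_measurable_vector2 [measurable]:
  "(\<lambda>z::real\<times>real. vector [fst z, snd z] :: real^2) \<in> borel_measurable borel"
proof (rule borel_measurable_continuous_onI)
  have "continuous_on UNIV (\<lambda>z::real\<times>real. fst z *\<^sub>R axis 1 1 + snd z *\<^sub>R axis 2 (1::real) :: real^2)"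
    by (intro continuous_intros)
  moreover have "(vector [fst z, snd z] :: real^2) = fst z *\<^sub>R axis 1 1 + snd z *\<^sub>R axis 2 1" for z :: "real \<times> real"
    by (simp add: vec_eq_iff forall_2 axis_def)
  ultimately show "continuous_on UNIV (\<lambda>z::real\<times>real. vector [fst z, snd z] :: real^2)" by simp
qed

text \<open>This transports Tonelli's theorem from pairs to vectors with two components.\<close>

lemma lborel_real2_eq_distr:
  "(lborel :: (real^2) measure) = distr (lborel :: (real \<times> real) measure) borel (\<lambda>z. vector [fst z, snd z])"
proof (rule lborel_eqI)
  show "emeasure (distr lborel borel (\<lambda>z. vector [fst z, snd z])) (box l u) = (\<Prod>b\<in>Basis. (u - l) \<bullet> b)"
    if lu: "\<And>b. b \<in> Basis \<Longrightarrow> l \<bullet> b \<le> u \<bullet> b" for l u :: "real^2"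
  proof -
    have B: "(Basis :: (real^2) set) = {axis 1 1, axis 2 1}"
      by (auto simp: Basis_vec_def UNIV_2)
    have ne: "axis 1 1 \<noteq> (axis 2 1 :: real^2)" by (simp add: axis_eq_axis)
    have le: "l$1 \<le> u$1" "l$2 \<le> u$2" using lu[of "axis 1 1"] lu[of "axis 2 1"] B by (auto simp: inner_axis)
    have "(\<lambda>z::real\<times>real. vector [fst z, snd z]) -` box l u = box (l$1, l$2) (u$1, u$2)"
      by (auto simp: mem_box B inner_axis Basis_prod_def)
    then have "emeasure (distr lborel borel (\<lambda>z. vector [fst z, snd z])) (box l u)
        = emeasure lborel (box (l$1, l$2) (u$1, u$2))"
      by (subst emeasure_distr) auto
    also have "\<dots> = (\<Prod>b\<in>Basis. ((u$1, u$2) - (l$1, l$2)) \<bullet> b)"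
      using le by (intro emeasure_lborel_box) (auto simp: Basis_prod_def)
    also have "(\<Prod>b\<in>Basis. ((u$1, u$2) - (l$1, l$2)) \<bullet> b) = (u$1 - l$1) * (u$2 - l$2)"
      by (simp add: Basis_prod_def)
    also have "\<dots> = (\<Prod>b\<in>Basis. (u - l) \<bullet> b)" by (simp add: B ne inner_axis)
    finally show ?thesis .
  qed
qed simp

text \<open>The integral of \<open>x\<^sub>1\<^sup>a x\<^sub>2\<^sup>b (1 - x\<^sub>1 - x\<^sub>2)\<^sup>c\<close> over the triangle, for exponents above \<open>-1\<close>.\<close>

definition Dirichlet :: "real \<Rightarrow> real \<Rightarrow> real \<Rightarrow> real" where
  "Dirichlet a b c = Gamma (a + 1) * Gamma (b + 1) * Gamma (c + 1) / Gamma (a + b + c + 3)"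

text \<open>These relations say that the derivatives of \<open>x\<^sub>1\<^sup>a\<^sup>+\<^sup>1 x\<^sub>2\<^sup>b k\<^sup>c\<^sup>+\<^sup>1\<close> along the first axis, of
  \<open>x\<^sub>1\<^sup>a x\<^sub>2\<^sup>b\<^sup>+\<^sup>1 k\<^sup>c\<^sup>+\<^sup>1\<close> along the second, and of \<open>x\<^sub>1\<^sup>a\<^sup>+\<^sup>1 x\<^sub>2\<^sup>b\<^sup>+\<^sup>1 k\<^sup>c\<close> along the third
  side have integral zero, where \<open>k = 1 - x\<^sub>1 - x\<^sub>2\<close>.\<close>

lemma Dirichlet_shift:
  assumes "a > -1" "b > -1" "c > -1"
  shows "(a + 1) * Dirichlet a b (c + 1) = (c + 1) * Dirichlet (a + 1) b c"
    "(b + 1) * Dirichlet a b (c + 1) = (c + 1) * Dirichlet a (b + 1) c"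
    "(a + 1) * Dirichlet a (b + 1) c = (b + 1) * Dirichlet (a + 1) b c"
proof -
  have G: "Gamma (z + 1) = z * Gamma z" if "z > 0" for z :: real
    using that by (intro Gamma_plus1) (auto elim!: nonpos_Ints_cases)
  show "(a + 1) * Dirichlet a b (c + 1) = (c + 1) * Dirichlet (a + 1) b c"
    "(b + 1) * Dirichlet a b (c + 1) = (c + 1) * Dirichlet a (b + 1) c"
    "(a + 1) * Dirichlet a (b + 1) c = (b + 1) * Dirichlet (a + 1) b c"
    using G[of "a + 1"] G[of "b + 1"] G[of "c + 1"] assms
    by (simp_all add: Dirichlet_def algebra_simps)
qed

lemma nn_integral_Beta:
  fixes a c s :: real
  assumes "a > -1" "c > -1" "s > 0"
  shows "(\<integral>\<^sup>+x. ennreal (indicator {0<..<s} x * (x powr a * (s - x) powr c)) \<partial>lborel)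
    = ennreal (s powr (a + c + 1) * Beta (a + 1) (c + 1))"
proof -
  have "((\<lambda>x. x powr a * (1 - x) powr c) has_integral Beta (a + 1) (c + 1)) {0..1}"
    using has_integral_Beta_real[of "a + 1" "c + 1"] assms by simp
  then have "((\<lambda>x. x powr a * (1 - x) powr c) has_integral Beta (a + 1) (c + 1)) {0<..<1}"
    by (simp add: has_integral_Icc_iff_Ioo)
  then have "((\<lambda>x. indicator {0<..<1} x * (x powr a * (1 - x) powr c)) has_integral Beta (a + 1) (c + 1)) UNIV"
    by (subst (asm) has_integral_restrict_UNIV[symmetric])
      (auto elim!: has_integral_eq[rotated] simp: indicator_def)
  then have unit: "(\<integral>\<^sup>+x. ennreal (indicator {0<..<1} x * (x powr a * (1 - x) powr c)) \<partial>lborel) = ennreal (Beta (a + 1) (c + 1))"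
    by (intro nn_integral_has_integral_lborel) auto
  have "(\<integral>\<^sup>+x. ennreal (indicator {0<..<s} x * (x powr a * (s - x) powr c)) \<partial>lborel)
      = ennreal \<bar>s\<bar> * (\<integral>\<^sup>+t. ennreal (indicator {0<..<s} (0 + s * t) * ((0 + s * t) powr a * (s - (0 + s * t)) powr c)) \<partial>lborel)"
    using assms by (intro nn_integral_real_affine) auto
  also have "(\<lambda>t. ennreal (indicator {0<..<s} (0 + s * t) * ((0 + s * t) powr a * (s - (0 + s * t)) powr c)))
      = (\<lambda>t. ennreal (s powr (a + c)) * ennreal (indicator {0<..<1} t * (t powr a * (1 - t) powr c)))"
  proof
    fix t
    have "s - s * t = s * (1 - t)" by (simp add: algebra_simps)
    moreover have "s * t < s \<longleftrightarrow> t < 1" using assms by simp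
    ultimately show "ennreal (indicator {0<..<s} (0 + s * t) * ((0 + s * t) powr a * (s - (0 + s * t)) powr c))
        = ennreal (s powr (a + c)) * ennreal (indicator {0<..<1} t * (t powr a * (1 - t) powr c))"
      using assms by (auto simp: indicator_def zero_less_mult_iff powr_mult powr_add ennreal_mult[symmetric] mult_ac)
  qed
  also have "(\<integral>\<^sup>+t. ennreal (s powr (a + c)) * ennreal (indicator {0<..<1} t * (t powr a * (1 - t) powr c)) \<partial>lborel)
      = ennreal (s powr (a + c)) * ennreal (Beta (a + 1) (c + 1))"
    by (subst nn_integral_cmult) (auto simp: unit)
  also have "ennreal \<bar>s\<bar> * \<dots> = ennreal (s powr (a + c + 1) * Beta (a + 1) (c + 1))"
  proof -
    have "Beta (a + 1) (c + 1) \<ge> 0" using assms by (simp add: Beta_def Gamma_real_nonneg)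
    then show ?thesis using assms by (simp add: ennreal_mult[symmetric] powr_add mult_ac)
  qed
  finally show ?thesis .
qed

text \<open>For fixed \<open>y\<close> the inner integral is a Beta integral scaled to \<open>{0<..<1 - y}\<close>; the power of
  \<open>1 - y\<close> that it leaves behind makes the outer integral a Beta integral again.\<close>

lemma nn_integral_Dirichlet:
  assumes abc: "a > -1" "b > -1" "c > -1"
  shows "(\<integral>\<^sup>+x. ennreal (indicator std_triangle x * weight a b c x) \<partial>lborel) = ennreal (Dirichlet a b c)"
proof -
  have [measurable]: "std_triangle \<in> sets borel" using open_triangle by auto
  have coord [measurable]: "(\<lambda>x::real^2. x $ i) \<in> borel_measurable borel" for i
    by (intro borel_measurable_continuous_onI continuous_intros)
  have wm [measurable]: "weight a b c \<in> borel_measurable borel"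
    unfolding weight_def[abs_def] by measurable
  have "(\<integral>\<^sup>+x. ennreal (indicator std_triangle x * weight a b c x) \<partial>lborel)
     = (\<integral>\<^sup>+z. ennreal (indicator std_triangle (vector [fst z, snd z]) * weight a b c (vector [fst z, snd z])) \<partial>lborel)"
    unfolding lborel_real2_eq_distr by (subst nn_integral_distr) auto
  also have "\<dots> = (\<integral>\<^sup>+z. ennreal (indicator std_triangle (vector [fst z, snd z]) * weight a b c (vector [fst z, snd z]))
      \<partial>(lborel \<Otimes>\<^sub>M lborel))"
    by (simp add: lborel_prod)
  also have "\<dots> = (\<integral>\<^sup>+y. \<integral>\<^sup>+x. ennreal (indicator std_triangle (vector [x, y]) * weight a b c (vector [x, y])) \<partial>lborel \<partial>lborel)"
    by (subst lborel_pair.nn_integral_snd[symmetric]) (auto simp: lborel_prod)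
  also have "\<dots> = (\<integral>\<^sup>+y. ennreal (indicator {0<..<1} y * (y powr b * (1 - y) powr (a + c + 1))) * ennreal (Beta (a + 1) (c + 1)) \<partial>lborel)"
  proof (rule nn_integral_cong)
    fix y :: real
    show "(\<integral>\<^sup>+x. ennreal (indicator std_triangle (vector [x, y]) * weight a b c (vector [x, y])) \<partial>lborel)
      = ennreal (indicator {0<..<1} y * (y powr b * (1 - y) powr (a + c + 1))) * ennreal (Beta (a + 1) (c + 1))"
    proof (cases "0 < y \<and> y < 1")
      case True
      have "ennreal (indicator std_triangle (vector [x, y]) * weight a b c (vector [x, y]))
        = ennreal (y powr b) * ennreal (indicator {0<..<1 - y} x * (x powr a * (1 - y - x) powr c))" for x
        using True by (auto simp: indicator_def std_triangle_def weight_def ennreal_mult'[symmetric] algebra_simps)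
      then have "(\<integral>\<^sup>+x. ennreal (indicator std_triangle (vector [x, y]) * weight a b c (vector [x, y])) \<partial>lborel)
        = ennreal (y powr b) * (\<integral>\<^sup>+x. ennreal (indicator {0<..<1 - y} x * (x powr a * (1 - y - x) powr c)) \<partial>lborel)"
        by (simp add: nn_integral_cmult)
      also have "\<dots> = ennreal (y powr b) * ennreal ((1 - y) powr (a + c + 1) * Beta (a + 1) (c + 1))"
        using True abc by (subst nn_integral_Beta) auto
      finally show ?thesis
        using True abc by (simp add: ennreal_mult[symmetric] Beta_def Gamma_real_nonneg mult_ac)
    next
      case False
      then have "indicator std_triangle (vector [x, y] :: real^2) = (0::real)" for x
        by (auto simp: indicator_def std_triangle_def)
      then show ?thesis using False by simp
    qed
  qed
  also have "\<dots> = ennreal (Beta (b + 1) (a + c + 1 + 1)) * ennreal (Beta (a + 1) (c + 1))"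
    using nn_integral_Beta[of b "a + c + 1" 1] abc by (subst nn_integral_multc) auto
  also have "\<dots> = ennreal (Dirichlet a b c)"
  proof -
    have "Gamma (a + c + 2) \<noteq> 0" using abc Gamma_real_pos[of "a + c + 2"] by linarith
    moreover have "0 \<le> Beta (a + 1) (c + 1)"
      using abc by (simp add: Beta_def Gamma_real_nonneg)
    ultimately show ?thesis
      using abc by (simp add: ennreal_mult[symmetric] Dirichlet_def Beta_def Gamma_real_nonneg algebra_simps)
  qed
  finally show ?thesis .
qed

lemma has_bochner_integral_Dirichlet:
  assumes abc: "a > -1" "b > -1" "c > -1"
  shows "has_bochner_integral (lebesgue_on std_triangle) (weight a b c) (Dirichlet a b c)"
proof -
  have [measurable]: "std_triangle \<in> sets borel" using open_triangle by auto
  have coord [measurable]: "(\<lambda>x::real^2. x $ i) \<in> borel_measurable borel" for i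
    by (intro borel_measurable_continuous_onI continuous_intros)
  have wm [measurable]: "weight a b c \<in> borel_measurable borel"
    unfolding weight_def[abs_def] by measurable
  show ?thesis
  proof (rule has_bochner_integral_nn_integral)
    show "weight a b c \<in> borel_measurable (lebesgue_on std_triangle)"
      by (intro measurable_restrict_space1 measurable_completion) simp
    show "AE x in lebesgue_on std_triangle. 0 \<le> weight a b c x" by (simp add: weight_def)
    show "0 \<le> Dirichlet a b c" using abc by (simp add: Dirichlet_def Gamma_real_nonneg)
    have "(\<integral>\<^sup>+x. ennreal (weight a b c x) \<partial>lebesgue_on std_triangle)
        = (\<integral>\<^sup>+x. ennreal (weight a b c x) * indicator std_triangle x \<partial>lebesgue)"
      using open_triangle by (intro nn_integral_restrict_space) auto
    also have "\<dots> = (\<integral>\<^sup>+x. ennreal (indicator std_triangle x * weight a b c x) \<partial>lborel)"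
      by (subst nn_integral_completion) (auto intro!: nn_integral_cong simp: indicator_def)
    finally show "(\<integral>\<^sup>+x. ennreal (weight a b c x) \<partial>lebesgue_on std_triangle) = ennreal (Dirichlet a b c)"
      using nn_integral_Dirichlet[OF abc] by simp
  qed
qed

section \<open>Weighted Lebesgue spaces\<close>

text \<open>One construction for both function spaces: scalar functions with the form \<open>u v \<rho>\<close> and vector
  fields with the form \<open>h \<bullet> \<rho> \<Phi> g\<close>.\<close>

locale weighted_L2 =
  fixes M :: "'a measure" and b :: "'a \<Rightarrow> 'b::euclidean_space \<Rightarrow> 'b \<Rightarrow> real"
  assumes bilinear: "x \<in> space M \<Longrightarrow> bounded_bilinear (b x)"
    and symmetric: "x \<in> space M \<Longrightarrow> b x h g = b x g h"
    and coercive: "x \<in> space M \<Longrightarrow> \<exists>c>0. \<forall>h. c * (norm h)\<^sup>2 \<le> b x h h"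
    and measurable_form: "f \<in> borel_measurable M \<Longrightarrow> f' \<in> borel_measurable M \<Longrightarrow>
        (\<lambda>x. b x (f x) (f' x)) \<in> borel_measurable M"
begin

definition L2 :: "('a \<Rightarrow> 'b) set" where
  "L2 = {f \<in> borel_measurable M. integrable M (\<lambda>x. b x (f x) (f x))}"

definition inner2 :: "('a \<Rightarrow> 'b) \<Rightarrow> ('a \<Rightarrow> 'b) \<Rightarrow> real" where
  "inner2 f g = (\<integral>x. b x (f x) (g x) \<partial>M)"

lemma pointwise: "x \<in> space M \<Longrightarrow> semi_inner_on UNIV (b x)"
proof
  assume x: "x \<in> space M"
  interpret bounded_bilinear "b x" by (rule bilinear[OF x])
  show "b x (u + v) w = b x u w + b x v w" "b x (c *\<^sub>R u) w = c * b x u w" for u v w c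
    by (simp_all add: add_left scaleR_left)
  show "b x u v = b x v u" for u v by (rule symmetric[OF x])
  obtain c where c: "c > 0" "\<And>h. c * (norm h)\<^sup>2 \<le> b x h h" using coercive[OF x] by blast
  show "0 \<le> b x u u" for u using c(2)[of u] c(1) by (smt (verit) mult_nonneg_nonneg zero_le_power2)
qed auto

lemma form_nonneg: "x \<in> space M \<Longrightarrow> 0 \<le> b x h h"
  using semi_inner_on.nonneg[OF pointwise] by simp

lemma form_zero_iff: "x \<in> space M \<Longrightarrow> b x h h = 0 \<longleftrightarrow> h = 0"
proof
  assume x: "x \<in> space M"
  then obtain c where c: "c > 0" "\<And>h. c * (norm h)\<^sup>2 \<le> b x h h" using coercive by blast
  show "h = 0" if "b x h h = 0"
    using c(2)[of h] c(1) that by (simp add: mult_le_0_iff)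
  show "b x h h = 0" if "h = 0"
    using that semi_inner_on.zero_left[OF pointwise[OF x], of 0] by simp
qed

lemma form_le: "x \<in> space M \<Longrightarrow> \<bar>b x h g\<bar> \<le> b x h h + b x g g"
proof -
  assume x: "x \<in> space M"
  interpret semi_inner_on UNIV "b x" by (rule pointwise[OF x])
  have "0 \<le> b x h h + 2 * b x h g + b x g g" "0 \<le> b x h h - 2 * b x h g + b x g g"
    using nonneg[of "h + g"] nonneg[of "h - g"] square_add[of h g] square_diff[of h g] by auto
  then show ?thesis using nonneg[of h] nonneg[of g] by auto
qed

lemma integrable_form:
  assumes "f \<in> L2" "g \<in> L2"
  shows "integrable M (\<lambda>x. b x (f x) (g x))"
proof (rule Bochner_Integration.integrable_bound[where f = "\<lambda>x. b x (f x) (f x) + b x (g x) (g x)"])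
  show "AE x in M. norm (b x (f x) (g x)) \<le> norm (b x (f x) (f x) + b x (g x) (g x))"
    using form_le form_nonneg by (intro AE_I2) (auto intro: order_trans[OF _ abs_ge_self])
qed (use assms in \<open>auto simp: L2_def intro: measurable_form\<close>)

sublocale semi_inner_on L2 inner2
proof
  show "subspace L2"
  proof (rule subspaceI)
    show "0 \<in> L2"
    proof -
      have "integrable M (\<lambda>x. b x (0::'b) 0) \<longleftrightarrow> integrable M (\<lambda>x. 0 :: real)"
        by (intro Bochner_Integration.integrable_cong) (auto simp: form_zero_iff)
      then show ?thesis by (simp add: L2_def zero_fun_def)
    qed
    show "f + g \<in> L2" if f: "f \<in> L2" and g: "g \<in> L2" for f g
    proof -
      have fm: "f \<in> borel_measurable M" "g \<in> borel_measurable M" using f g by (auto simp: L2_def)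
      have fi: "integrable M (\<lambda>x. b x (f x) (f x))" "integrable M (\<lambda>x. b x (g x) (g x))"
        using f g by (auto simp: L2_def)
      have s: "(\<lambda>x. f x + g x) \<in> borel_measurable M" using fm by simp
      have "integrable M (\<lambda>x. b x (f x + g x) (f x + g x))"
      proof (rule Bochner_Integration.integrable_bound[where f = "\<lambda>x. 2 * b x (f x) (f x) + 2 * b x (g x) (g x)"])
        show "AE x in M. norm (b x (f x + g x) (f x + g x)) \<le> norm (2 * b x (f x) (f x) + 2 * b x (g x) (g x))"
        proof (rule AE_I2)
          fix x assume x: "x \<in> space M"
          interpret semi_inner_on UNIV "b x" by (rule pointwise[OF x])
          have "b x (f x + g x) (f x + g x) \<le> 2 * b x (f x) (f x) + 2 * b x (g x) (g x)"
            using nonneg[of "f x - g x"] square_add[of "f x" "g x"] square_diff[of "f x" "g x"] by auto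
          then show "norm (b x (f x + g x) (f x + g x)) \<le> norm (2 * b x (f x) (f x) + 2 * b x (g x) (g x))"
            using nonneg[of "f x + g x"] by auto
        qed
        show "(\<lambda>x. b x (f x + g x) (f x + g x)) \<in> borel_measurable M" by (intro measurable_form s)
      qed (use fi in auto)
      with s show ?thesis by (simp add: L2_def plus_fun_def)
    qed
    show "c *\<^sub>R f \<in> L2" if f: "f \<in> L2" for c f
    proof -
      have "integrable M (\<lambda>x. b x (c *\<^sub>R f x) (c *\<^sub>R f x)) \<longleftrightarrow> integrable M (\<lambda>x. c\<^sup>2 * b x (f x) (f x))"
        by (intro Bochner_Integration.integrable_cong) (auto simp: semi_inner_on.square_scale[OF pointwise])
      then show ?thesis using f by (auto simp: L2_def scaleR_fun_def)
    qed
  qed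
  show "inner2 (f + g) h = inner2 f h + inner2 g h" if "f \<in> L2" "g \<in> L2" "h \<in> L2" for f g h
  proof -
    have "inner2 (f + g) h = (\<integral>x. b x (f x) (h x) + b x (g x) (h x) \<partial>M)"
      unfolding inner2_def
      by (intro Bochner_Integration.integral_cong) (auto simp: semi_inner_on.add_left[OF pointwise])
    then show ?thesis using that by (simp add: inner2_def integrable_form)
  qed
  show "inner2 (c *\<^sub>R f) h = c * inner2 f h" if "f \<in> L2" "h \<in> L2" for f h c
  proof -
    have "inner2 (c *\<^sub>R f) h = (\<integral>x. c * b x (f x) (h x) \<partial>M)"
      unfolding inner2_def
      by (intro Bochner_Integration.integral_cong) (auto simp: semi_inner_on.scale_left[OF pointwise])
    then show ?thesis by (simp add: inner2_def)
  qed
  show "inner2 f g = inner2 g f" for f g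
    unfolding inner2_def by (intro Bochner_Integration.integral_cong) (auto simp: symmetric)
  show "0 \<le> inner2 f f" for f
    unfolding inner2_def by (intro integral_nonneg_AE AE_I2) (auto simp: form_nonneg)
qed

lemma null_iff_AE:
  assumes "f \<in> L2"
  shows "inner2 f f = 0 \<longleftrightarrow> (AE x in M. f x = 0)"
proof -
  have "inner2 f f = 0 \<longleftrightarrow> (AE x in M. b x (f x) (f x) = 0)"
    unfolding inner2_def using assms form_nonneg
    by (intro integral_nonneg_eq_0_iff_AE) (auto simp: L2_def)
  also have "\<dots> \<longleftrightarrow> (AE x in M. f x = 0)"
    by (intro AE_cong) (auto simp: form_zero_iff)
  finally show ?thesis .
qed

lemma nn_integral_eq_inner2:
  assumes "f \<in> L2"
  shows "(\<integral>\<^sup>+x. ennreal (b x (f x) (f x)) \<partial>M) = ennreal (inner2 f f)"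
  unfolding inner2_def using assms form_nonneg
  by (intro nn_integral_eq_integral) (auto simp: L2_def intro: AE_I2)

lemma complete:
  assumes f: "\<And>n. f n \<in> L2"
    and C: "\<And>\<epsilon>. \<epsilon> > 0 \<Longrightarrow> \<exists>N. \<forall>i\<ge>N. \<forall>j\<ge>N. inner2 (f i - f j) (f i - f j) \<le> \<epsilon>"
  shows "\<exists>g\<in>L2. tends f g"
proof -
  have fm: "f n \<in> borel_measurable M" for n using f by (simp add: L2_def)
  have fd: "(\<integral>\<^sup>+x. ennreal (b x (f i x - f j x) (f i x - f j x)) \<partial>M) = ennreal (inner2 (f i - f j) (f i - f j))" for i j
    using nn_integral_eq_inner2[of "f i - f j"] f by auto
  obtain g where g: "g \<in> borel_measurable M"
    and lim: "\<And>\<epsilon>. \<epsilon> > 0 \<Longrightarrow> \<exists>K. \<forall>n\<ge>K. (\<integral>\<^sup>+x. ennreal (b x (f n x - g x) (f n x - g x)) \<partial>M) \<le> ennreal \<epsilon>"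
  proof (rule weighted_Riesz_Fischer[where f = f and M = M and N = "\<lambda>x h. b x h h"])
    show "continuous_on UNIV (\<lambda>h. b x h h)" if "x \<in> space M" for x
      using bounded_bilinear.continuous_on[OF bilinear[OF that] continuous_on_id continuous_on_id] .
    show "\<exists>K. \<forall>i\<ge>K. \<forall>j\<ge>K. (\<integral>\<^sup>+x. ennreal (b x (f i x - f j x) (f i x - f j x)) \<partial>M) \<le> ennreal \<epsilon>"
      if "\<epsilon> > 0" for \<epsilon>
      unfolding fd using C[OF that] by (meson ennreal_leI)
  qed (auto intro: fm measurable_form coercive)
  have d: "f n - g \<in> L2" if "(\<integral>\<^sup>+x. ennreal (b x (f n x - g x) (f n x - g x)) \<partial>M) \<le> ennreal \<epsilon>" for n \<epsilon>
  proof -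
    have m: "(\<lambda>x. f n x - g x) \<in> borel_measurable M" using fm g by simp
    have "integrable M (\<lambda>x. b x (f n x - g x) (f n x - g x))"
      using that form_nonneg
      by (intro integrableI_nonneg measurable_form m) (auto intro!: AE_I2 simp: top_unique less_top[symmetric])
    with m show ?thesis by (simp add: L2_def fun_diff_def)
  qed
  obtain K where "(\<integral>\<^sup>+x. ennreal (b x (f K x - g x) (f K x - g x)) \<partial>M) \<le> ennreal 1"
    using lim[of 1] by auto
  from closed(3)[OF f d[OF this], of K] have gL: "g \<in> L2" by simp
  have "\<forall>\<^sub>F n in sequentially. dist (inner2 (f n - g) (f n - g)) 0 < \<epsilon>" if \<epsilon>: "\<epsilon> > 0" for \<epsilon>
  proof -
    obtain K where K: "\<And>n. n \<ge> K \<Longrightarrow> (\<integral>\<^sup>+x. ennreal (b x (f n x - g x) (f n x - g x)) \<partial>M) \<le> ennreal (\<epsilon>/2)"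
      using lim[of "\<epsilon>/2"] \<epsilon> by auto
    have "dist (inner2 (f n - g) (f n - g)) 0 < \<epsilon>" if "n \<ge> K" for n
    proof -
      have "ennreal (inner2 (f n - g) (f n - g)) \<le> ennreal (\<epsilon>/2)"
        using K[OF that] nn_integral_eq_inner2[of "f n - g"] f gL by auto
      then have "inner2 (f n - g) (f n - g) \<le> \<epsilon>/2" using \<epsilon> by (subst (asm) ennreal_le_iff) auto
      then show ?thesis using \<epsilon> nonneg[of "f n - g"] f gL by (simp add: dist_real_def)
    qed
    then show ?thesis by (auto simp: eventually_sequentially)
  qed
  then have "tends f g" unfolding tends_def by (rule tendstoI)
  with gL show ?thesis by blast
qed

end

section \<open>Polynomials in two variables\<close>

definition monom2 :: "nat \<Rightarrow> nat \<Rightarrow> real^2 \<Rightarrow> real" where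
  "monom2 i j x = x$1 ^ i * x$2 ^ j"

text \<open>The Cantor enumeration of pairs runs along the diagonals and so lists the monomials by
  nondecreasing degree.\<close>

definition nth_monom :: "nat \<Rightarrow> real^2 \<Rightarrow> real" where
  "nth_monom k = case_prod monom2 (prod_decode k)"

lemma nth_monom_encode: "nth_monom (prod_encode (i, j)) = monom2 i j"
  by (simp add: nth_monom_def)

lemma range_nth_monom: "range nth_monom = {monom2 i j |i j. True}"
proof
  show "range nth_monom \<subseteq> {monom2 i j |i j. True}" by (auto simp: nth_monom_def split_beta)
  show "{monom2 i j |i j. True} \<subseteq> range nth_monom" using nth_monom_encode by (auto intro: rangeI) (metis nth_monom_encode rangeI)
qed

lemmas real_polynomial_linear = real_polynomial_function.intros(1)
  and real_polynomial_const = real_polynomial_function.intros(2)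
  and real_polynomial_add = real_polynomial_function.intros(3)
  and real_polynomial_mult = real_polynomial_function.intros(4)

lemma real_polynomial_coord: "real_polynomial_function (\<lambda>x::real^2. x $ i)"
  by (intro real_polynomial_linear bounded_linear_vec_nth)

lemma real_polynomial_monom2: "real_polynomial_function (monom2 i j)"
  unfolding monom2_def[abs_def]
  by (intro real_polynomial_mult real_polynomial_function_power real_polynomial_coord)

lemma subspace_real_polynomials: "subspace (Collect (real_polynomial_function :: ((real^2) \<Rightarrow> real) \<Rightarrow> bool))"
  by (intro subspaceI)
     (auto simp: zero_fun_def plus_fun_def scaleR_fun_def
       intro: real_polynomial_const real_polynomial_add real_polynomial_mult)

theorem span_nth_monom: "span (range nth_monom) = Collect real_polynomial_function"
proof
  show "span (range nth_monom) \<subseteq> Collect real_polynomial_function"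
    by (intro span_minimal subspace_real_polynomials) (auto simp: range_nth_monom real_polynomial_monom2)
  have mm: "monom2 i j \<in> span (range nth_monom)" for i j
    by (intro span_base) (auto simp: range_nth_monom)
  have prod: "f * g \<in> span (range nth_monom)"
    if f: "f \<in> span (range nth_monom)" and g: "g \<in> span (range nth_monom)" for f g
    using f
  proof (induction rule: span_induct_alt)
    case base
    have "0 * g = 0" by (simp add: fun_eq_iff)
    then show ?case by (metis span_zero)
  next
    case (step c a f)
    then obtain i j where a: "a = monom2 i j" by (auto simp: range_nth_monom)
    have "a * g \<in> span (range nth_monom)"
      using g
    proof (induction rule: span_induct_alt)
      case base
      have "a * 0 = 0" by (simp add: fun_eq_iff)
      then show ?case by (metis span_zero)
    next
      case (step d b g)
      then obtain k l where b: "b = monom2 k l" by (auto simp: range_nth_monom)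
      have "a * (d *\<^sub>R b + g) = d *\<^sub>R monom2 (i + k) (j + l) + a * g"
        by (simp add: a b fun_eq_iff monom2_def power_add algebra_simps)
      then show ?case using step(2) by (metis mm span_add span_scale)
    qed
    moreover have "(c *\<^sub>R a + f) * g = c *\<^sub>R (a * g) + f * g"
      by (simp add: fun_eq_iff algebra_simps)
    ultimately show ?case using step(2) by (metis span_add span_scale)
  qed
  show "Collect real_polynomial_function \<subseteq> span (range nth_monom)"
  proof safe
    fix p :: "real^2 \<Rightarrow> real" assume "real_polynomial_function p"
    then show "p \<in> span (range nth_monom)"
    proof (induction rule: real_polynomial_function.induct)
      case (linear f)
      then interpret bounded_linear f .
      have "f = f (axis 1 1) *\<^sub>R monom2 1 0 + f (axis 2 1) *\<^sub>R monom2 0 1"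
      proof
        fix x :: "real^2"
        have "x = x$1 *\<^sub>R axis 1 1 + x$2 *\<^sub>R axis 2 1"
          by (simp add: vec_eq_iff forall_2 axis_def)
        then have "f x = f (x$1 *\<^sub>R axis 1 1 + x$2 *\<^sub>R axis 2 1)" by simp
        then show "f x = (f (axis 1 1) *\<^sub>R monom2 1 0 + f (axis 2 1) *\<^sub>R monom2 0 1) x"
          by (simp add: add scaleR monom2_def)
      qed
      then show ?case using mm by (metis span_add span_scale)
    next
      case (const c)
      have "(\<lambda>x. c) = c *\<^sub>R monom2 0 0" by (simp add: fun_eq_iff monom2_def)
      then show ?case using mm by (metis span_scale)
    next
      case (add f g)
      then show ?case using span_add[of f _ g] by (simp add: plus_fun_def)
    next
      case (mult f g)
      then show ?case using prod[of f g] by (simp add: times_fun_def)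
    qed
  qed
qed

subsection \<open>Partial derivatives\<close>

lemma partial_plus:
  assumes "f differentiable (at x)" "g differentiable (at x)"
  shows "partial i (\<lambda>y. f y + g y) x = partial i f x + partial i g x"
  using partial_eqI[OF has_derivative_add[OF assms[unfolded frechet_derivative_works]]]
  by (simp add: partial_def)

lemma partial_times:
  assumes "f differentiable (at x)" "g differentiable (at x)"
  shows "partial i (\<lambda>y. f y * g y) x = partial i f x * g x + f x * partial i g x"
  using partial_eqI[OF has_derivative_mult[OF assms[unfolded frechet_derivative_works]]]
  by (simp add: partial_def)

lemma partial_const: "partial i (\<lambda>y. c) x = 0"
  using partial_eqI[OF has_derivative_const] .

lemma partial_bounded_linear: "bounded_linear f \<Longrightarrow> partial i f x = f (axis i 1)"
  using partial_eqI bounded_linear_imp_has_derivative by blast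

lemma partial_scale:
  "f differentiable (at x) \<Longrightarrow> partial i (\<lambda>y. c * f y) x = c * partial i f x"
  using partial_times[of "\<lambda>_. c" x f i] by (simp add: partial_const)

lemma partial_minus:
  "f differentiable (at x) \<Longrightarrow> g differentiable (at x) \<Longrightarrow> partial i (\<lambda>y. f y - g y) x = partial i f x - partial i g x"
  using partial_plus[of f x "\<lambda>y. (-1) * g y" i] partial_scale[of g x i "-1"]
  by (simp add: differentiable_minus)

lemma poly_differentiable: "real_polynomial_function p \<Longrightarrow> p differentiable (at x)"
  by (rule differentiable_at_real_polynomial_function)

lemma real_polynomial_partial:
  fixes p :: "real^2 \<Rightarrow> real"
  assumes "real_polynomial_function p"
  shows "real_polynomial_function (partial i p)"
  using assms
proof (induction rule: real_polynomial_function.induct)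
  case (linear f)
  then have "partial i f = (\<lambda>x. f (axis i 1))" by (intro ext partial_bounded_linear)
  then show ?case by (simp add: real_polynomial_const)
next
  case (const c)
  have "partial i (\<lambda>x. c) = (\<lambda>x. 0)" by (intro ext partial_const)
  then show ?case by (simp add: real_polynomial_const)
next
  case (add f g)
  then have "partial i (\<lambda>x. f x + g x) = (\<lambda>x. partial i f x + partial i g x)"
    by (intro ext partial_plus poly_differentiable)
  then show ?case using add by (simp add: real_polynomial_add)
next
  case (mult f g)
  then have "partial i (\<lambda>x. f x * g x) = (\<lambda>x. partial i f x * g x + f x * partial i g x)"
    by (intro ext partial_times poly_differentiable)
  then show ?case using mult by (simp add: real_polynomial_add real_polynomial_mult)
qed

lemma partial_monom2:
  "partial 1 (monom2 i j) x = real i * monom2 (i - 1) j x"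
  "partial 2 (monom2 i j) x = real j * monom2 i (j - 1) x"
proof -
  have c: "((\<lambda>y::real^2. y$k) has_derivative (\<lambda>h. h$k)) (at x)" for k
    by (rule bounded_linear.has_derivative[OF bounded_linear_vec_nth has_derivative_ident])
  have "(monom2 i j has_derivative
      (\<lambda>h. x$1 ^ i * (real j * h$2 * x$2 ^ (j - 1)) + real i * h$1 * x$1 ^ (i - 1) * x$2 ^ j)) (at x)"
    unfolding monom2_def[abs_def] by (intro has_derivative_mult has_derivative_power c)
  from partial_eqI[OF this]
  show "partial 1 (monom2 i j) x = real i * monom2 (i - 1) j x"
    "partial 2 (monom2 i j) x = real j * monom2 i (j - 1) x"
    by (simp_all add: axis_def monom2_def)
qed

text \<open>The factors \<open>real i\<close> and \<open>real j\<close> cover the case of exponent zero, where the truncated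
  subtraction in the exponent is wrong.\<close>

lemma coord_monom2:
  "real i * (x$1 * monom2 (i - 1) j x) = real i * monom2 i j x"
  "real j * (x$2 * monom2 i (j - 1) x) = real j * monom2 i j x"
  by (cases i; simp add: monom2_def) (cases j; simp add: monom2_def)

subsection \<open>Degrees in the enumeration\<close>

definition monom_degree :: "nat \<Rightarrow> nat" where
  "monom_degree k = fst (prod_decode k) + snd (prod_decode k)"

lemma prod_encode_less:
  "i > 0 \<Longrightarrow> prod_encode (i - 1, j) < prod_encode (i, j)"
  "j > 0 \<Longrightarrow> prod_encode (i, j - 1) < prod_encode (i, j)"
proof -
  show "prod_encode (i - 1, j) < prod_encode (i, j)" if "i > 0"
    using that by (cases i) (simp_all add: prod_encode_def)
  show "prod_encode (i, j - 1) < prod_encode (i, j)" if "j > 0"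
    using that by (cases j) (simp_all add: prod_encode_def)
qed

lemma finite_monom_degree: "finite {k. monom_degree k < n}"
proof (rule finite_subset)
  show "{k. monom_degree k < n} \<subseteq> prod_encode ` ({..<n} \<times> {..<n})"
  proof
    fix k assume "k \<in> {k. monom_degree k < n}"
    then have "prod_decode k \<in> {..<n} \<times> {..<n}"
      by (cases "prod_decode k") (auto simp: monom_degree_def)
    then show "k \<in> prod_encode ` ({..<n} \<times> {..<n})" by (metis imageI prod_decode_inverse)
  qed
qed auto

text \<open>Along the curve \<open>(t, t ^ N)\<close> the monomials below a given index become distinct powers of \<open>t\<close>
  once \<open>N\<close> exceeds their degrees in the first variable, so a vanishing combination would be a
  nonzero polynomial in one variable with infinitely many zeros.\<close>

lemma nth_monom_independent:
  assumes v: "v \<in> span (nth_monom ` {..<n})"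
  shows "\<exists>x\<in>std_triangle. nth_monom n x \<noteq> v x"
proof (rule ccontr)
  assume "\<not> ?thesis"
  then have eq: "nth_monom n x = v x" if "x \<in> std_triangle" for x using that by blast
  define N where "N = Suc n"
  define e where "e k = fst (prod_decode k) + N * snd (prod_decode k)" for k
  define curve :: "real \<Rightarrow> real^2" where "curve t = vector [t, t ^ N]" for t
  have m: "nth_monom k (curve t) = poly (monom 1 (e k)) t" for k t
    by (cases "prod_decode k")
       (simp add: nth_monom_def monom2_def e_def curve_def poly_monom power_add power_mult)
  have e_ne: "e k \<noteq> e n" if "k < n" for k
  proof
    assume eq: "e k = e n"
    have fst_lt: "fst (prod_decode j) < N" if "j \<le> n" for j
      using le_prod_encode_1[of "fst (prod_decode j)" "snd (prod_decode j)"] that by (simp add: N_def)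
    have "e j mod N = fst (prod_decode j)" "e j div N = snd (prod_decode j)" if "j \<le> n" for j
      using fst_lt[OF that] unfolding e_def by simp_all
    then have "prod_decode k = prod_decode n" using eq that by (metis less_imp_le order_refl prod.collapse)
    then show False using that by simp
  qed
  have "\<exists>q. (\<forall>t. poly q t = v (curve t)) \<and> coeff q (e n) = 0"
    using v
  proof (induction rule: span_induct_alt)
    case base
    show ?case by (intro exI[of _ 0]) simp
  next
    case (step c x y)
    then obtain k q where "x = nth_monom k" "k < n" "\<forall>t. poly q t = y (curve t)" "coeff q (e n) = 0" by auto
    then show ?case
      by (intro exI[of _ "smult c (monom 1 (e k)) + q"]) (simp add: m e_ne)
  qed
  then obtain q where q: "\<And>t. poly q t = v (curve t)" "coeff q (e n) = 0" by blast
  let ?r = "monom 1 (e n) - q"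
  have "coeff ?r (e n) = 1" using q by simp
  then have "?r \<noteq> 0" by (metis coeff_0 zero_neq_one)
  then have "finite {t. poly ?r t = 0}" by (rule poly_roots_finite)
  moreover have "{0<..<1/2} \<subseteq> {t. poly ?r t = 0}"
  proof
    fix t :: real assume t: "t \<in> {0<..<1/2}"
    have "t ^ N \<le> t ^ 1" using t by (intro power_decreasing) (auto simp: N_def)
    then have "curve t \<in> std_triangle" using t by (auto simp: curve_def std_triangle_def)
    then have "poly (monom 1 (e n)) t = v (curve t)" using eq m by metis
    then show "t \<in> {t. poly ?r t = 0}" using q by simp
  qed
  moreover have "infinite {0<..<1/2::real}" by (simp add: infinite_Ioo)
  ultimately show False using finite_subset by blast
qed

section \<open>The weighted spaces on the triangle\<close>

lemma borel_measurable_lebesgue_on: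
  "g \<in> borel_measurable borel \<Longrightarrow> g \<in> borel_measurable (lebesgue_on S)"
  by (intro measurable_restrict_space1 measurable_completion) simp

lemma borel_measurable_coord:
  fixes f :: "'a \<Rightarrow> real^'n"
  assumes "f \<in> borel_measurable M"
  shows "(\<lambda>x. f x $ i) \<in> borel_measurable M"
proof -
  have "(\<lambda>x. f x \<bullet> axis i 1) \<in> borel_measurable M" using assms by measurable
  then show ?thesis by (simp add: inner_axis)
qed

text \<open>Along the directions of the three sides of the triangle the matrix \<open>\<Phi>\<close> becomes a sum of three
  squares with coefficients that are positive in the interior.\<close>

lemma form_decomposition:
  "h \<bullet> (r *\<^sub>R (coeff_mat x *v g)) = r * (x$1 * (1 - x$1 - x$2) * (h$1 * g$1)
     + x$2 * (1 - x$1 - x$2) * (h$2 * g$2) + x$1 * x$2 * ((h$1 - h$2) * (g$1 - g$2)))"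
  by (simp add: inner_vec_def sum_2 coeff_mat_def matrix_vector_mult_def algebra_simps)

lemma triangle_pos:
  assumes "x \<in> std_triangle"
  shows "x$1 > 0" "x$2 > 0" "1 - x$1 - x$2 > 0" "x$1 < 1" "x$2 < 1"
  using assms by (auto simp: std_triangle_def)

lemma weight_pos: "x \<in> std_triangle \<Longrightarrow> weight a b c x > 0"
  using triangle_pos[of x] by (simp add: weight_def)

lemma bounded_triangle: "bounded std_triangle"
proof (rule boundedI)
  fix x assume x: "x \<in> std_triangle"
  have "norm x \<le> (\<Sum>i\<in>UNIV. \<bar>x$i\<bar>)" by (rule norm_le_l1_cart)
  also have "\<dots> \<le> 2" using triangle_pos[OF x] by (simp add: sum_2)
  finally show "norm x \<le> 2" .
qed

lemma triangle_lebesgue: "std_triangle \<in> sets lebesgue"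
  using open_triangle by auto

lemma polynomial_bounded_on_triangle:
  assumes "real_polynomial_function p"
  obtains C where "\<And>x. x \<in> std_triangle \<Longrightarrow> \<bar>p x\<bar> \<le> C"
proof -
  obtain R where R: "std_triangle \<subseteq> ball 0 R" using bounded_subset_ballD[OF bounded_triangle] by blast
  have "bounded (p ` cball 0 R)"
    using continuous_real_polymonial_function[OF assms]
    by (intro compact_imp_bounded compact_continuous_image continuous_at_imp_continuous_on) auto
  then obtain C where "\<And>x. x \<in> cball 0 R \<Longrightarrow> \<bar>p x\<bar> \<le> C" by (fastforce simp: bounded_iff)
  then show thesis using that R by (meson ball_subset_cball subsetD)
qed

lemma polynomial_measurable:
  fixes p :: "real^2 \<Rightarrow> real"
  shows "real_polynomial_function p \<Longrightarrow> p \<in> borel_measurable (lebesgue_on S)"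
  by (intro borel_measurable_lebesgue_on borel_measurable_continuous_onI continuous_at_imp_continuous_on)
     (auto intro: continuous_real_polymonial_function)

lemma weight_measurable: "weight a b c \<in> borel_measurable (lebesgue_on S)"
proof -
  have [measurable]: "(\<lambda>x::real^2. x $ i) \<in> borel_measurable borel" for i
    by (intro borel_measurable_continuous_onI continuous_intros)
  show ?thesis unfolding weight_def[abs_def] by (intro borel_measurable_lebesgue_on) measurable
qed

definition poly_field :: "(real^2 \<Rightarrow> real^2) \<Rightarrow> bool" where
  "poly_field v \<longleftrightarrow> (\<forall>i. real_polynomial_function (\<lambda>x. v x $ i))"

locale triangle_weight =
  fixes \<alpha> \<beta> \<gamma> :: real
  assumes \<alpha>: "\<alpha> > -1" and \<beta>: "\<beta> > -1" and \<gamma>: "\<gamma> > -1"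
begin

abbreviation \<rho> :: "real^2 \<Rightarrow> real" where "\<rho> \<equiv> weight \<alpha> \<beta> \<gamma>"
abbreviation \<Omega> :: "(real^2) measure" where "\<Omega> \<equiv> lebesgue_on std_triangle"

lemma integrable_weight: "integrable \<Omega> \<rho>"
  using has_bochner_integral_Dirichlet[OF \<alpha> \<beta> \<gamma>] by (simp add: has_bochner_integral_iff)

definition mass_form :: "real^2 \<Rightarrow> real \<Rightarrow> real \<Rightarrow> real" where
  "mass_form x u v = u * v * \<rho> x"

definition gradient_form :: "real^2 \<Rightarrow> real^2 \<Rightarrow> real^2 \<Rightarrow> real" where
  "gradient_form x h g = h \<bullet> (\<rho> x *\<^sub>R (coeff_mat x *v g))"

sublocale H: weighted_L2 \<Omega> mass_form
proof (rule weighted_L2.intro)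
  fix x assume "x \<in> space \<Omega>"
  then have r: "\<rho> x > 0" using weight_pos by simp
  show "bounded_bilinear (mass_form x)"
    using bounded_bilinear.comp[OF bounded_bilinear_mult bounded_linear_ident bounded_linear_mult_left[of "\<rho> x"]]
    by (simp add: mass_form_def[abs_def] mult.assoc)
  show "mass_form x u v = mass_form x v u" for u v by (simp add: mass_form_def)
  show "\<exists>c>0. \<forall>h. c * (norm h)\<^sup>2 \<le> mass_form x h h"
    using r by (intro exI[of _ "\<rho> x"]) (auto simp: mass_form_def power2_eq_square)
qed (auto simp: mass_form_def intro!: borel_measurable_times weight_measurable)

sublocale V: weighted_L2 \<Omega> gradient_form
proof (rule weighted_L2.intro)
  fix x assume "x \<in> space \<Omega>"
  then have x: "x \<in> std_triangle" by simp
  have r: "\<rho> x > 0" using weight_pos[OF x] .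
  note pos = triangle_pos[OF x]
  have "bounded_linear (\<lambda>g. \<rho> x *\<^sub>R (coeff_mat x *v g))"
    by (intro bounded_linear_compose[OF bounded_linear_scaleR_right] matrix_vector_mul_bounded_linear)
  from bounded_bilinear.comp[OF bounded_bilinear_inner bounded_linear_ident this]
  show "bounded_bilinear (gradient_form x)" by (simp add: gradient_form_def[abs_def])
  show "gradient_form x h g = gradient_form x g h" for h g
    unfolding gradient_form_def form_decomposition by (simp add: mult.commute)
  let ?k = "1 - x$1 - x$2"
  let ?c = "min (x$1 * ?k) (x$2 * ?k)"
  show "\<exists>c>0. \<forall>h. c * (norm h)\<^sup>2 \<le> gradient_form x h h"
  proof (intro exI[of _ "\<rho> x * ?c"] conjI allI)
    show "\<rho> x * ?c > 0" using r pos by simp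
    fix h :: "real^2"
    have "(norm h)\<^sup>2 = h$1 * h$1 + h$2 * h$2"
      by (simp add: power2_norm_eq_inner inner_vec_def sum_2)
    then have "?c * (norm h)\<^sup>2 = ?c * (h$1 * h$1) + ?c * (h$2 * h$2)" by (simp add: distrib_left)
    also have "\<dots> \<le> x$1 * ?k * (h$1 * h$1) + x$2 * ?k * (h$2 * h$2)"
      by (intro add_mono mult_right_mono) auto
    also have "\<dots> \<le> x$1 * ?k * (h$1 * h$1) + x$2 * ?k * (h$2 * h$2) + x$1 * x$2 * ((h$1 - h$2) * (h$1 - h$2))"
      using pos by simp
    finally show "\<rho> x * ?c * (norm h)\<^sup>2 \<le> gradient_form x h h"
      unfolding gradient_form_def form_decomposition using r by (simp add: mult.assoc)
  qed
next
  fix f f' :: "real^2 \<Rightarrow> real^2"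
  assume f: "f \<in> borel_measurable \<Omega>" "f' \<in> borel_measurable \<Omega>"
  have [measurable]: "(\<lambda>x. x $ i) \<in> borel_measurable \<Omega>" for i
    by (rule polynomial_measurable[OF real_polynomial_coord])
  note [measurable] = weight_measurable borel_measurable_coord[OF f(1)] borel_measurable_coord[OF f(2)]
  show "(\<lambda>x. gradient_form x (f x) (f' x)) \<in> borel_measurable \<Omega>"
    unfolding gradient_form_def form_decomposition by measurable
qed

lemma L2w_eq: "L2w std_triangle \<rho> = H.L2"
  by (simp add: L2w_def H.L2_def mass_form_def power2_eq_square)

lemma L2w_inner_eq: "L2w_inner std_triangle \<rho> = H.inner2"
  by (simp add: fun_eq_iff L2w_inner_def H.inner2_def mass_form_def)

lemma L2w_vec_eq: "L2w_vec std_triangle \<rho> coeff_mat = V.L2"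
  by (simp add: L2w_vec_def V.L2_def gradient_form_def)

lemma bounded_in_L2:
  assumes "u \<in> borel_measurable \<Omega>" "\<And>x. x \<in> std_triangle \<Longrightarrow> \<bar>u x\<bar> \<le> C"
  shows "u \<in> H.L2"
proof -
  have "integrable \<Omega> (\<lambda>x. \<rho> x * (u x * u x))"
  proof (rule integrable_mult_bounded[OF integrable_weight])
    show "\<bar>u x * u x\<bar> \<le> C * C" if "x \<in> space \<Omega>" for x
      using assms(2)[of x] that unfolding abs_mult by (intro mult_mono) (auto intro: order_trans[OF abs_ge_zero])
  qed (use assms in auto)
  then show ?thesis using assms by (simp add: H.L2_def mass_form_def mult_ac)
qed

lemma polynomial_L2: "real_polynomial_function p \<Longrightarrow> p \<in> H.L2"
  using polynomial_bounded_on_triangle[of p] bounded_in_L2 polynomial_measurable by metis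

lemma polynomial_integrable: "real_polynomial_function p \<Longrightarrow> integrable \<Omega> (\<lambda>x. p x * \<rho> x)"
  using H.integrable_form[OF polynomial_L2[of p] polynomial_L2[OF real_polynomial_const[of 1]]] by (simp add: mass_form_def)

lemma poly_field_L2:
  assumes "poly_field v"
  shows "v \<in> V.L2"
proof -
  have p: "real_polynomial_function (\<lambda>x. v x $ i)" for i using assms by (simp add: poly_field_def)
  have v: "v \<in> borel_measurable \<Omega>"
  proof (subst borel_measurable_euclidean_space, intro ballI)
    fix b :: "real^2" assume "b \<in> Basis"
    then obtain i where "b = axis i 1" by (auto simp: Basis_vec_def)
    then show "(\<lambda>x. v x \<bullet> b) \<in> borel_measurable \<Omega>"
      using polynomial_measurable[OF p] by (simp add: inner_axis)
  qed
  have "real_polynomial_function (\<lambda>x. x$1 * (1 - x$1 - x$2) * (v x$1 * v x$1)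
     + x$2 * (1 - x$1 - x$2) * (v x$2 * v x$2) + x$1 * x$2 * ((v x$1 - v x$2) * (v x$1 - v x$2)))"
    by (intro real_polynomial_add real_polynomial_mult real_polynomial_function_diff
        real_polynomial_const real_polynomial_coord p)
  from polynomial_integrable[OF this] v show ?thesis
    unfolding V.L2_def gradient_form_def form_decomposition by (simp add: mult.commute)
qed

subsection \<open>Integration by parts\<close>

text \<open>Let \<open>k = 1 - x\<^sub>1 - x\<^sub>2\<close>.  The functions \<open>\<rho> div1 g\<close>, \<open>\<rho> div2 g\<close> and \<open>\<rho> div12 g\<close> are the
  divergences of \<open>\<rho> g\<close> times the fields \<open>x\<^sub>1 k \<partial>\<^sub>1\<close>, \<open>x\<^sub>2 k \<partial>\<^sub>2\<close> and \<open>x\<^sub>1 x\<^sub>2 (\<partial>\<^sub>1 - \<partial>\<^sub>2)\<close>.  Each of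
  these is parallel to one side of the triangle and vanishes on the other two, so their integrals
  are zero; for a monomial \<open>g\<close> this is a shift relation of the Dirichlet integral.\<close>

definition div1 :: "(real^2 \<Rightarrow> real) \<Rightarrow> real^2 \<Rightarrow> real" where
  "div1 g x = (\<alpha> + 1) * ((1 - x$1 - x$2) * g x) - (\<gamma> + 1) * (x$1 * g x) + (1 - x$1 - x$2) * (x$1 * partial 1 g x)"

definition div2 :: "(real^2 \<Rightarrow> real) \<Rightarrow> real^2 \<Rightarrow> real" where
  "div2 g x = (\<beta> + 1) * ((1 - x$1 - x$2) * g x) - (\<gamma> + 1) * (x$2 * g x) + (1 - x$1 - x$2) * (x$2 * partial 2 g x)"

definition div12 :: "(real^2 \<Rightarrow> real) \<Rightarrow> real^2 \<Rightarrow> real" where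
  "div12 g x = (\<alpha> + 1) * (x$2 * g x) - (\<beta> + 1) * (x$1 * g x) + (x$2 * (x$1 * partial 1 g x) - x$1 * (x$2 * partial 2 g x))"

lemma div_polynomial:
  assumes "real_polynomial_function g"
  shows "real_polynomial_function (div1 g)" "real_polynomial_function (div2 g)" "real_polynomial_function (div12 g)"
  unfolding div1_def[abs_def] div2_def[abs_def] div12_def[abs_def]
  by (intro real_polynomial_add real_polynomial_mult real_polynomial_function_diff
        real_polynomial_const real_polynomial_coord real_polynomial_partial assms)+

lemma integral_zero_from_monomials:
  assumes T: "\<And>g. real_polynomial_function g \<Longrightarrow> real_polynomial_function (T g)"
    and lin: "\<And>c f g x. real_polynomial_function f \<Longrightarrow> real_polynomial_function g \<Longrightarrow>
        T (\<lambda>x. c * f x + g x) x = c * T f x + T g x"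
    and mon: "\<And>i j. (\<integral>x. T (monom2 i j) x * \<rho> x \<partial>\<Omega>) = 0"
    and g: "real_polynomial_function g"
  shows "(\<integral>x. T g x * \<rho> x \<partial>\<Omega>) = 0"
proof -
  have "g \<in> span (range nth_monom)" using g span_nth_monom by blast
  then have "real_polynomial_function g \<and> (\<integral>x. T g x * \<rho> x \<partial>\<Omega>) = 0"
  proof (induction rule: span_induct_alt)
    case base
    have "T (\<lambda>x. 0) x = 0" for x
      using lin[of "\<lambda>x. 0" "\<lambda>x. 0" 1 x] real_polynomial_const by fastforce
    then show ?case by (simp add: zero_fun_def real_polynomial_const)
  next
    case (step c m f)
    then obtain i j where m: "m = monom2 i j" by (auto simp: range_nth_monom)
    have f: "real_polynomial_function f" using step by blast
    have mp: "real_polynomial_function m" using real_polynomial_monom2 m by simp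
    have "T (c *\<^sub>R m + f) x = c * T m x + T f x" for x
      using lin[OF mp f] by (simp add: plus_fun_def scaleR_fun_def)
    then have "(\<integral>x. T (c *\<^sub>R m + f) x * \<rho> x \<partial>\<Omega>) = (\<integral>x. c * (T m x * \<rho> x) + T f x * \<rho> x \<partial>\<Omega>)"
      by (simp add: algebra_simps)
    also have "\<dots> = c * (\<integral>x. T m x * \<rho> x \<partial>\<Omega>) + (\<integral>x. T f x * \<rho> x \<partial>\<Omega>)"
      using polynomial_integrable[OF T[OF mp]] polynomial_integrable[OF T[OF f]] by simp
    also have "\<dots> = 0" using step mon m by simp
    finally show ?case
      using f mp by (simp add: plus_fun_def scaleR_fun_def real_polynomial_add
          real_polynomial_mult real_polynomial_const)
  qed
  then show ?thesis by blast
qed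

lemma monom2_weight:
  assumes "x \<in> std_triangle"
  shows "monom2 i j x * \<rho> x = weight (\<alpha> + i) (\<beta> + j) \<gamma> x"
    "(1 - x$1 - x$2) * weight a b c x = weight a b (c + 1) x"
    "x$1 * weight a b c x = weight (a + 1) b c x" "x$2 * weight a b c x = weight a (b + 1) c x"
  using triangle_pos[OF assms] by (simp_all add: monom2_def weight_def powr_add powr_realpow)

lemma integral_weights:
  assumes "a > -1" "b > -1" "c > -1" "a' > -1" "b' > -1" "c' > -1"
    and "r * Dirichlet a b c = s * Dirichlet a' b' c'"
    and "\<And>x. x \<in> std_triangle \<Longrightarrow> f x = r * weight a b c x - s * weight a' b' c' x"
  shows "(\<integral>x. f x \<partial>\<Omega>) = 0"
proof -
  have "(\<integral>x. f x \<partial>\<Omega>) = (\<integral>x. r * weight a b c x - s * weight a' b' c' x \<partial>\<Omega>)"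
    using assms(8) by (intro Bochner_Integration.integral_cong) auto
  also have "\<dots> = r * Dirichlet a b c - s * Dirichlet a' b' c'"
    using has_bochner_integral_Dirichlet[OF assms(1-3)] has_bochner_integral_Dirichlet[OF assms(4-6)]
    by (simp add: has_bochner_integral_iff)
  finally show ?thesis using assms(7) by simp
qed

lemma div_monom2:
  "div1 (monom2 i j) x = (\<alpha> + i + 1) * ((1 - x$1 - x$2) * monom2 i j x) - (\<gamma> + 1) * (x$1 * monom2 i j x)"
  "div2 (monom2 i j) x = (\<beta> + j + 1) * ((1 - x$1 - x$2) * monom2 i j x) - (\<gamma> + 1) * (x$2 * monom2 i j x)"
  "div12 (monom2 i j) x = (\<alpha> + i + 1) * (x$2 * monom2 i j x) - (\<beta> + j + 1) * (x$1 * monom2 i j x)"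
proof -
  have "x$1 * partial 1 (monom2 i j) x = real i * monom2 i j x" "x$2 * partial 2 (monom2 i j) x = real j * monom2 i j x"
    using coord_monom2(1)[of i x j] coord_monom2(2)[of j x i] by (simp_all add: partial_monom2 mult_ac)
  then show "div1 (monom2 i j) x = (\<alpha> + i + 1) * ((1 - x$1 - x$2) * monom2 i j x) - (\<gamma> + 1) * (x$1 * monom2 i j x)"
    "div2 (monom2 i j) x = (\<beta> + j + 1) * ((1 - x$1 - x$2) * monom2 i j x) - (\<gamma> + 1) * (x$2 * monom2 i j x)"
    "div12 (monom2 i j) x = (\<alpha> + i + 1) * (x$2 * monom2 i j x) - (\<beta> + j + 1) * (x$1 * monom2 i j x)"
    by (simp_all add: div1_def div2_def div12_def algebra_simps)
qed

lemma integral_div: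
  assumes g: "real_polynomial_function g"
  shows "(\<integral>x. div1 g x * \<rho> x \<partial>\<Omega>) = 0" "(\<integral>x. div2 g x * \<rho> x \<partial>\<Omega>) = 0" "(\<integral>x. div12 g x * \<rho> x \<partial>\<Omega>) = 0"
proof -
  have lin: "partial k (\<lambda>x. c * f x + h x) x = c * partial k f x + partial k h x"
    if "real_polynomial_function f" "real_polynomial_function h" for k c x and f h :: "real^2 \<Rightarrow> real"
  proof -
    have d: "f differentiable (at x)" "h differentiable (at x)" using that by (auto intro: poly_differentiable)
    then have "(\<lambda>x. c * f x) differentiable (at x)" by (intro differentiable_mult) auto
    then show ?thesis using d by (simp add: partial_plus partial_scale)
  qed
  have a: "\<alpha> + real i > -1" for i using \<alpha> by linarith
  have b: "\<beta> + real j > -1" for j using \<beta> by linarith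
  have f: "(r * (t * m) - r' * (t' * m)) * w = r * (t * (m * w)) - r' * (t' * (m * w))"
    for r t m r' t' w :: real by (simp add: algebra_simps)
  show "(\<integral>x. div1 g x * \<rho> x \<partial>\<Omega>) = 0"
  proof (rule integral_zero_from_monomials[OF div_polynomial(1) _ _ g])
    show "(\<integral>x. div1 (monom2 i j) x * \<rho> x \<partial>\<Omega>) = 0" for i j
      by (rule integral_weights[OF _ _ _ _ _ _ Dirichlet_shift(1)[of "\<alpha> + i" "\<beta> + j" \<gamma>]])
         (use a[of i] b[of j] a[of "Suc i"] \<gamma> in \<open>simp_all add: div_monom2 f monom2_weight add_ac\<close>)
    show "div1 (\<lambda>x. c * f x + h x) x = c * div1 f x + div1 h x"
      if "real_polynomial_function f" "real_polynomial_function h" for c f h x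
      unfolding div1_def lin[OF that] by (simp add: algebra_simps)
  qed
  show "(\<integral>x. div2 g x * \<rho> x \<partial>\<Omega>) = 0"
  proof (rule integral_zero_from_monomials[OF div_polynomial(2) _ _ g])
    show "(\<integral>x. div2 (monom2 i j) x * \<rho> x \<partial>\<Omega>) = 0" for i j
      by (rule integral_weights[OF _ _ _ _ _ _ Dirichlet_shift(2)[of "\<alpha> + i" "\<beta> + j" \<gamma>]])
         (use a[of i] b[of j] b[of "Suc j"] \<gamma> in \<open>simp_all add: div_monom2 f monom2_weight add_ac\<close>)
    show "div2 (\<lambda>x. c * f x + h x) x = c * div2 f x + div2 h x"
      if "real_polynomial_function f" "real_polynomial_function h" for c f h x
      unfolding div2_def lin[OF that] by (simp add: algebra_simps)
  qed
  show "(\<integral>x. div12 g x * \<rho> x \<partial>\<Omega>) = 0"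
  proof (rule integral_zero_from_monomials[OF div_polynomial(3) _ _ g])
    show "(\<integral>x. div12 (monom2 i j) x * \<rho> x \<partial>\<Omega>) = 0" for i j
      by (rule integral_weights[OF _ _ _ _ _ _ Dirichlet_shift(3)[of "\<alpha> + i" "\<beta> + j" \<gamma>]])
         (use a[of i] b[of j] a[of "Suc i"] b[of "Suc j"] \<gamma> in \<open>simp_all add: div_monom2 f monom2_weight add_ac\<close>)
    show "div12 (\<lambda>x. c * f x + h x) x = c * div12 f x + div12 h x"
      if "real_polynomial_function f" "real_polynomial_function h" for c f h x
      unfolding div12_def lin[OF that] by (simp add: algebra_simps)
  qed
qed

text \<open>This is \<open>(1/\<rho>) div (\<rho> \<Phi> w)\<close> (see \<open>divg_eq_flux_div\<close>), split along the directions of the sides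
  as in \<open>form_decomposition\<close>.  Unlike the quotient it is visibly a polynomial.\<close>

definition flux_div :: "(real^2 \<Rightarrow> real^2) \<Rightarrow> real^2 \<Rightarrow> real" where
  "flux_div w x = div1 (\<lambda>y. w y $ 1) x + div2 (\<lambda>y. w y $ 2) x + div12 (\<lambda>y. w y $ 1 - w y $ 2) x"

lemma flux_div_polynomial:
  assumes "poly_field w"
  shows "real_polynomial_function (flux_div w)"
  unfolding flux_div_def[abs_def] using assms unfolding poly_field_def
  by (intro real_polynomial_add div_polynomial real_polynomial_function_diff) auto

lemma integral_flux_div:
  assumes "poly_field w"
  shows "(\<integral>x. flux_div w x * \<rho> x \<partial>\<Omega>) = 0"
proof -
  have p: "real_polynomial_function (\<lambda>x. w x $ i)" for i using assms by (simp add: poly_field_def)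
  have "(\<integral>x. flux_div w x * \<rho> x \<partial>\<Omega>) = (\<integral>x. div1 (\<lambda>y. w y $ 1) x * \<rho> x + div2 (\<lambda>y. w y $ 2) x * \<rho> x
      + div12 (\<lambda>y. w y $ 1 - w y $ 2) x * \<rho> x \<partial>\<Omega>)"
    by (simp add: flux_div_def distrib_right)
  also have "\<dots> = 0"
    using p by (simp add: integral_div real_polynomial_function_diff polynomial_integrable div_polynomial)
  finally show ?thesis .
qed

lemma divg_eq_flux_div:
  assumes w: "poly_field w" and x: "x \<in> std_triangle"
  shows "divg (\<lambda>y. \<rho> y *\<^sub>R (coeff_mat y *v w y)) x = flux_div w x * \<rho> x"
proof -
  let ?F = "\<lambda>y. \<rho> y *\<^sub>R (coeff_mat y *v w y)"
  have d: "(\<lambda>x. w x $ i) differentiable (at x)" for i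
    using w by (auto simp: poly_field_def intro: poly_differentiable)
  note pos = triangle_pos[OF x]
  have F1: "(\<lambda>y. ?F y $ 1) = (\<lambda>y. \<rho> y * ((y$1 * (1 - y$1)) * w y $ 1 + (- y$1 * y$2) * w y $ 2))"
    and F2: "(\<lambda>y. ?F y $ 2) = (\<lambda>y. \<rho> y * ((- y$1 * y$2) * w y $ 1 + (y$2 * (1 - y$2)) * w y $ 2))"
    by (auto simp: coeff_mat_def matrix_vector_mult_def sum_2)
  have c: "((\<lambda>y::real^2. y$i) has_derivative (\<lambda>h. h$i)) (at x)" for i
    by (rule bounded_linear.has_derivative[OF bounded_linear_vec_nth has_derivative_ident])
  have dd: "((\<lambda>y::real^2. y$i * (1 - y$i)) has_derivative (\<lambda>h. (1 - 2 * x$i) * h$i)) (at x)" for i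
    by (rule has_derivative_eq_rhs[OF has_derivative_mult[OF c has_derivative_diff[OF has_derivative_const c]]])
       (auto simp: algebra_simps)
  have o: "((\<lambda>y::real^2. - y$1 * y$2) has_derivative (\<lambda>h. - x$1 * h$2 - h$1 * x$2)) (at x)"
    by (rule has_derivative_eq_rhs[OF has_derivative_mult[OF has_derivative_minus[OF c] c]])
       (auto simp: algebra_simps)
  define k where "k = 1 - x$1 - x$2"
  have k: "k > 0" using pos by (simp add: k_def)
  let ?w1 = "w x $ 1" and ?w2 = "w x $ 2"
  let ?p = "\<lambda>i j. partial i (\<lambda>y. w y $ j) x"
  \<comment> \<open>The singular factors \<open>1 / x\<^sub>1\<close>, \<open>1 / x\<^sub>2\<close>, \<open>1 / k\<close> from the weight cancel against \<open>\<Phi>\<close>.\<close>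
  have D1: "partial 1 (\<lambda>y. ?F y $ 1) x = \<rho> x * ((\<alpha> / x$1 - \<gamma> / k) *
      (x$1 * (1 - x$1) * ?w1 - x$1 * x$2 * ?w2) + (1 - 2 * x$1) * ?w1
      + x$1 * (1 - x$1) * ?p 1 1 - x$2 * ?w2 - x$1 * x$2 * ?p 1 2)"
    unfolding F1 partial_flux[OF x dd o d d] by (simp add: axis_def k_def)
  have D2: "partial 2 (\<lambda>y. ?F y $ 2) x = \<rho> x * ((\<beta> / x$2 - \<gamma> / k) *
      (x$2 * (1 - x$2) * ?w2 - x$1 * x$2 * ?w1) + (1 - 2 * x$2) * ?w2
      + x$2 * (1 - x$2) * ?p 2 2 - x$1 * ?w1 - x$1 * x$2 * ?p 2 1)"
    unfolding F2 partial_flux[OF x o dd d d] by (simp add: axis_def k_def algebra_simps)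
  have a: "(\<alpha> / x$1) * (x$1 * (1 - x$1) * ?w1 - x$1 * x$2 * ?w2) = \<alpha> * ((1 - x$1) * ?w1 - x$2 * ?w2)"
    and b: "(\<beta> / x$2) * (x$2 * (1 - x$2) * ?w2 - x$1 * x$2 * ?w1) = \<beta> * ((1 - x$2) * ?w2 - x$1 * ?w1)"
    using pos by (simp_all add: field_simps)
  have "(\<gamma> / k) * (x$1 * (1 - x$1) * ?w1 - x$1 * x$2 * ?w2) + (\<gamma> / k) * (x$2 * (1 - x$2) * ?w2 - x$1 * x$2 * ?w1)
     = (\<gamma> / k) * (k * (x$1 * ?w1 + x$2 * ?w2))"
    by (simp add: k_def algebra_simps)
  also have "\<dots> = \<gamma> * (x$1 * ?w1 + x$2 * ?w2)" using k by simp
  finally have g: "(\<gamma> / k) * (x$1 * (1 - x$1) * ?w1 - x$1 * x$2 * ?w2) + (\<gamma> / k) * (x$2 * (1 - x$2) * ?w2 - x$1 * x$2 * ?w1)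
     = \<gamma> * (x$1 * ?w1 + x$2 * ?w2)" .
  have "divg ?F x = \<rho> x * (((\<alpha> / x$1) * (x$1 * (1 - x$1) * ?w1 - x$1 * x$2 * ?w2)
       + (\<beta> / x$2) * (x$2 * (1 - x$2) * ?w2 - x$1 * x$2 * ?w1)
       - ((\<gamma> / k) * (x$1 * (1 - x$1) * ?w1 - x$1 * x$2 * ?w2) + (\<gamma> / k) * (x$2 * (1 - x$2) * ?w2 - x$1 * x$2 * ?w1)))
       + (1 - 2 * x$1) * ?w1 + x$1 * (1 - x$1) * ?p 1 1 - x$2 * ?w2 - x$1 * x$2 * ?p 1 2
       + (1 - 2 * x$2) * ?w2 + x$2 * (1 - x$2) * ?p 2 2 - x$1 * ?w1 - x$1 * x$2 * ?p 2 1)"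
    unfolding divg_def sum_2 D1 D2 by (simp only: distrib_left left_diff_distrib) (simp add: algebra_simps)
  then show ?thesis
    unfolding a b g flux_div_def div1_def div2_def div12_def
    by (simp add: partial_minus[OF d d] algebra_simps)
qed

lemma flux_div_product:
  assumes p: "real_polynomial_function p" and w: "poly_field w"
  shows "flux_div (\<lambda>y. p y *\<^sub>R w y) x * \<rho> x = p x * flux_div w x * \<rho> x + gradient_form x (gradient p x) (w x)"
proof -
  have d: "p differentiable (at x)" "(\<lambda>x. w x $ i) differentiable (at x)" for i
    using p w by (auto simp: poly_field_def intro: poly_differentiable)
  have m: "partial k (\<lambda>y. p y * w y $ i) x = partial k p x * w x $ i + p x * partial k (\<lambda>y. w y $ i) x" for k i
    by (rule partial_times[OF d])
  have dm: "(\<lambda>y. p y * w y $ i) differentiable (at x)" for i by (intro differentiable_mult d)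
  show ?thesis
    unfolding gradient_form_def form_decomposition gradient_def flux_div_def div1_def div2_def div12_def
    by (simp add: partial_minus[OF d(2) d(2)] partial_minus[OF dm dm] m algebra_simps)
qed

lemma poly_field_gradient: "real_polynomial_function p \<Longrightarrow> poly_field (gradient p)"
  by (simp add: poly_field_def gradient_def real_polynomial_partial)

text \<open>The divergence of \<open>\<rho> p \<Phi> w\<close> has integral zero, and the product rule splits it into the two
  sides.\<close>

lemma integration_by_parts:
  assumes p: "real_polynomial_function p" and w: "poly_field w"
  shows "H.inner2 p (flux_div w) = - V.inner2 (gradient p) w"
proof -
  have "poly_field (\<lambda>y. p y *\<^sub>R w y)"
    using p w by (auto simp: poly_field_def intro: real_polynomial_mult)
  from integral_flux_div[OF this]
  have "(\<integral>x. p x * flux_div w x * \<rho> x + gradient_form x (gradient p x) (w x) \<partial>\<Omega>) = 0"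
    by (simp add: flux_div_product[OF p w])
  then show ?thesis
    using H.integrable_form[OF polynomial_L2[OF p] polynomial_L2[OF flux_div_polynomial[OF w]]]
      V.integrable_form[OF poly_field_L2[OF poly_field_gradient[OF p]] poly_field_L2[OF w]]
    by (simp add: H.inner2_def V.inner2_def mass_form_def)
qed

section \<open>Totality of the polynomials\<close>

lemma AE_zero_if_orthogonal_L2:
  assumes u: "u \<in> H.L2" and orth: "\<And>p. real_polynomial_function p \<Longrightarrow> H.inner2 u p = 0"
  shows "AE x in \<Omega>. u x = 0"
proof -
  have one: "(\<lambda>x. 1) \<in> H.L2" by (intro polynomial_L2 real_polynomial_const)
  have int: "integrable \<Omega> (\<lambda>x. u x * \<rho> x)"
    using H.integrable_form[OF u one] by (simp add: mass_form_def)
  have "(\<integral>x. u x * \<rho> x * p x \<partial>\<Omega>) = 0" if "real_polynomial_function p" for p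
    using orth[OF that] by (simp add: H.inner2_def mass_form_def mult_ac)
  from AE_zero_if_orthogonal_to_polynomials[OF bounded_triangle triangle_lebesgue int this]
  have "AE x in \<Omega>. u x * \<rho> x = 0" .
  then show ?thesis
    using AE_space
  proof eventually_elim
    case (elim x)
    then show ?case using weight_pos[of x \<alpha> \<beta> \<gamma>] by simp
  qed
qed

text \<open>Testing with \<open>p\<close> times a unit vector shows that the components of \<open>\<rho> \<Phi> h\<close> vanish, and
  \<open>\<rho> \<Phi>\<close> is positive definite on the open triangle.\<close>

lemma AE_zero_if_orthogonal_fields:
  assumes h: "h \<in> V.L2" and orth: "\<And>v. poly_field v \<Longrightarrow> V.inner2 h v = 0"
  shows "AE x in \<Omega>. h x = 0"
proof -
  let ?F = "\<lambda>i x. (\<rho> x *\<^sub>R (coeff_mat x *v h x)) $ i"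
  have field: "poly_field (\<lambda>x. axis i (p x))" if p: "real_polynomial_function p" for i p
    unfolding poly_field_def
  proof
    fix j
    show "real_polynomial_function (\<lambda>x. axis i (p x) $ j)"
      using p by (cases "j = i") (auto simp: axis_def real_polynomial_const)
  qed
  have comp: "gradient_form x (h x) (axis i c) = ?F i x * c" if "x \<in> std_triangle" for x i c
    using V.symmetric[of x "h x" "axis i c"] that by (simp add: gradient_form_def inner_axis' mult.commute)
  have zero: "AE x in \<Omega>. ?F i x = 0" for i
  proof (rule AE_zero_if_orthogonal_to_polynomials[OF bounded_triangle triangle_lebesgue])
    have "integrable \<Omega> (\<lambda>x. gradient_form x (h x) (axis i 1))"
      using V.integrable_form[OF h poly_field_L2[OF field[OF real_polynomial_const[of 1]]]] .
    moreover have "integrable \<Omega> (\<lambda>x. gradient_form x (h x) (axis i 1)) \<longleftrightarrow> integrable \<Omega> (?F i)"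
      by (intro Bochner_Integration.integrable_cong) (auto simp: comp)
    ultimately show "integrable \<Omega> (?F i)" by simp
    fix p :: "real^2 \<Rightarrow> real" assume p: "real_polynomial_function p"
    have "(\<integral>x. ?F i x * p x \<partial>\<Omega>) = V.inner2 h (\<lambda>x. axis i (p x))"
      unfolding V.inner2_def by (intro Bochner_Integration.integral_cong) (auto simp: comp)
    then show "(\<integral>x. ?F i x * p x \<partial>\<Omega>) = 0" using orth[OF field[OF p]] by simp
  qed
  show ?thesis
    using zero[of 1] zero[of 2] AE_space
  proof eventually_elim
    case (elim x)
    then have "\<rho> x *\<^sub>R (coeff_mat x *v h x) = 0" by (simp only: vec_eq_iff forall_2 zero_index)
    then have "gradient_form x (h x) (h x) = 0" by (simp only: gradient_form_def inner_zero_right)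
    then show ?case using V.form_zero_iff elim by simp
  qed
qed

section \<open>The weak gradient\<close>

lemma is_weak_gradient_iff:
  "is_weak_gradient std_triangle \<rho> coeff_mat u h \<longleftrightarrow>
     h \<in> V.L2 \<and> (\<forall>v. poly_field v \<longrightarrow> H.inner2 u (flux_div v) = - V.inner2 h v)"
proof -
  have "(\<integral>x. u x * divg (\<lambda>y. \<rho> y *\<^sub>R (coeff_mat y *v v y)) x \<partial>\<Omega>) = H.inner2 u (flux_div v)"
    if "poly_field v" for v
    unfolding H.inner2_def mass_form_def
    by (intro Bochner_Integration.integral_cong) (auto simp: divg_eq_flux_div[OF that])
  then show ?thesis
    unfolding is_weak_gradient_def L2w_vec_eq V.inner2_def gradient_form_def poly_field_def by simp
qed

abbreviation weak_grad :: "(real^2 \<Rightarrow> real) \<Rightarrow> (real^2 \<Rightarrow> real^2) \<Rightarrow> bool" where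
  "weak_grad \<equiv> is_weak_gradient std_triangle \<rho> coeff_mat"

abbreviation W :: "(real^2 \<Rightarrow> real) set" where
  "W \<equiv> W12 std_triangle \<rho> coeff_mat"

abbreviation wgrad :: "(real^2 \<Rightarrow> real) \<Rightarrow> real^2 \<Rightarrow> real^2" where
  "wgrad \<equiv> weak_gradient std_triangle \<rho> coeff_mat"

definition energy :: "(real^2 \<Rightarrow> real) \<Rightarrow> (real^2 \<Rightarrow> real) \<Rightarrow> real" where
  "energy u v = V.inner2 (wgrad u) (wgrad v)"

lemma W_iff: "u \<in> W \<longleftrightarrow> u \<in> H.L2 \<and> (\<exists>h. weak_grad u h)"
  by (simp add: W12_def L2w_eq)

lemma wgrad: "u \<in> W \<Longrightarrow> weak_grad u (wgrad u)"
  unfolding weak_gradient_def using someI_ex[of "weak_grad u"] W_iff by blast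

lemma weak_grad_L2: "weak_grad u h \<Longrightarrow> h \<in> V.L2"
  by (simp add: is_weak_gradient_iff)

text \<open>A weak gradient is unique up to null fields, so the energy does not depend on the representative
  that \<^const>\<open>weak_gradient\<close> picks.\<close>

lemma weak_grad_inner:
  assumes "weak_grad u h" "weak_grad u h'" and g: "g \<in> V.L2"
  shows "V.inner2 h g = V.inner2 h' g"
proof -
  have L: "h \<in> V.L2" "h' \<in> V.L2" using assms weak_grad_L2 by blast+
  then have d: "h - h' \<in> V.L2" by blast
  have "V.inner2 (h - h') v = 0" if "poly_field v" for v
    using assms that L poly_field_L2[OF that] by (simp add: is_weak_gradient_iff V.diff_left)
  then have "AE x in \<Omega>. (h - h') x = 0" by (intro AE_zero_if_orthogonal_fields d)
  then have "V.inner2 (h - h') (h - h') = 0" using V.null_iff_AE[OF d] by simp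
  from V.null_orthogonal[OF d g this] show ?thesis using L g by (simp add: V.diff_left)
qed

lemma energy_eq:
  assumes "u \<in> W" "v \<in> W" "weak_grad u h" "weak_grad v g"
  shows "energy u v = V.inner2 h g"
proof -
  have L: "h \<in> V.L2" "g \<in> V.L2" "wgrad u \<in> V.L2" "wgrad v \<in> V.L2"
    using assms weak_grad_L2 wgrad by blast+
  have "energy u v = V.inner2 h (wgrad v)"
    unfolding energy_def using weak_grad_inner[OF wgrad assms(3)] assms(1) L by blast
  also have "\<dots> = V.inner2 g h"
    using weak_grad_inner[OF wgrad[OF assms(2)] assms(4) L(1)] V.sym L by metis
  finally show ?thesis using V.sym L by metis
qed

lemma weak_grad_combination:
  assumes u: "u \<in> H.L2" and v: "v \<in> H.L2" and "weak_grad u h" "weak_grad v g"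
  shows "weak_grad (c *\<^sub>R u + v) (c *\<^sub>R h + g)"
proof -
  have L: "h \<in> V.L2" "g \<in> V.L2" using assms weak_grad_L2 by blast+
  have "H.inner2 (c *\<^sub>R u + v) (flux_div w) = - V.inner2 (c *\<^sub>R h + g) w" if w: "poly_field w" for w
    using assms that L poly_field_L2[OF w] polynomial_L2[OF flux_div_polynomial[OF w]]
    by (simp add: is_weak_gradient_iff V.add_left H.add_left V.scale_left H.scale_left)
  then show ?thesis using L by (simp add: is_weak_gradient_iff)
qed

lemma weak_grad_zero: "weak_grad 0 0"
proof -
  have "H.inner2 0 (flux_div w) = - V.inner2 0 w" if "poly_field w" for w
    using that by (simp add: H.zero_left V.zero_left polynomial_L2 flux_div_polynomial poly_field_L2)
  then show ?thesis by (simp add: is_weak_gradient_iff)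
qed

lemma weak_grad_polynomial: "real_polynomial_function p \<Longrightarrow> weak_grad p (gradient p)"
  by (simp add: is_weak_gradient_iff poly_field_L2 poly_field_gradient integration_by_parts)

lemma polynomial_W: "real_polynomial_function p \<Longrightarrow> p \<in> W"
  using weak_grad_polynomial polynomial_L2 by (auto simp: W_iff)

lemma W_combination: "u \<in> W \<Longrightarrow> v \<in> W \<Longrightarrow> c *\<^sub>R u + v \<in> W"
  using weak_grad_combination[of u v _ _ c] by (auto simp: W_iff)

sublocale E: semi_inner_on W energy
proof
  show "subspace W"
  proof (rule subspaceI)
    show "0 \<in> W" using weak_grad_zero by (auto simp: W_iff)
    then show "c *\<^sub>R u \<in> W" if "u \<in> W" for c u using W_combination[OF that, of 0 c] by simp
    show "u + v \<in> W" if "u \<in> W" "v \<in> W" for u v using W_combination[OF that, of 1] by simp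
  qed
  then have sub: "u + v \<in> W" "c *\<^sub>R u \<in> W" "0 \<in> W" if "u \<in> W" "v \<in> W" for u v c
    using that by (auto intro: subspace_add subspace_scale subspace_0)
  have H: "u \<in> H.L2" if "u \<in> W" for u using that by (simp add: W_iff)
  have V: "wgrad u \<in> V.L2" if "u \<in> W" for u using wgrad[OF that] weak_grad_L2 by blast
  show "energy (u + v) w = energy u w + energy v w" if "u \<in> W" "v \<in> W" "w \<in> W" for u v w
  proof -
    have "weak_grad (u + v) (wgrad u + wgrad v)"
      using weak_grad_combination[of u v "wgrad u" "wgrad v" 1] that wgrad H by simp
    from energy_eq[OF sub(1)[OF that(1,2)] that(3) this wgrad[OF that(3)]]
    show ?thesis using that V by (simp add: V.add_left energy_def)
  qed
  show "energy (c *\<^sub>R u) w = c * energy u w" if "u \<in> W" "w \<in> W" for u w c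
  proof -
    have "weak_grad (c *\<^sub>R u) (c *\<^sub>R wgrad u)"
      using weak_grad_combination[of u 0 "wgrad u" 0 c] that wgrad H weak_grad_zero by simp
    from energy_eq[OF sub(2)[OF that(1,2)] that(2) this wgrad[OF that(2)]]
    show ?thesis using that V by (simp add: V.scale_left energy_def)
  qed
  show "energy u v = energy v u" if "u \<in> W" "v \<in> W" for u v
    unfolding energy_def using that V by (intro V.sym) auto
  show "0 \<le> energy u u" if "u \<in> W" for u
    unfolding energy_def using that V by (intro V.nonneg) auto
qed

section \<open>Orthogonal polynomials on the triangle\<close>

text \<open>The operator without its potential, \<open>- (1/\<rho>) div (\<rho> \<Phi> \<nabla>p)\<close>, on polynomials.\<close>

definition L0 :: "(real^2 \<Rightarrow> real) \<Rightarrow> real^2 \<Rightarrow> real" where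
  "L0 p x = - flux_div (gradient p) x"

definition monom_eigenvalue :: "nat \<Rightarrow> real" where
  "monom_eigenvalue k = real (monom_degree k) * (real (monom_degree k) + \<alpha> + \<beta> + \<gamma> + 2)"

lemma L0_polynomial: "real_polynomial_function p \<Longrightarrow> real_polynomial_function (L0 p)"
  unfolding L0_def[abs_def]
  by (intro real_polynomial_function_minus flux_div_polynomial poly_field_gradient)

lemma gradient_combination:
  assumes "real_polynomial_function p" "real_polynomial_function q"
  shows "gradient (c *\<^sub>R p + q) = c *\<^sub>R gradient p + gradient q"
proof -
  have d: "p differentiable (at x)" "q differentiable (at x)" for x using assms by (auto intro: poly_differentiable)
  then have "(\<lambda>x. c * p x) differentiable (at x)" for x by (intro differentiable_mult) auto
  then show ?thesis
    using d by (simp add: fun_eq_iff vec_eq_iff gradient_def plus_fun_def scaleR_fun_def partial_plus partial_scale)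
qed

lemma flux_div_combination:
  assumes "poly_field v" "poly_field w"
  shows "flux_div (c *\<^sub>R v + w) = c *\<^sub>R flux_div v + flux_div w"
proof
  fix x
  have d: "(\<lambda>y. v y $ i) differentiable (at x)" "(\<lambda>y. w y $ i) differentiable (at x)" for i
    using assms by (auto simp: poly_field_def intro: poly_differentiable)
  have dc: "(\<lambda>y. c * v y $ i) differentiable (at x)" for i using d by (intro differentiable_mult) auto
  have ds: "(\<lambda>y. c * v y $ i + w y $ i) differentiable (at x)" for i
    using d dc by (intro differentiable_add)
  have l: "partial k (\<lambda>y. c * v y $ i + w y $ i) x = c * partial k (\<lambda>y. v y $ i) x + partial k (\<lambda>y. w y $ i) x" for k i
    by (simp add: partial_plus[OF dc d(2)] partial_scale[OF d(1)])
  have "(c *\<^sub>R v + w) y $ i = c * v y $ i + w y $ i" for y i by simp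
  then show "flux_div (c *\<^sub>R v + w) x = (c *\<^sub>R flux_div v + flux_div w) x"
    by (simp only: flux_div_def div1_def div2_def div12_def partial_minus[OF ds ds] partial_minus[OF d(1) d(1)]
        partial_minus[OF d(2) d(2)] l plus_fun_apply scaleR_fun_apply real_scaleR_def) (simp add: algebra_simps)
qed

lemma L0_combination:
  assumes "real_polynomial_function p" "real_polynomial_function q"
  shows "L0 (c *\<^sub>R p + q) = c *\<^sub>R L0 p + L0 q"
  using assms
  by (simp add: fun_eq_iff L0_def gradient_combination flux_div_combination poly_field_gradient)

lemma L0_inner:
  assumes p: "real_polynomial_function p" and q: "real_polynomial_function q"
  shows "H.inner2 p (L0 q) = V.inner2 (gradient p) (gradient q)"
proof -
  have "L0 q = (-1) *\<^sub>R flux_div (gradient q)" by (simp add: fun_eq_iff L0_def)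
  then show ?thesis
    using integration_by_parts[OF p poly_field_gradient[OF q]] polynomial_L2[OF p]
      polynomial_L2[OF flux_div_polynomial[OF poly_field_gradient[OF q]]]
    by (simp only: H.scale_right)
qed

text \<open>Each second derivative in \<open>L0\<close> carries a factor of the form \<open>x\<^sub>i\<close> or \<open>x\<^sub>i x\<^sub>j\<close>, and multiplying
  a derivative of a monomial by its variable gives a multiple of the monomial, so only terms of
  degree \<open>i + j\<close> and \<open>i + j - 1\<close> remain.\<close>

lemma L0_monom2:
  "L0 (monom2 i j) = (real (i + j) * (real (i + j) + \<alpha> + \<beta> + \<gamma> + 2)) *\<^sub>R monom2 i j
     + ((- real i * (real i + \<alpha>)) *\<^sub>R monom2 (i - 1) j + (- real j * (real j + \<beta>)) *\<^sub>R monom2 i (j - 1))"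
proof
  fix x :: "real^2"
  let ?m = "monom2 i j x" and ?a = "real i * monom2 (i - 1) j x" and ?b = "real j * monom2 i (j - 1) x"
  have d: "monom2 k l differentiable (at x)" for k l
    by (intro poly_differentiable real_polynomial_monom2)
  have g: "gradient (monom2 i j) y $ 1 = real i * monom2 (i - 1) j y"
    "gradient (monom2 i j) y $ 2 = real j * monom2 i (j - 1) y" for y
    by (simp_all add: gradient_def partial_monom2)
  have dg: "(\<lambda>y. real i * monom2 (i - 1) j y) differentiable (at x)"
    "(\<lambda>y. real j * monom2 i (j - 1) y) differentiable (at x)"
    using d by (auto intro!: differentiable_mult)
  have xa: "x$1 * ?a = real i * ?m" and xb: "x$2 * ?b = real j * ?m"
    using coord_monom2(1)[of i x j] coord_monom2(2)[of j x i] by (simp_all add: mult_ac)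
  have ps: "partial k (\<lambda>y. real i * monom2 (i - 1) j y) x = real i * partial k (monom2 (i - 1) j) x"
    "partial k (\<lambda>y. real j * monom2 i (j - 1) y) x = real j * partial k (monom2 i (j - 1)) x" for k
    by (intro partial_scale d)+
  have xd: "x$1 * partial 1 (monom2 k l) x = real k * monom2 k l x"
    "x$2 * partial 2 (monom2 k l) x = real l * monom2 k l x" for k l
    using coord_monom2(1)[of k x l] coord_monom2(2)[of l x k] by (simp_all add: partial_monom2 mult_ac)
  have p11: "x$1 * partial 1 (\<lambda>y. real i * monom2 (i - 1) j y) x = (real i - 1) * ?a"
    unfolding ps mult.left_commute[of "x$1"] xd by (cases i) simp_all
  have p22: "x$2 * partial 2 (\<lambda>y. real j * monom2 i (j - 1) y) x = (real j - 1) * ?b"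
    unfolding ps mult.left_commute[of "x$2"] xd by (cases j) simp_all
  have p21: "x$2 * partial 2 (\<lambda>y. real i * monom2 (i - 1) j y) x = real j * ?a"
    unfolding ps mult.left_commute[of "x$2"] xd by simp
  have p12: "x$1 * partial 1 (\<lambda>y. real j * monom2 i (j - 1) y) x = real i * ?b"
    unfolding ps mult.left_commute[of "x$1"] xd by simp
  have "L0 (monom2 i j) x = -(
      (\<alpha> + 1) * ((1 - x$1 - x$2) * ?a) - (\<gamma> + 1) * (x$1 * ?a) + (1 - x$1 - x$2) * ((real i - 1) * ?a)
    + ((\<beta> + 1) * ((1 - x$1 - x$2) * ?b) - (\<gamma> + 1) * (x$2 * ?b) + (1 - x$1 - x$2) * ((real j - 1) * ?b))
    + ((\<alpha> + 1) * (x$2 * (?a - ?b)) - (\<beta> + 1) * (x$1 * (?a - ?b))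
       + (x$2 * ((real i - 1) * ?a - real i * ?b) - x$1 * (real j * ?a - (real j - 1) * ?b))))"
    unfolding L0_def flux_div_def div1_def div2_def div12_def g partial_minus[OF dg] right_diff_distrib[of "x$1" "partial 1 _ x"]
      right_diff_distrib[of "x$2" "partial 2 _ x"] p11 p22 p12 p21 ..
  also have "\<dots> = - ((\<alpha> + real i) * ?a + (\<beta> + real j) * ?b
      - (\<alpha> + \<beta> + \<gamma> + 2 + real i + real j) * (x$1 * ?a) - (\<alpha> + \<beta> + \<gamma> + 2 + real i + real j) * (x$2 * ?b))"
    by (simp add: algebra_simps)
  also have "\<dots> = (real (i + j) * (real (i + j) + \<alpha> + \<beta> + \<gamma> + 2)) * ?m - (\<alpha> + real i) * ?a - (\<beta> + real j) * ?b"
    unfolding xa xb by (simp add: algebra_simps)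
  finally show "L0 (monom2 i j) x = ((real (i + j) * (real (i + j) + \<alpha> + \<beta> + \<gamma> + 2)) *\<^sub>R monom2 i j
     + ((- real i * (real i + \<alpha>)) *\<^sub>R monom2 (i - 1) j + (- real j * (real j + \<beta>)) *\<^sub>R monom2 i (j - 1))) x"
    by (simp add: algebra_simps)
qed

lemma L0_triangular: "L0 (nth_monom n) - monom_eigenvalue n *\<^sub>R nth_monom n \<in> span (nth_monom ` {..<n})"
proof -
  obtain i j where ij: "prod_decode n = (i, j)" by fastforce
  then have n: "n = prod_encode (i, j)" by (metis prod_decode_inverse)
  have low: "(c * real i) *\<^sub>R monom2 (i - 1) j \<in> span (nth_monom ` {..<n})" for c
  proof (cases "i = 0")
    case False
    then have "monom2 (i - 1) j \<in> nth_monom ` {..<n}"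
      using prod_encode_less(1)[of i j] nth_monom_encode n by (metis gr0I imageI lessThan_iff)
    then show ?thesis by (intro span_scale span_base)
  qed (simp add: span_zero)
  have low': "(c * real j) *\<^sub>R monom2 i (j - 1) \<in> span (nth_monom ` {..<n})" for c
  proof (cases "j = 0")
    case False
    then have "monom2 i (j - 1) \<in> nth_monom ` {..<n}"
      using prod_encode_less(2)[of j i] nth_monom_encode n by (metis gr0I imageI lessThan_iff)
    then show ?thesis by (intro span_scale span_base)
  qed (simp add: span_zero)
  have "L0 (nth_monom n) - monom_eigenvalue n *\<^sub>R nth_monom n
     = ((-(real i + \<alpha>)) * real i) *\<^sub>R monom2 (i - 1) j + ((-(real j + \<beta>)) * real j) *\<^sub>R monom2 i (j - 1)"
    by (simp add: nth_monom_def ij L0_monom2 monom_eigenvalue_def monom_degree_def fun_eq_iff algebra_simps)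
  then show ?thesis using low low' by (metis span_add)
qed

text \<open>Where a continuous function is nonzero it is nonzero on an open set, which is not negligible.\<close>

lemma polynomial_null:
  assumes p: "real_polynomial_function p" and 0: "H.inner2 p p = 0" and x: "x \<in> std_triangle"
  shows "p x = 0"
proof (rule ccontr)
  assume "p x \<noteq> 0"
  have "continuous_on UNIV p"
    using continuous_real_polymonial_function[OF p] by (intro continuous_at_imp_continuous_on) blast
  then have "open {x. p x \<noteq> 0}" by (intro open_Collect_neq) auto
  then have "open (std_triangle \<inter> {x. p x \<noteq> 0})" using open_triangle by (rule open_Int[rotated])
  moreover have "std_triangle \<inter> {x. p x \<noteq> 0} \<noteq> {}" using x \<open>p x \<noteq> 0\<close> by auto
  ultimately have nn: "\<not> negligible (std_triangle \<inter> {x. p x \<noteq> 0})" by (rule open_not_negligible)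
  have "AE x in \<Omega>. p x = 0" using H.null_iff_AE[OF polynomial_L2[OF p]] 0 by simp
  then have "AE x in lebesgue. x \<in> std_triangle \<longrightarrow> p x = 0"
    using triangle_lebesgue by (subst (asm) AE_restrict_space_iff) auto
  then obtain N where N: "N \<in> null_sets lebesgue" "{x. \<not> (x \<in> std_triangle \<longrightarrow> p x = 0)} \<subseteq> N"
    unfolding eventually_ae_filter by auto
  have "negligible N" using N(1) by (simp add: negligible_iff_null_sets)
  moreover have "std_triangle \<inter> {x. p x \<noteq> 0} \<subseteq> N" using N(2) by blast
  ultimately have "negligible (std_triangle \<inter> {x. p x \<noteq> 0})" by (rule negligible_subset)
  with nn show False by blast
qed

text \<open>Orthonormalising the monomials in their order by degree diagonalises \<open>L0\<close>, which is triangular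
  with respect to them.\<close>

theorem eigenpolynomials:
  obtains \<phi> where "H.orthonormal \<phi> UNIV" "\<And>n. real_polynomial_function (\<phi> n)"
    "\<And>p. real_polynomial_function p \<Longrightarrow> p \<in> span (range \<phi>)"
    "\<And>n u. u \<in> H.L2 \<Longrightarrow> H.inner2 u (L0 (\<phi> n)) = monom_eigenvalue n * H.inner2 u (\<phi> n)"
proof -
  have poly: "real_polynomial_function (nth_monom n)" for n
    using span_nth_monom by (metis mem_Collect_eq rangeI span_base)
  have polyspan: "real_polynomial_function v" if "v \<in> span (nth_monom ` I)" for v I
    using that span_nth_monom span_mono[of "nth_monom ` I" "range nth_monom"] by auto
  have ind: "H.inner2 (nth_monom n - v) (nth_monom n - v) \<noteq> 0" if v: "v \<in> span (nth_monom ` {..<n})" for n v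
  proof
    assume 0: "H.inner2 (nth_monom n - v) (nth_monom n - v) = 0"
    have "real_polynomial_function (nth_monom n - v)"
      unfolding fun_diff_def by (intro real_polynomial_function_diff poly polyspan[OF v])
    from polynomial_null[OF this 0] nth_monom_independent[OF v] show False by auto
  qed
  obtain \<phi> where \<phi>: "H.orthonormal \<phi> UNIV" "\<And>n. \<phi> n \<in> span (nth_monom ` {..n})"
    "\<And>n. span (\<phi> ` {..<n}) = span (nth_monom ` {..<n})"
    using H.Gram_Schmidt[of nth_monom] polynomial_L2[OF poly] ind by blast
  have \<phi>p: "real_polynomial_function (\<phi> n)" for n using polyspan[OF \<phi>(2)] .
  have "nth_monom n \<in> span (range \<phi>)" for n
  proof -
    have "nth_monom n \<in> span (\<phi> ` {..<Suc n})" unfolding \<phi>(3) by (intro span_base) auto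
    then show ?thesis using span_mono[of "\<phi> ` {..<Suc n}" "range \<phi>"] by auto
  qed
  then have "span (range nth_monom) \<subseteq> span (range \<phi>)" by (intro span_minimal subspace_span) auto
  then have tot: "p \<in> span (range \<phi>)" if "real_polynomial_function p" for p
    using that span_nth_monom by auto
  have eig: "H.inner2 u (L0 (\<phi> n)) = monom_eigenvalue n * H.inner2 u (\<phi> n)" if u: "u \<in> H.L2" for n u
  proof -
    have zero: "L0 (0::real^2 \<Rightarrow> real) = 0"
      using L0_combination[OF poly[of 0] poly[of 0], of 0] L0_combination[OF poly[of 0] poly[of 0], of "-1"] by simp
    let ?d = "L0 (\<phi> n) - monom_eigenvalue n *\<^sub>R \<phi> n"
    have "H.inner2 ?d ?d = 0"
    proof (rule H.triangular_eigenvector[OF \<phi> polynomial_L2[OF poly] _ _ _ L0_triangular])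
      fix u v :: "real^2 \<Rightarrow> real" assume "u \<in> span (range nth_monom)" "v \<in> span (range nth_monom)"
      then have uv: "real_polynomial_function u" "real_polynomial_function v" using span_nth_monom by auto
      show "L0 (u + v) = L0 u + L0 v" using L0_combination[OF uv, of 1] by simp
      have "H.inner2 (L0 u) v = V.inner2 (gradient v) (gradient u)"
        using L0_inner[OF uv(2,1)] H.sym polynomial_L2 L0_polynomial uv by metis
      also have "\<dots> = H.inner2 u (L0 v)"
        using L0_inner[OF uv] V.sym poly_field_L2 poly_field_gradient uv by metis
      finally show "H.inner2 (L0 u) v = H.inner2 u (L0 v)" .
    next
      fix c and u :: "real^2 \<Rightarrow> real" assume "u \<in> span (range nth_monom)"
      then have u: "real_polynomial_function u" using span_nth_monom by auto
      have z: "real_polynomial_function (0::real^2 \<Rightarrow> real)" by (simp add: zero_fun_def real_polynomial_const)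
      show "L0 (c *\<^sub>R u) = c *\<^sub>R L0 u" using L0_combination[OF u z, of c] zero by simp
    qed
    note d0 = this
    have \<phi>L: "\<phi> n \<in> H.L2" "L0 (\<phi> n) \<in> H.L2" using \<phi>p by (auto intro: polynomial_L2 L0_polynomial)
    have "H.inner2 ?d u = 0" by (rule H.null_orthogonal[OF _ u d0]) (intro H.closed(3,4) \<phi>L)
    then have "H.inner2 (L0 (\<phi> n)) u = monom_eigenvalue n * H.inner2 (\<phi> n) u"
      using \<phi>L u by (simp add: H.diff_left H.scale_left)
    then show ?thesis using H.sym \<phi>L u by metis
  qed
  show thesis using that[OF \<phi>(1) \<phi>p tot eig] .
qed

lemma monom_eigenvalue_nonneg: "0 \<le> monom_eigenvalue k"
proof (cases "monom_degree k = 0")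
  case False
  then have "real (monom_degree k) \<ge> 1" by linarith
  then show ?thesis using \<alpha> \<beta> \<gamma> by (simp add: monom_eigenvalue_def)
qed (simp add: monom_eigenvalue_def)

lemma monom_eigenvalue_at_top: "filterlim monom_eigenvalue at_top sequentially"
  unfolding filterlim_at_top
proof
  fix C :: real
  obtain n :: nat where n: "max 1 C + 1 \<le> real n" using real_arch_simple by blast
  have "\<forall>\<^sub>F k in sequentially. n \<le> monom_degree k"
    using finite_monom_degree[of n] by (simp add: cofinite_eq_sequentially[symmetric] eventually_cofinite not_le)
  then show "\<forall>\<^sub>F k in sequentially. C \<le> monom_eigenvalue k"
  proof eventually_elim
    case (elim k)
    then have d: "max 1 C + 1 \<le> real (monom_degree k)" using n by linarith
    have "C * 1 \<le> real (monom_degree k) * (real (monom_degree k) + \<alpha> + \<beta> + \<gamma> + 2)"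
      using d \<alpha> \<beta> \<gamma> by (intro mult_mono) auto
    then show ?case by (simp add: monom_eigenvalue_def)
  qed
qed

section \<open>The Helmholtz form as a perturbed diagonal form\<close>

definition potential_form :: "(real^2 \<Rightarrow> real) \<Rightarrow> (real^2 \<Rightarrow> real) \<Rightarrow> real" where
  "potential_form u v = (\<integral>x. potential x * u x * v x * \<rho> x \<partial>\<Omega>)"

lemma potential_bounds: "x \<in> std_triangle \<Longrightarrow> 2 \<le> potential x \<and> potential x \<le> 4"
  using triangle_pos[of x] power_le_one[of "x$1" 2] power_le_one[of "x$2" 2] by (simp add: potential_def)

lemma integrable_potential_form:
  assumes "u \<in> H.L2" "v \<in> H.L2"
  shows "integrable \<Omega> (\<lambda>x. potential x * u x * v x * \<rho> x)"
proof -
  have "real_polynomial_function potential"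
    unfolding potential_def[abs_def]
    by (intro real_polynomial_add real_polynomial_const real_polynomial_function_power real_polynomial_coord)
  then have "integrable \<Omega> (\<lambda>x. mass_form x (u x) (v x) * potential x)"
    using H.integrable_form[OF assms] potential_bounds
    by (intro integrable_mult_bounded[of _ _ _ 4] polynomial_measurable) fastforce+
  then show ?thesis by (simp add: mass_form_def mult_ac)
qed

lemma potential_form_bounds:
  assumes u: "u \<in> H.L2"
  shows "2 * H.inner2 u u \<le> potential_form u u" "potential_form u u \<le> 4 * H.inner2 u u"
proof -
  have i: "integrable \<Omega> (\<lambda>x. c * mass_form x (u x) (u x))" for c
    using H.integrable_form[OF u u] by simp
  have m: "0 \<le> u x * u x * \<rho> x" if "x \<in> std_triangle" for x
    using weight_pos[OF that, of \<alpha> \<beta> \<gamma>] by simp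
  have "c * mass_form x (u x) (u x) \<le> potential x * u x * u x * \<rho> x"
    if "x \<in> std_triangle" "c \<le> potential x" for x c
    using mult_right_mono[OF that(2) m[OF that(1)]] by (simp add: mass_form_def mult.assoc)
  then have "(\<integral>x. 2 * mass_form x (u x) (u x) \<partial>\<Omega>) \<le> potential_form u u"
    unfolding potential_form_def using potential_bounds by (intro integral_mono i integrable_potential_form u) auto
  then show "2 * H.inner2 u u \<le> potential_form u u" by (simp add: H.inner2_def)
  have "potential x * u x * u x * \<rho> x \<le> c * mass_form x (u x) (u x)"
    if "x \<in> std_triangle" "potential x \<le> c" for x c
    using mult_right_mono[OF that(2) m[OF that(1)]] by (simp add: mass_form_def mult.assoc)
  then have "potential_form u u \<le> (\<integral>x. 4 * mass_form x (u x) (u x) \<partial>\<Omega>)"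
    unfolding potential_form_def using potential_bounds by (intro integral_mono i integrable_potential_form u) auto
  then show "potential_form u u \<le> 4 * H.inner2 u u" by (simp add: H.inner2_def)
qed

sublocale Q: semi_inner_on H.L2 potential_form
proof
  show "subspace H.L2" by (rule H.subspace)
  show "potential_form (u + v) w = potential_form u w + potential_form v w" if "u \<in> H.L2" "v \<in> H.L2" "w \<in> H.L2" for u v w
    using integrable_potential_form[OF that(1,3)] integrable_potential_form[OF that(2,3)]
    by (simp add: potential_form_def distrib_left distrib_right)
  show "potential_form (c *\<^sub>R u) w = c * potential_form u w" for c u w
  proof -
    have "potential_form (c *\<^sub>R u) w = (\<integral>x. c * (potential x * u x * w x * \<rho> x) \<partial>\<Omega>)"
      unfolding potential_form_def by (intro Bochner_Integration.integral_cong) auto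
    then show ?thesis by (simp add: potential_form_def)
  qed
  show "potential_form u v = potential_form v u" for u v by (simp add: potential_form_def mult_ac)
  show "0 \<le> potential_form u u" if "u \<in> H.L2" for u using potential_form_bounds(1)[OF that] H.nonneg[OF that] by linarith
qed

lemma Hilbert_basis_polynomials:
  assumes on: "H.orthonormal \<phi> UNIV"
    and sp: "\<And>p. real_polynomial_function p \<Longrightarrow> p \<in> span (range \<phi>)"
  shows "Hilbert_basis H.L2 H.inner2 \<phi>"
proof
  show "H.orthonormal \<phi> UNIV" by (rule on)
  have \<phi>L: "\<phi> k \<in> H.L2" for k using on by (simp add: H.orthonormal_in)
  show "H.inner2 u u = 0" if u: "u \<in> H.L2" and 0: "\<And>k. H.inner2 u (\<phi> k) = 0" for u
  proof -
    have "subspace {v \<in> H.L2. H.inner2 u v = 0}"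
      using u by (auto simp: subspace_def H.add_right H.scale_right H.sym[of u 0] H.zero_left)
    then have "span (range \<phi>) \<subseteq> {v \<in> H.L2. H.inner2 u v = 0}"
      using \<phi>L 0 by (intro span_minimal) auto
    then have "AE x in \<Omega>. u x = 0" using sp by (intro AE_zero_if_orthogonal_L2 u) blast
    then show ?thesis using H.null_iff_AE[OF u] by simp
  qed
  show "\<exists>w\<in>H.L2. H.tends s w" if "\<And>n. s n \<in> H.L2"
    "\<And>\<epsilon>. \<epsilon> > 0 \<Longrightarrow> \<exists>N. \<forall>i\<ge>N. \<forall>j\<ge>N. H.inner2 (s i - s j) (s i - s j) \<le> \<epsilon>" for s
    by (rule H.complete[OF that])
qed

text \<open>The point is \<open>finite_energy\<close>: the gradients of the partial sums of the expansion of \<open>u\<close> are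
  orthogonal with squared norms \<open>l k \<langle>u, \<phi> k\<rangle>\<^sup>2\<close>, so if these sum up, the gradients converge in
  \<open>L\<^sup>2(\<Omega>, \<rho> \<Phi>)\<close>.  The defining identity of the weak gradient passes to the limit.\<close>

lemma diagonal_form_triangle:
  assumes on: "H.orthonormal \<phi> UNIV" and poly: "\<And>n. real_polynomial_function (\<phi> n)"
    and sp: "\<And>p. real_polynomial_function p \<Longrightarrow> p \<in> span (range \<phi>)"
    and eig: "\<And>n u. u \<in> H.L2 \<Longrightarrow> H.inner2 u (L0 (\<phi> n)) = monom_eigenvalue n * H.inner2 u (\<phi> n)"
  shows "diagonal_form H.L2 W H.inner2 energy potential_form \<phi> monom_eigenvalue 4"
proof -
  interpret Hilbert_basis H.L2 H.inner2 \<phi> by (rule Hilbert_basis_polynomials[OF on sp])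
  have gL: "gradient (\<phi> k) \<in> V.L2" for k by (intro poly_field_L2 poly_field_gradient poly)
  have orth: "V.inner2 (gradient (\<phi> i)) (gradient (\<phi> j)) = (if i = j then monom_eigenvalue i else 0)" for i j
    using L0_inner[OF poly poly, of i j] eig[OF polynomial_L2[OF poly], of i j] H.orthonormal_eq[OF on, of i j]
    by (auto split: if_splits)
  show ?thesis
  proof
    show "W \<subseteq> H.L2" by (auto simp: W_iff)
    show "\<phi> k \<in> W" for k by (intro polynomial_W poly)
    show "0 \<le> monom_eigenvalue k" for k by (rule monom_eigenvalue_nonneg)
    show "filterlim monom_eigenvalue at_top sequentially" by (rule monom_eigenvalue_at_top)
    show "potential_form u u \<le> 4 * H.inner2 u u" if "u \<in> H.L2" for u by (rule potential_form_bounds(2)[OF that])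
    show "energy u (\<phi> k) = monom_eigenvalue k * H.inner2 u (\<phi> k)" if u: "u \<in> W" for u k
    proof -
      have uL: "u \<in> H.L2" using u by (simp add: W_iff)
      have fL: "flux_div (gradient (\<phi> k)) \<in> H.L2"
        by (intro polynomial_L2 flux_div_polynomial poly_field_gradient poly)
      have "energy u (\<phi> k) = V.inner2 (wgrad u) (gradient (\<phi> k))"
        by (intro energy_eq u wgrad polynomial_W weak_grad_polynomial poly)
      also have "\<dots> = - H.inner2 u (flux_div (gradient (\<phi> k)))"
        using wgrad[OF u] poly_field_gradient[OF poly] by (simp add: is_weak_gradient_iff)
      also have "\<dots> = H.inner2 u ((-1) *\<^sub>R flux_div (gradient (\<phi> k)))"
        using H.scale_right[OF fL uL, of "-1"] by simp
      also have "(-1) *\<^sub>R flux_div (gradient (\<phi> k)) = L0 (\<phi> k)" by (simp add: fun_eq_iff L0_def)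
      finally show ?thesis using eig[OF uL] by simp
    qed
    show "u \<in> W \<and> energy u u \<le> C"
      if u: "u \<in> H.L2" and bound: "\<And>K. (\<Sum>k<K. monom_eigenvalue k * (H.inner2 u (\<phi> k))\<^sup>2) \<le> C" for u C
    proof -
      define S where "S K = H.proj \<phi> K u" for K
      define G where "G K = (\<Sum>k<K. H.inner2 u (\<phi> k) *\<^sub>R gradient (\<phi> k))" for K
      have SL: "S K \<in> H.L2" for K unfolding S_def by (rule H.proj_in[OF \<phi>_finite])
      have GL: "G K \<in> V.L2" for K unfolding G_def using gL by auto
      have SG: "weak_grad (S K) (G K)" for K
      proof (induction K)
        case 0
        then show ?case using weak_grad_zero by (simp add: S_def G_def H.proj_def zero_fun_def)
      next
        case (Suc K)
        have "weak_grad (H.inner2 u (\<phi> K) *\<^sub>R \<phi> K + S K) (H.inner2 u (\<phi> K) *\<^sub>R gradient (\<phi> K) + G K)"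
          by (intro weak_grad_combination weak_grad_polynomial poly polynomial_L2 SL Suc)
        moreover have "S (Suc K) = H.inner2 u (\<phi> K) *\<^sub>R \<phi> K + S K"
          "G (Suc K) = H.inner2 u (\<phi> K) *\<^sub>R gradient (\<phi> K) + G K"
          unfolding S_def G_def H.proj_def sum.lessThan_Suc by (rule add.commute)+
        ultimately show ?case by (simp only:)
      qed
      have Gsq: "V.inner2 (G K) (G K) \<le> C" for K
        using V.orthogonal_combination_square[of "{..<K}" "\<lambda>k. gradient (\<phi> k)" monom_eigenvalue] gL orth bound
        by (simp add: G_def)
      have "\<exists>N. \<forall>i\<ge>N. \<forall>j\<ge>N. V.inner2 (G i - G j) (G i - G j) \<le> \<epsilon>" if "\<epsilon> > 0" for \<epsilon>
        unfolding G_def by (rule V.orthogonal_series_Cauchy[OF gL orth bound that])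
      from V.complete[OF GL this] obtain h where h: "h \<in> V.L2" and t: "V.tends G h" by blast
      have St: "H.tends S u"
      proof -
        have "H.inner2 (S K - u) (S K - u) = H.inner2 (u - S K) (u - S K)" for K
          unfolding H.square_diff[OF SL u] H.square_diff[OF u SL] H.sym[OF SL u] by simp
        then show ?thesis using expansion_tends[OF u] by (simp add: H.tends_def S_def)
      qed
      have "H.inner2 u (flux_div w) = - V.inner2 h w" if w: "poly_field w" for w
      proof (rule LIMSEQ_unique)
        show "(\<lambda>K. H.inner2 (S K) (flux_div w)) \<longlonglongrightarrow> H.inner2 u (flux_div w)"
          by (rule H.tends_inner[OF SL u polynomial_L2[OF flux_div_polynomial[OF w]] St])
        have "(\<lambda>K. - V.inner2 (G K) w) \<longlonglongrightarrow> - V.inner2 h w"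
          by (intro tendsto_minus V.tends_inner[OF GL h poly_field_L2[OF w] t])
        then show "(\<lambda>K. H.inner2 (S K) (flux_div w)) \<longlonglongrightarrow> - V.inner2 h w"
          using SG w by (simp add: is_weak_gradient_iff)
      qed
      then have uh: "weak_grad u h" using h by (simp add: is_weak_gradient_iff)
      then have uW: "u \<in> W" using u by (auto simp: W_iff)
      have "energy u u = V.inner2 h h" by (rule energy_eq[OF uW uW uh uh])
      also have "\<dots> \<le> C" using LIMSEQ_le_const2[OF V.tends_square[OF GL h t]] Gsq by blast
      finally show ?thesis using uW by blast
    qed
  qed
qed

lemma W12_norm_eq: "W12_norm std_triangle \<rho> coeff_mat u = sqrt (H.inner2 u u + energy u u)"
  by (simp add: W12_norm_def H.inner2_def mass_form_def energy_def V.inner2_def gradient_form_def power2_eq_square)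

text \<open>The partial sums of the expansion in the eigenpolynomials approximate every element of
  \<open>W\<^sup>1\<^sup>,\<^sup>2\<close> in its norm, so taking the closure of the polynomials loses nothing.\<close>

lemma W_space_eq: "W_space std_triangle \<rho> coeff_mat = W"
proof
  show "W_space std_triangle \<rho> coeff_mat \<subseteq> W" by (auto simp: W_space_def)
  obtain \<phi> where on: "H.orthonormal \<phi> UNIV" and poly: "\<And>n. real_polynomial_function (\<phi> n)"
    and sp: "\<And>p. real_polynomial_function p \<Longrightarrow> p \<in> span (range \<phi>)"
    and eig: "\<And>n u. u \<in> H.L2 \<Longrightarrow> H.inner2 u (L0 (\<phi> n)) = monom_eigenvalue n * H.inner2 u (\<phi> n)"
    using eigenpolynomials by blast
  interpret D: diagonal_form H.L2 W H.inner2 energy potential_form \<phi> monom_eigenvalue 4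
    by (rule diagonal_form_triangle[OF on poly sp eig])
  show "W \<subseteq> W_space std_triangle \<rho> coeff_mat"
  proof
    fix u assume u: "u \<in> W"
    have "\<exists>p. real_polynomial_function p \<and> W12_norm std_triangle \<rho> coeff_mat (\<lambda>x. u x - p x) < \<epsilon>" if \<epsilon>: "\<epsilon> > 0" for \<epsilon>
    proof -
      have uH: "u \<in> H.L2" using u by (simp add: W_iff)
      have "(\<lambda>K. H.inner2 (u - H.proj \<phi> K u) (u - H.proj \<phi> K u) + energy (u - H.proj \<phi> K u) (u - H.proj \<phi> K u)) \<longlonglongrightarrow> 0 + 0"
        by (intro tendsto_add D.expansion_tends D.energy_expansion_tends u uH)
      then have "\<forall>\<^sub>F K in sequentially. H.inner2 (u - H.proj \<phi> K u) (u - H.proj \<phi> K u) + energy (u - H.proj \<phi> K u) (u - H.proj \<phi> K u) < \<epsilon>\<^sup>2"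
        using \<epsilon> by (intro order_tendstoD) auto
      then obtain K where K: "H.inner2 (u - H.proj \<phi> K u) (u - H.proj \<phi> K u) + energy (u - H.proj \<phi> K u) (u - H.proj \<phi> K u) < \<epsilon>\<^sup>2"
        by (auto simp: eventually_sequentially)
      let ?p = "H.proj \<phi> K u"
      have "?p \<in> Collect real_polynomial_function"
        unfolding H.proj_def using subspace_real_polynomials poly
        by (intro subspace_sum subspace_scale) auto
      moreover have "W12_norm std_triangle \<rho> coeff_mat (u - ?p) < \<epsilon>"
        unfolding W12_norm_eq using K \<epsilon> by (simp add: real_less_lsqrt)
      ultimately show ?thesis by (auto simp: fun_diff_def)
    qed
    then show "u \<in> W_space std_triangle \<rho> coeff_mat" using u by (simp add: W_space_def)
  qed
qed

lemma eigenfunction_iff: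
  "eigenfunction std_triangle \<rho> coeff_mat potential (helmholtz \<alpha> \<beta> \<gamma>) \<mu> u \<longleftrightarrow>
     u \<in> W \<and> H.inner2 u u \<noteq> 0 \<and> (\<forall>v\<in>W. energy v u + potential_form v u = \<mu> * H.inner2 v u)"
proof -
  have "(\<integral>x. v x * (\<mu> * u x) * \<rho> x \<partial>\<Omega>) = \<mu> * H.inner2 v u" for v
  proof -
    have "(\<integral>x. v x * (\<mu> * u x) * \<rho> x \<partial>\<Omega>) = (\<integral>x. \<mu> * mass_form x (v x) (u x) \<partial>\<Omega>)"
      by (simp add: mass_form_def mult_ac)
    then show ?thesis by (simp add: H.inner2_def)
  qed
  moreover have "(\<lambda>x. \<mu> * u x) \<in> H.L2" if "u \<in> W"
    using H.closed(4)[of u \<mu>] that by (simp add: W_iff scaleR_fun_def)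
  moreover have "(AE x in \<Omega>. u x = 0) \<longleftrightarrow> H.inner2 u u = 0" if "u \<in> W"
    using H.null_iff_AE[of u] that by (simp add: W_iff)
  ultimately show ?thesis
    unfolding eigenfunction_def weak_solution_def W_space_eq L2w_eq
    by (auto simp: helmholtz_divergence_form energy_def V.inner2_def gradient_form_def potential_form_def)
qed

abbreviation eigenfun :: "real \<Rightarrow> (real^2 \<Rightarrow> real) \<Rightarrow> bool" where
  "eigenfun \<equiv> eigenfunction std_triangle \<rho> coeff_mat potential (helmholtz \<alpha> \<beta> \<gamma>)"

lemma eigenvalue_pos:
  assumes "eigenfun \<mu> u"
  shows "\<mu> > 0"
proof -
  have u: "u \<in> W" "H.inner2 u u \<noteq> 0" "energy u u + potential_form u u = \<mu> * H.inner2 u u"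
    using assms by (auto simp: eigenfunction_iff)
  have uH: "u \<in> H.L2" using u by (simp add: W_iff)
  have "H.inner2 u u > 0" using H.nonneg[OF uH] u(2) by simp
  moreover have "2 * H.inner2 u u \<le> \<mu> * H.inner2 u u"
    using potential_form_bounds(1)[OF uH] E.nonneg[OF u(1)] u(3) by linarith
  ultimately show ?thesis by simp
qed

theorem eigenfunction_basis:
  obtains e \<nu> where "L2w_orthogonal_basis std_triangle \<rho> e" "\<And>n. eigenfun (\<nu> n) (e n)"
    "\<And>\<mu> u. eigenfun \<mu> u \<Longrightarrow> \<mu> \<in> range \<nu>" "incseq \<nu>" "filterlim \<nu> at_top sequentially"
proof -
  obtain \<phi> where on: "H.orthonormal \<phi> UNIV" and poly: "\<And>n. real_polynomial_function (\<phi> n)"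
    and sp: "\<And>p. real_polynomial_function p \<Longrightarrow> p \<in> span (range \<phi>)"
    and eig: "\<And>n u. u \<in> H.L2 \<Longrightarrow> H.inner2 u (L0 (\<phi> n)) = monom_eigenvalue n * H.inner2 u (\<phi> n)"
    using eigenpolynomials by blast
  interpret D: diagonal_form H.L2 W H.inner2 energy potential_form \<phi> monom_eigenvalue 4
    by (rule diagonal_form_triangle[OF on poly sp eig])
  obtain e \<nu> where e: "D.perturbed.orthonormal e UNIV"
    and eigen: "\<And>n v. v \<in> W \<Longrightarrow> energy (e n) v + potential_form (e n) v = \<nu> n * H.inner2 (e n) v"
    and inc: "incseq \<nu>" and top: "filterlim \<nu> at_top sequentially"
    and approx: "\<And>u \<epsilon>. u \<in> W \<Longrightarrow> \<epsilon> > 0 \<Longrightarrow>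
        \<exists>N. H.inner2 (u - D.perturbed.proj e N u) (u - D.perturbed.proj e N u) \<le> \<epsilon>"
    and all: "\<And>u \<mu>. u \<in> W \<Longrightarrow> H.inner2 u u \<noteq> 0 \<Longrightarrow>
        (\<And>v. v \<in> W \<Longrightarrow> energy v u + potential_form v u = \<mu> * H.inner2 v u) \<Longrightarrow> \<mu> \<in> range \<nu>"
    using D.perturbed.spectral by metis
  have WH: "u \<in> H.L2" if "u \<in> W" for u using that by (simp add: W_iff)
  have eW: "e n \<in> W" and ee: "H.inner2 (e m) (e n) = (if m = n then 1 else 0)" for m n
    using e by (auto simp: D.perturbed.orthonormal_in D.perturbed.orthonormal_eq)
  have ef: "eigenfun (\<nu> n) (e n)" for n
    unfolding eigenfunction_iff
  proof (intro conjI ballI)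
    show "energy v (e n) + potential_form v (e n) = \<nu> n * H.inner2 v (e n)" if v: "v \<in> W" for v
      using eigen[OF v, of n] E.sym[OF v eW] Q.sym[OF WH[OF v] WH[OF eW]] H.sym[OF WH[OF v] WH[OF eW]] by simp
  qed (use eW ee in auto)
  have all': "\<mu> \<in> range \<nu>" if "eigenfun \<mu> u" for \<mu> u
    using all[of u \<mu>] that by (auto simp: eigenfunction_iff)
  have basis: "L2w_orthogonal_basis std_triangle \<rho> e"
    unfolding L2w_orthogonal_basis_def L2w_eq L2w_inner_eq
  proof (intro conjI allI ballI impI)
    show "e n \<in> H.L2" for n using WH[OF eW] .
    show "\<not> (AE x in \<Omega>. e n x = 0)" for n using H.null_iff_AE[OF WH[OF eW], of n] ee[of n n] by simp
    show "H.inner2 (e m) (e n) = 0" if "m \<noteq> n" for m n using ee that by simp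
    fix u \<epsilon> assume u: "u \<in> H.L2" and \<epsilon>: "\<epsilon> > (0::real)"
    \<comment> \<open>Approximate \<open>u\<close> by a polynomial \<open>p\<close>, which has finite energy, and \<open>p\<close> by eigenfunctions.\<close>
    have \<epsilon>2: "\<epsilon>\<^sup>2 / 5 > 0" using \<epsilon> by simp
    have "\<forall>\<^sub>F K in sequentially. H.inner2 (u - H.proj \<phi> K u) (u - H.proj \<phi> K u) < \<epsilon>\<^sup>2 / 5"
      using D.expansion_tends[OF u] \<epsilon>2 by (rule order_tendstoD)
    then obtain K where K: "H.inner2 (u - H.proj \<phi> K u) (u - H.proj \<phi> K u) < \<epsilon>\<^sup>2 / 5"
      by (auto simp: eventually_sequentially)
    define p where "p = H.proj \<phi> K u"
    have p: "p \<in> W" unfolding p_def H.proj_def using D.\<phi>_in by auto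
    obtain N where N: "H.inner2 (p - D.perturbed.proj e N p) (p - D.perturbed.proj e N p) \<le> \<epsilon>\<^sup>2 / 5"
      using approx[OF p \<epsilon>2] by blast
    define s where "s = D.perturbed.proj e N p"
    have s: "s \<in> W" unfolding s_def D.perturbed.proj_def using eW by auto
    have "H.inner2 (u - s) (u - s) = H.inner2 ((u - p) - (s - p)) ((u - p) - (s - p))" by simp
    also have "\<dots> \<le> 2 * H.inner2 (u - p) (u - p) + 2 * H.inner2 (s - p) (s - p)"
      using u WH[OF p] WH[OF s] by (intro H.square_diff_le) auto
    also have "H.inner2 (s - p) (s - p) = H.inner2 (p - s) (p - s)"
      using H.square_diff[OF WH[OF s] WH[OF p]] H.square_diff[OF WH[OF p] WH[OF s]] H.sym[OF WH[OF s] WH[OF p]] by simp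
    also have "2 * H.inner2 (u - p) (u - p) + 2 * H.inner2 (p - s) (p - s) < \<epsilon>\<^sup>2"
      using K N \<epsilon>2 unfolding p_def[symmetric] s_def[symmetric] by linarith
    finally have "H.inner2 (u - s) (u - s) < \<epsilon>\<^sup>2" .
    from real_less_lsqrt[OF _ this] have less: "sqrt (H.inner2 (u - s) (u - s)) < \<epsilon>" using \<epsilon> by argo
    have eq: "u - s = (\<lambda>x. u x - (\<Sum>n<N. H.inner2 p (e n) * e n x))"
      by (simp add: fun_eq_iff s_def D.perturbed.proj_def sum_fun_apply)
    show "\<exists>N c. let r = \<lambda>x. u x - (\<Sum>n<N. c n * e n x) in sqrt (H.inner2 r r) < \<epsilon>"
      using less unfolding eq Let_def by (intro exI[of _ N] exI[of _ "\<lambda>n. H.inner2 p (e n)"])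
  qed
  show thesis by (rule that[OF basis ef all' inc top])
qed

end

theorem proposition18:
  fixes \<alpha> \<beta> \<gamma> :: real
  assumes "\<alpha> > -1" and "\<beta> > -1" and "\<gamma> > -1"
  shows "\<exists>(e :: nat \<Rightarrow> real^2 \<Rightarrow> real) (\<nu> :: nat \<Rightarrow> real).
      L2w_orthogonal_basis std_triangle (weight \<alpha> \<beta> \<gamma>) e
    \<and> (\<forall>n. eigenfunction std_triangle (weight \<alpha> \<beta> \<gamma>) coeff_mat potential (helmholtz \<alpha> \<beta> \<gamma>) (\<nu> n) (e n))
    \<and> (\<forall>\<mu>. eigenvalue std_triangle (weight \<alpha> \<beta> \<gamma>) coeff_mat potential (helmholtz \<alpha> \<beta> \<gamma>) \<mu> \<longrightarrow> \<mu> > 0)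
    \<and> range \<nu> = {\<mu>. eigenvalue std_triangle (weight \<alpha> \<beta> \<gamma>) coeff_mat potential (helmholtz \<alpha> \<beta> \<gamma>) \<mu>}
    \<and> incseq \<nu> \<and> filterlim \<nu> at_top sequentially"
proof -
  interpret triangle_weight \<alpha> \<beta> \<gamma> using assms by unfold_locales
  obtain e \<nu> where e: "L2w_orthogonal_basis std_triangle \<rho> e" "\<And>n. eigenfun (\<nu> n) (e n)"
      "\<And>\<mu> u. eigenfun \<mu> u \<Longrightarrow> \<mu> \<in> range \<nu>" "incseq \<nu>" "filterlim \<nu> at_top sequentially"
    using eigenfunction_basis by blast
  have "range \<nu> = {\<mu>. eigenvalue std_triangle \<rho> coeff_mat potential (helmholtz \<alpha> \<beta> \<gamma>) \<mu>}"
    using e(2,3) unfolding eigenvalue_def by blast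
  moreover have "\<forall>\<mu>. eigenvalue std_triangle \<rho> coeff_mat potential (helmholtz \<alpha> \<beta> \<gamma>) \<mu> \<longrightarrow> \<mu> > 0"
    using eigenvalue_pos unfolding eigenvalue_def by blast
  ultimately show ?thesis
    using e(1,2,4,5) by (intro exI[of _ e] exI[of _ \<nu>] conjI) auto
qed

end
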